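(* There exist numerical constants $C,C'>0$ such that the following holds. If $d\ge 3$ is an integer with $d\ge C'$, then for any $\sigma$ with $0<\sigma<1$ and $\sigma\le\left(C d^3(\ln d)^{1/2}\ln(d/\sigma)\right)^{-1}$ and any integers $t,s,\ell\ge1$, any $(t,s,\ell)$-algorithm identifying $\mu\in\mathcal G_\sigma$ with error $1/6$ satisfies $$ts\ell\ge\frac{d^2}{C\,\sigma^2\,\ln^3 d\,\ln^2(1/\sigma)}.$$
   Context: Let $\mathcal I_2=\{I\subseteq\{1,\dots,d\}\colon|I|=2\}$. For $I\in\mathcal I_2$ and $0<\sigma<1$, $\eta_{I,\sigma}$ is the zero-mean Gaussian distribution on $\mathbb R^d$ with covariance matrix $\Sigma_{I,\sigma}$ given by $\Sigma_{I,\sigma}(i,j)=1$ if $i=j$, $\Sigma_{I,\sigma}(i,j)=\sigma$ if $I=\{i,j\}$, and $0$ otherwise. $\mathcal G_\sigma=\{\eta_{I,\sigma}\colon I\in\mathcal I_2\}$. Memory-limited algorithms: a $(t,s,\ell)$-algorithm identifying a distribution in a finite family with error $\varepsilon$ receives $t$ i.i.d. samples from some member $\mu$ of the family and goes over them sequentially in $\ell$ passes using at most $s$ bits of memory: letting $x_1,\dots,x_{t\ell}$ be $\ell$ copies of the data set in order, its memory states $u_j\in\{0,1\}^s$ satisfy $u_{j+1}=f_j(x_j,u_j)$ for arbitrary functions $f_j$, and its output is a function of $u_{t\ell+1}$. For every member $\mu$ of the family, when the data is generated by $\mu$, the algorithm outputs (the index of) $\mu$ with probability at least $1-\varepsilon$.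 *)

theory Defs
  imports
    "HOL-Probability.Probability"
    "Jordan_Normal_Form.Determinant"
    "Jordan_Normal_Form.Gauss_Jordan_Elimination"
begin

text \<open>
  Since the dimension is quantified inside the statement, \<open>d\<close>-dimensional space is rendered as the
  extensional functions on \<open>{..<d}\<close>, with Lebesgue measure \<^term>\<open>Pi\<^sub>M {..<d} (\<lambda>_. lborel)\<close>;
  coordinates run from \<open>0\<close> to \<open>d - 1\<close> instead of \<open>1\<close> to \<open>d\<close>.
\<close>

text \<open>The zero-mean Gaussian distribution with a (positive definite) covariance matrix \<open>S\<close>, given by
  its density \<open>exp (- x\<^sup>T S\<^sup>-\<^sup>1 x / 2) / sqrt ((2 \<pi>)\<^sup>d det S)\<close>.\<close>

definition centered_gaussian :: "nat \<Rightarrow> real mat \<Rightarrow> (nat \<Rightarrow> real) measure" where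
  "centered_gaussian d S =
     density (Pi\<^sub>M {..<d} (\<lambda>_. lborel))
       (\<lambda>x. ennreal
          (exp (- (\<Sum>i<d. \<Sum>j<d. x i * the (mat_inverse S) $$ (i, j) * x j) / 2)
             / sqrt ((2 * pi) ^ d * Determinant.det S)))"

definition pair_sets :: "nat \<Rightarrow> nat set set" where
  "pair_sets d = {I. I \<subseteq> {..<d} \<and> card I = 2}"

definition pair_cov :: "nat \<Rightarrow> real \<Rightarrow> nat set \<Rightarrow> real mat" where
  "pair_cov d \<sigma> I =
     mat d d (\<lambda>(i, j). if i = j then 1 else if I = {i, j} then \<sigma> else 0)"

definition pair_gaussian :: "nat \<Rightarrow> real \<Rightarrow> nat set \<Rightarrow> (nat \<Rightarrow> real) measure" where
  "pair_gaussian d \<sigma> I = centered_gaussian d (pair_cov d \<sigma> I)"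

text \<open>
  The memory state after \<open>j\<close> steps on the data set \<open>x 0, \<dots>, x (t - 1)\<close>, started in state \<open>u\<close>.
  The \<open>j\<close>-th entry of the repeated data stream is \<open>x (j mod t)\<close>.
\<close>

primrec memory_state ::
  "nat \<Rightarrow> (nat \<Rightarrow> 'x \<Rightarrow> bool list \<Rightarrow> bool list) \<Rightarrow> bool list \<Rightarrow> (nat \<Rightarrow> 'x) \<Rightarrow> nat \<Rightarrow> bool list"
where
  "memory_state t f u x 0 = u"
| "memory_state t f u x (Suc j) = f j (x (j mod t)) (memory_state t f u x j)"

text \<open>
  The algorithm with update functions \<open>f\<close>, initial state \<open>u\<close> and output function \<open>h\<close> is a
  \<open>(t, s, l)\<close>-algorithm identifying a member of the family \<open>(M i)\<^sub>i\<^sub>\<in>\<^sub>K\<close> with error \<open>\<epsilon>\<close>. Memory states are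
  bit strings of length \<open>s\<close>. The update functions need not be measurable; as \<^const>\<open>measure\<close> is \<open>0\<close> on
  non-measurable sets, for \<open>\<epsilon> < 1\<close> the last condition includes measurability of the success event.
\<close>

definition identifying_algorithm ::
  "nat \<Rightarrow> nat \<Rightarrow> nat \<Rightarrow> 'i set \<Rightarrow> ('i \<Rightarrow> 'x measure) \<Rightarrow> real \<Rightarrow>
   (nat \<Rightarrow> 'x \<Rightarrow> bool list \<Rightarrow> bool list) \<Rightarrow> bool list \<Rightarrow> (bool list \<Rightarrow> 'i) \<Rightarrow> bool"
where
  "identifying_algorithm t s l K M \<epsilon> f u h \<longleftrightarrow>
     length u = s \<and>
     (\<forall>i\<in>K. \<forall>x\<in>space (M i). \<forall>j<t * l. \<forall>v. length v = s \<longrightarrow> length (f j x v) = s) \<and>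
     (\<forall>i\<in>K. measure (Pi\<^sub>M {..<t} (\<lambda>_. M i))
        {x \<in> space (Pi\<^sub>M {..<t} (\<lambda>_. M i)). h (memory_state t f u x (t * l)) = i} \<ge> 1 - \<epsilon>)"

end

theory Submission
  imports Defs
begin

text \<open>
  Compare the transcript of the algorithm when all samples are standard Gaussian with its transcript
  under correlation in the pair \<open>I\<close>. Cut the data into blocks of \<open>k = 2 s l\<close> samples and record the
  memory states at the block ends. Given the transcript \<open>\<pi>\<close> the blocks are independent, and block \<open>j\<close>
  contributes the factor \<open>E[L\<^sub>I | A\<^sub>j(\<pi>)]\<close> to the likelihood ratio of \<open>\<pi>\<close>, where \<open>L\<^sub>I\<close> is the likelihood
  ratio of the block and \<open>A\<^sub>j(\<pi>)\<close> the set of block data consistent with \<open>\<pi>\<close>. To identify \<open>I\<close>, the sum over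
  \<open>j\<close> of the second moments of these factors minus 1 must be at least a constant.

  On the other hand \<open>L\<^sub>I - 1\<close> is \<open>\<sigma> Q\<^sub>I\<close> up to a remainder of second moment \<open>O(k\<^sup>2 \<sigma>\<^sup>4)\<close>, where \<open>Q\<^sub>I\<close> sums the
  products of the two coordinates over the block. A block of that size is long enough for the \<open>Q\<^sub>I\<close> to be
  jointly sub-Gaussian at the relevant scale, so that the sum over \<open>I\<close> of the squared conditional means
  of the \<open>Q\<^sub>I\<close> is of order \<open>k log (1 / P(A\<^sub>j(\<pi>)))\<close>, on average at most of order \<open>k s l\<close>. Summing over the
  \<open>t / k\<close> blocks and the \<open>d\<^sup>2 / 4\<close> pairs joining the two halves of the coordinates gives
  \<open>d\<^sup>2 = O(\<sigma>\<^sup>2 t s l)\<close>.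
\<close>

section \<open>Product measures\<close>

text \<open>The features are quadratic in Gaussian variables, so their exponential moments are
  controlled only for coefficient vectors in a ball of fixed radius, however long the block is.
  Conditioning a block of k samples on an event of probability p therefore moves the vector of
  feature means by O(sqrt (k ln (1 / p))) only while ln (1 / p) = O(k); beyond that the bound is
  O(ln (1 / p)). On typical cells ln (1 / p) is of order s l, which makes blocks of length
  comparable to s l the shortest useful ones. The number s l arises because a block is read l times
  and each reading leaves s bits: with the other blocks fixed, at most 2^(s l) transcripts remain.
  Deviations are measured by second moments because the centred factors of distinct blocks are
  uncorrelated under the standard Gaussian law, so that their sum is controlled along with the
  individual factors. The remainders, summed over the pairs, contribute about d^2 (k \<sigma>^2)^2
  per block, which stays within the order k^2 \<sigma>^2 of the main term when d \<sigma> \<le>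
  1.\<close>

lemma PiM_density:
  fixes M :: "'i \<Rightarrow> 'a measure" and f :: "'i \<Rightarrow> 'a \<Rightarrow> ennreal"
  assumes fin: "finite I" and M: "\<And>i. sigma_finite_measure (M i)"
    and f: "\<And>i. f i \<in> borel_measurable (M i)"
    and D: "\<And>i. sigma_finite_measure (density (M i) (f i))"
  shows "PiM I (\<lambda>i. density (M i) (f i)) = density (PiM I M) (\<lambda>x. \<Prod>i\<in>I. f i (x i))"
proof -
  interpret M: product_sigma_finite M by (rule product_sigma_finite.intro) (rule M)
  interpret D: product_sigma_finite "\<lambda>i. density (M i) (f i)" by (rule product_sigma_finite.intro) (rule D)
  have [measurable]: "f i \<in> borel_measurable (M i)" for i by (rule f)
  have fP[measurable]: "(\<lambda>x. \<Prod>i\<in>I. f i (x i)) \<in> borel_measurable (PiM I M)"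
    by measurable
  show ?thesis
  proof (rule D.PiM_eqI[symmetric])
    show "finite I" by fact
    show "sets (density (Pi\<^sub>M I M) (\<lambda>x. \<Prod>i\<in>I. f i (x i))) = sets (\<Pi>\<^sub>M i\<in>I. density (M i) (f i))"
      by (simp cong: sets_PiM_cong)
    fix A assume A: "\<And>i. i \<in> I \<Longrightarrow> A i \<in> sets (density (M i) (f i))"
    then have A'[measurable]: "\<And>i. i \<in> I \<Longrightarrow> A i \<in> sets (M i)" by simp
    have AP: "Pi\<^sub>E I A \<in> sets (PiM I M)" using fin A' by (intro sets_PiM_I_finite) auto
    have "emeasure (density (Pi\<^sub>M I M) (\<lambda>x. \<Prod>i\<in>I. f i (x i))) (Pi\<^sub>E I A)
        = (\<integral>\<^sup>+x. (\<Prod>i\<in>I. f i (x i)) * indicator (Pi\<^sub>E I A) x \<partial>PiM I M)"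
      using AP by (simp add: emeasure_density)
    also have "\<dots> = (\<integral>\<^sup>+x. (\<Prod>i\<in>I. f i (x i) * indicator (A i) (x i)) \<partial>PiM I M)"
    proof (rule nn_integral_cong)
      fix x assume x: "x \<in> space (PiM I M)"
      have "(indicator (Pi\<^sub>E I A) x :: ennreal) = (\<Prod>i\<in>I. indicator (A i) (x i))"
        using x fin by (auto simp: space_PiM PiE_iff indicator_def prod_zero_iff)
      then show "(\<Prod>i\<in>I. f i (x i)) * indicator (Pi\<^sub>E I A) x = (\<Prod>i\<in>I. f i (x i) * indicator (A i) (x i))"
        by (simp add: prod.distrib)
    qed
    also have "\<dots> = (\<Prod>i\<in>I. \<integral>\<^sup>+x. f i x * indicator (A i) x \<partial>M i)"
      using fin by (intro M.product_nn_integral_prod) auto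
    also have "\<dots> = (\<Prod>i\<in>I. emeasure (density (M i) (f i)) (A i))"
      by (intro prod.cong refl) (simp add: emeasure_density)
    finally show "emeasure (density (Pi\<^sub>M I M) (\<lambda>x. \<Prod>i\<in>I. f i (x i))) (Pi\<^sub>E I A)
        = (\<Prod>i\<in>I. emeasure (density (M i) (f i)) (A i))" .
  qed
qed

lemma indep_vars_coordinates:
  fixes M :: "'i \<Rightarrow> 'a measure"
  assumes M: "\<And>i. prob_space (M i)"
  shows "prob_space.indep_vars (PiM I M) M (\<lambda>i x. x i) I"
proof (cases "I = {}")
  case True
  interpret product_prob_space M I by (rule product_prob_spaceI) (rule M)
  show ?thesis unfolding P.indep_vars_def P.indep_sets_def using True by simp
next
  case False
  interpret product_prob_space M I by (rule product_prob_spaceI) (rule M)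
  have "distr (PiM I M) (PiM I M) (\<lambda>x. \<lambda>i\<in>I. x i) = distr (PiM I M) (PiM I M) (\<lambda>x. x)"
    by (intro distr_cong refl) (auto simp: space_PiM PiE_restrict)
  then have "distr (PiM I M) (PiM I M) (\<lambda>x. \<lambda>i\<in>I. x i) = PiM I M" by simp
  also have "\<dots> = PiM I (\<lambda>i. distr (PiM I M) (M i) (\<lambda>x. x i))"
    by (intro PiM_cong refl) (simp add: PiM_component)
  finally show ?thesis
    using False by (subst P.indep_vars_iff_distr_eq_PiM') auto
qed

lemma indep_vars_blocks:
  fixes M :: "'i \<Rightarrow> 'a measure" and H :: "'j \<Rightarrow> ('i \<Rightarrow> 'a) \<Rightarrow> real"
  assumes M: "\<And>i. prob_space (M i)"
    and G: "\<And>j. j \<in> J \<Longrightarrow> G j \<subseteq> I" "disjoint_family_on G J"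
    and H: "\<And>j. j \<in> J \<Longrightarrow> H j \<in> borel_measurable (PiM (G j) M)"
  shows "prob_space.indep_vars (PiM I M) (\<lambda>_. borel) (\<lambda>j x. H j (restrict x (G j))) J"
proof -
  interpret product_prob_space M I by (rule product_prob_spaceI) (rule M)
  have "P.indep_vars (\<lambda>j. PiM (G j) M) (\<lambda>j x. restrict (\<lambda>i. x i) (G j)) J"
    using G by (intro P.indep_vars_restrict[OF indep_vars_coordinates[OF M]]) auto
  from P.indep_vars_compose2[OF this, of H "\<lambda>_. borel"] H show ?thesis by simp
qed

section \<open>Testing between two product-form distributions on transcripts\<close>

text \<open>This is x - 2 x^2 \<le> ln (1 + x) in exponential form; the constant 2 is that of the
  logarithm bound applied to negative x.\<close>

lemma exp_diff_square_le:
  fixes x :: real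
  assumes "\<bar>x\<bar> \<le> 1 / 2"
  shows "exp (x - 2 * x\<^sup>2) \<le> 1 + x"
proof (cases "x \<ge> 0")
  case True
  have "x - 2 * x\<^sup>2 \<le> x - x\<^sup>2" by simp
  also have "\<dots> \<le> ln (1 + x)"
    using True assms by (intro ln_one_plus_pos_lower_bound) auto
  finally show ?thesis using True by (simp add: ln_ge_iff)
next
  case False
  have "- (- x) - 2 * (- x)\<^sup>2 \<le> ln (1 - (- x))"
    using False assms by (intro ln_one_minus_pos_lower_bound) auto
  then show ?thesis using False assms by (simp add: ln_ge_iff)
qed

text \<open>A likelihood ratio is bounded below by statistics whose means are computable. If the sum
  of squares and the square of the sum are both at most 1/4, the product is at least exp (-1/2 -
  2/4) = exp (-1) > 1/4; otherwise the right side is at most 0 and the product is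
  nonnegative.\<close>

lemma prod_one_plus_ge:
  fixes x :: "'j \<Rightarrow> real"
  assumes fin: "finite J" and x: "\<And>j. j \<in> J \<Longrightarrow> x j \<ge> -1"
  shows "(\<Prod>j\<in>J. 1 + x j) \<ge> (1 - 4 * (\<Sum>j\<in>J. (x j)\<^sup>2) - 4 * (\<Sum>j\<in>J. x j)\<^sup>2) / 4"
proof (cases "(\<Sum>j\<in>J. (x j)\<^sup>2) \<le> 1 / 4 \<and> (\<Sum>j\<in>J. x j)\<^sup>2 \<le> 1 / 4")
  case True
  have small: "\<bar>x j\<bar> \<le> 1 / 2" if "j \<in> J" for j
  proof -
    have "(x j)\<^sup>2 \<le> (\<Sum>j\<in>J. (x j)\<^sup>2)" using that fin by (intro member_le_sum) auto
    then have "(x j)\<^sup>2 \<le> (1 / 2)\<^sup>2" using True by (simp add: power2_eq_square)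
    then show ?thesis by (simp add: abs_le_square_iff[symmetric])
  qed
  have "\<bar>\<Sum>j\<in>J. x j\<bar> \<le> 1 / 2"
    using True abs_le_square_iff[of "\<Sum>j\<in>J. x j" "1 / 2"] by (simp add: power2_eq_square)
  then have "-1 \<le> (\<Sum>j\<in>J. x j) - 2 * (\<Sum>j\<in>J. (x j)\<^sup>2)" using True by linarith
  then have "exp (-1) \<le> exp (\<Sum>j\<in>J. x j - 2 * (x j)\<^sup>2)"
    by (simp add: sum_subtractf sum_distrib_left)
  also have "\<dots> = (\<Prod>j\<in>J. exp (x j - 2 * (x j)\<^sup>2))" using fin by (simp add: exp_sum)
  also have "\<dots> \<le> (\<Prod>j\<in>J. 1 + x j)"
    by (intro prod_mono conjI exp_diff_square_le small) auto
  finally have "exp (-1) \<le> (\<Prod>j\<in>J. 1 + x j)" .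
  moreover have "exp (-1::real) \<ge> 1 / 4"
  proof -
    have "exp (1::real) \<le> 4" using exp_le by simp
    then have "1 / 4 \<le> 1 / exp (1::real)" by (intro divide_left_mono) auto
    then show ?thesis by (simp add: exp_minus field_simps)
  qed
  moreover have "(1 - 4 * (\<Sum>j\<in>J. (x j)\<^sup>2) - 4 * (\<Sum>j\<in>J. x j)\<^sup>2) / 4 \<le> 1 / 4"
    by (simp add: sum_nonneg add_nonneg_nonneg diff_le_eq add_increasing2)
  ultimately show ?thesis by (meson order_trans)
next
  case False
  have aux: "(1 - 4 * v - 4 * s) / 4 \<le> 0" if "0 \<le> v" "0 \<le> s" "\<not> (v \<le> 1 / 4 \<and> s \<le> 1 / 4)" for v s :: real
  proof -
    have "1 / 4 < v \<or> 1 / 4 < s" using that(3) by auto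
    then have "1 \<le> 4 * v + 4 * s" using that(1,2) by (elim disjE) linarith+
    then show ?thesis by simp
  qed
  have "0 \<le> (\<Sum>j\<in>J. (x j)\<^sup>2)" by (simp add: sum_nonneg)
  moreover have "0 \<le> (\<Sum>j\<in>J. x j)\<^sup>2" by simp
  ultimately have "(1 - 4 * (\<Sum>j\<in>J. (x j)\<^sup>2) - 4 * (\<Sum>j\<in>J. x j)\<^sup>2) / 4 \<le> 0"
    using aux[OF _ _ False] by blast
  also have "0 \<le> (\<Prod>j\<in>J. 1 + x j)"
  proof (rule prod_nonneg)
    fix j assume "j \<in> J"
    from x[OF this] show "0 \<le> 1 + x j" by linarith
  qed
  finally show ?thesis .
qed

text \<open>Under \<open>w\<close> the \<open>x j\<close> are the centred likelihood ratios of the individual parties; they are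
  uncorrelated, so that the sum of the \<open>x j\<close> has the same second moment as its quadratic variation.\<close>

lemma testing_lower_bound:
  fixes w :: "'p \<Rightarrow> real" and x :: "'j \<Rightarrow> 'p \<Rightarrow> real"
  assumes fin: "finite T" "finite J" and w: "\<And>p. p \<in> T \<Longrightarrow> w p \<ge> 0"
    and x: "\<And>j p. j \<in> J \<Longrightarrow> p \<in> T \<Longrightarrow> x j p \<ge> -1"
    and uncorrelated: "\<And>a b. a \<in> J \<Longrightarrow> b \<in> J \<Longrightarrow> a \<noteq> b \<Longrightarrow> (\<Sum>p\<in>T. w p * (x a p * x b p)) = 0"
    and T': "T' \<subseteq> T" "(\<Sum>p\<in>T'. w p) \<ge> 5 / 6" "(\<Sum>p\<in>T'. w p * (\<Prod>j\<in>J. 1 + x j p)) \<le> 1 / 6"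
  shows "(\<Sum>j\<in>J. \<Sum>p\<in>T. w p * (x j p)\<^sup>2) \<ge> 1 / 48"
proof -
  define D where "D = (\<Sum>j\<in>J. \<Sum>p\<in>T. w p * (x j p)\<^sup>2)"
  define V where "V p = (\<Sum>j\<in>J. (x j p)\<^sup>2)" for p
  define S where "S p = (\<Sum>j\<in>J. x j p)\<^sup>2" for p
  have finT': "finite T'" using T'(1) fin(1) finite_subset by blast
  have DV: "(\<Sum>p\<in>T. w p * V p) = D"
    unfolding D_def V_def by (subst sum.swap) (simp add: sum_distrib_left)
  \<comment> \<open>Expand the square: only the diagonal survives, so \<open>S\<close> and
    \<open>V\<close> have the same weighted sum \<open>D\<close>.\<close>
  have "(\<Sum>p\<in>T. w p * S p) = (\<Sum>p\<in>T. \<Sum>a\<in>J. \<Sum>b\<in>J. w p * (x a p * x b p))"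
    unfolding S_def by (simp only: power2_eq_square sum_product) (simp add: sum_distrib_left)
  also have "\<dots> = (\<Sum>a\<in>J. \<Sum>p\<in>T. \<Sum>b\<in>J. w p * (x a p * x b p))" by (rule sum.swap)
  also have "\<dots> = (\<Sum>a\<in>J. \<Sum>b\<in>J. \<Sum>p\<in>T. w p * (x a p * x b p))"
    by (intro sum.cong refl sum.swap)
  also have "\<dots> = (\<Sum>a\<in>J. \<Sum>b\<in>J. if a = b then \<Sum>p\<in>T. w p * (x a p)\<^sup>2 else 0)"
    by (intro sum.cong refl) (auto simp: uncorrelated power2_eq_square)
  also have "\<dots> = D" unfolding D_def using fin by (simp add: sum.delta')
  finally have DS: "(\<Sum>p\<in>T. w p * S p) = D" .
  have sub: "(\<Sum>p\<in>T'. w p * F p) \<le> (\<Sum>p\<in>T. w p * F p)" if "\<And>p. F p \<ge> 0" for F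
    using T'(1) fin w that by (intro sum_mono2) auto
  have "(\<Sum>p\<in>T'. w p * ((1 - 4 * V p - 4 * S p) / 4)) \<le> (\<Sum>p\<in>T'. w p * (\<Prod>j\<in>J. 1 + x j p))"
    unfolding V_def S_def using T'(1)
    by (intro sum_mono mult_left_mono prod_one_plus_ge fin x w) auto
  also have "\<dots> \<le> 1 / 6" by fact
  finally have "(\<Sum>p\<in>T'. w p * ((1 - 4 * V p - 4 * S p) / 4)) \<le> 1 / 6" .
  moreover have "(\<Sum>p\<in>T'. w p * ((1 - 4 * V p - 4 * S p) / 4))
      = (\<Sum>p\<in>T'. w p) / 4 - (\<Sum>p\<in>T'. w p * V p) - (\<Sum>p\<in>T'. w p * S p)"
    by (simp add: sum_divide_distrib sum_subtractf[symmetric] field_simps)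
  moreover have "(\<Sum>p\<in>T'. w p * V p) \<le> D" "(\<Sum>p\<in>T'. w p * S p) \<le> D"
    using sub[of V] sub[of S] DV DS by (auto simp: V_def S_def sum_nonneg)
  \<comment> \<open>The inequalities combine to 5/24 - 2 D \<le> 1/6, that is D \<ge> 1/48.\<close>
  ultimately show ?thesis using T'(2) unfolding D_def[symmetric] by linarith
qed

section \<open>Features that are jointly sub-Gaussian, conditioned on an event\<close>

text \<open>The right side is shaped for summation over transcripts: the first term is linear in p
  and sums to a total probability, the second does not depend on p and is small enough to survive
  multiplication by exp \<beta>. For p \<ge> exp (-\<beta>) the first term suffices, for smaller p
  the second.\<close>

lemma log_square_bound:
  fixes p \<beta> :: real
  assumes "0 < p" "p \<le> 1" "\<beta> \<ge> 1"
  shows "p * (\<beta> - ln p)\<^sup>2 \<le> 4 * p * \<beta>\<^sup>2 + 8 * \<beta>\<^sup>2 * exp (- \<beta>)"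
proof -
  define u where "u = - ln p"
  have u: "u \<ge> 0" "p = exp (- u)" using assms by (auto simp: u_def)
  show ?thesis
  proof (cases "u \<le> \<beta>")
    case True
    have "(\<beta> + u)\<^sup>2 \<le> (2 * \<beta>)\<^sup>2" using u True by (intro power_mono) auto
    then have "p * (\<beta> + u)\<^sup>2 \<le> p * (4 * \<beta>\<^sup>2)"
      using assms by (intro mult_left_mono) (auto simp: power_mult_distrib)
    moreover have "8 * \<beta>\<^sup>2 * exp (- \<beta>) \<ge> 0" by simp
    ultimately have "p * (\<beta> + u)\<^sup>2 \<le> 4 * p * \<beta>\<^sup>2 + 8 * \<beta>\<^sup>2 * exp (- \<beta>)" by linarith
    then show ?thesis by (simp add: u_def)
  next
    case False
    \<comment> \<open>With p = exp (-\<beta>) exp (-z), the growth (1 + z)^2 \<le> 2 exp z of the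
      squared logarithm is absorbed by the factor exp (-z).\<close>
    define z where "z = u - \<beta>"
    have z: "z \<ge> 0" using False by (simp add: z_def)
    have "\<beta> + u \<le> (2 * \<beta>) * (1 + z)"
      using assms(3) z mult_right_mono[of 1 \<beta> z] by (simp add: z_def algebra_simps)
    then have "(\<beta> + u)\<^sup>2 \<le> ((2 * \<beta>) * (1 + z))\<^sup>2" using assms u by (intro power_mono) auto
    also have "\<dots> = 4 * \<beta>\<^sup>2 * (1 + z)\<^sup>2" by (simp add: power_mult_distrib)
    also have "\<dots> \<le> 4 * \<beta>\<^sup>2 * (2 * exp z)"
    proof (intro mult_left_mono)
      have "1 + z + z\<^sup>2 / 2 \<le> exp z" using exp_lower_Taylor_quadratic[OF z] .
      moreover have "(1 + z)\<^sup>2 = 1 + 2 * z + z\<^sup>2" by (simp add: power2_eq_square algebra_simps)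
      ultimately show "(1 + z)\<^sup>2 \<le> 2 * exp z" by linarith
    qed simp
    finally have "p * (\<beta> + u)\<^sup>2 \<le> p * (8 * \<beta>\<^sup>2 * exp z)"
      using assms by (intro mult_left_mono) auto
    also have "\<dots> = 8 * \<beta>\<^sup>2 * exp (- \<beta>)"
      by (simp add: u(2) z_def exp_diff exp_minus field_simps)
    finally show ?thesis using assms by (simp add: u_def add_nonneg_nonneg[of "4 * p * \<beta>\<^sup>2"] add_increasing)
  qed
qed

text \<open>Jensen's inequality on A: if c is the conditional mean of the sum Z of the b i * Q i,
  then prob A * exp c \<le> E (exp Z) \<le> exp \<beta>, so c \<le> \<beta> - ln (prob A). With b
  parallel to the vector v of conditional means, c is a multiple of the length of v, and
  \<open>log_square_bound\<close> handles its square.\<close>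

lemma (in prob_space) conditional_features_bound:
  fixes Q :: "'i \<Rightarrow> 'a \<Rightarrow> real" and \<beta> :: real
  assumes fin: "finite K" and Q: "\<And>i. i \<in> K \<Longrightarrow> integrable M (Q i)"
    and A[measurable]: "A \<in> events" and p: "prob A > 0" and \<beta>: "\<beta> \<ge> 1"
    and mgf: "\<And>b. (\<Sum>i\<in>K. (b i)\<^sup>2) \<le> 1 / 2 \<Longrightarrow>
      (\<integral>\<^sup>+x. ennreal (exp (\<Sum>i\<in>K. b i * Q i x)) \<partial>M) \<le> ennreal (exp (2 * \<beta> * (\<Sum>i\<in>K. (b i)\<^sup>2)))"
  shows "prob A * (\<Sum>i\<in>K. ((\<integral>x. indicator A x * Q i x \<partial>M) / prob A)\<^sup>2)
    \<le> 8 * prob A * \<beta>\<^sup>2 + 16 * \<beta>\<^sup>2 * exp (- \<beta>)"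
proof -
  define v where "v i = (\<integral>x. indicator A x * Q i x \<partial>M) / prob A" for i
  define V where "V = sqrt (\<Sum>i\<in>K. (v i)\<^sup>2)"
  have V2: "V\<^sup>2 = (\<Sum>i\<in>K. (v i)\<^sup>2)" unfolding V_def by (simp add: sum_nonneg)
  have V0: "V \<ge> 0" by (simp add: V_def sum_nonneg)
  have "V \<le> sqrt 2 * (\<beta> - ln (prob A))"
  proof (cases "V = 0")
    case True
    have "ln (prob A) \<le> 0" using p by simp
    then show ?thesis using True \<beta> by simp
  next
    case False
    \<comment> \<open>The squared length of b is 1/2, the largest that \<open>mgf\<close> admits;
      the exponent there becomes exactly \<beta>, and c = V / sqrt 2.\<close>
    define b where "b i = v i / (sqrt 2 * V)" for i
    have b2: "(\<Sum>i\<in>K. (b i)\<^sup>2) = 1 / 2"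
      using False by (simp add: b_def power_divide power_mult_distrib sum_divide_distrib[symmetric] V2[symmetric])
    define c where "c = V / sqrt 2"
    have c: "(\<Sum>i\<in>K. b i * v i) = c"
    proof -
      have "(\<Sum>i\<in>K. b i * v i) = (\<Sum>i\<in>K. (v i)\<^sup>2) / (sqrt 2 * V)"
        by (simp add: b_def sum_divide_distrib power2_eq_square)
      then show ?thesis using False unfolding V2[symmetric] by (simp add: c_def power2_eq_square)
    qed
    define Z where "Z x = (\<Sum>i\<in>K. b i * Q i x)" for x
    have Zint: "integrable M Z" unfolding Z_def using Q by auto
    have Zm[measurable]: "Z \<in> borel_measurable M" using Zint by auto
    have nn: "(\<integral>\<^sup>+x. ennreal (exp (Z x)) \<partial>M) \<le> ennreal (exp \<beta>)"
      unfolding Z_def using mgf[of b] b2 by simp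
    have eint: "integrable M (\<lambda>x. exp (Z x))"
      by (rule integrableI_nonneg) (use nn in \<open>auto intro: le_less_trans\<close>)
    have IQ: "integrable M (\<lambda>x. indicator A x * Q i x)" if "i \<in> K" for i
      using integrable_real_mult_indicator[OF A Q[OF that]] by (simp add: mult.commute)
    have IZ: "integrable M (\<lambda>x. indicator A x * Z x)"
      using integrable_real_mult_indicator[OF A Zint] by (simp add: mult.commute)
    have IA: "integrable M (indicat_real A)"
      by (intro integrable_real_indicator) (auto simp: less_top[symmetric])
    have EZ: "(\<integral>x. indicator A x * Z x \<partial>M) = prob A * c"
    proof -
      have "(\<integral>x. indicator A x * Z x \<partial>M) = (\<integral>x. (\<Sum>i\<in>K. b i * (indicator A x * Q i x)) \<partial>M)"
        by (simp add: Z_def sum_distrib_left mult_ac)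
      also have "\<dots> = (\<Sum>i\<in>K. b i * (\<integral>x. indicator A x * Q i x \<partial>M))"
        using IQ by (subst Bochner_Integration.integral_sum) auto
      also have "\<dots> = prob A * (\<Sum>i\<in>K. b i * v i)"
        using p by (simp add: v_def sum_distrib_left)
      finally show ?thesis by (simp add: c)
    qed
    have "prob A * exp c = exp c * (prob A * (1 - c) + (\<integral>x. indicator A x * Z x \<partial>M))"
      unfolding EZ by (simp add: algebra_simps)
    also have "\<dots> = (\<integral>x. exp c * (indicator A x * (1 - c) + indicator A x * Z x) \<partial>M)"
      using IZ IA by (subst integral_mult_right_zero, subst Bochner_Integration.integral_add) (auto simp: mult.commute)
    also have "\<dots> \<le> (\<integral>x. exp (Z x) \<partial>M)"
    proof (rule integral_mono)
      fix x
      \<comment> \<open>Jensen's inequality in the form of the tangent to exp at c, which keeps all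
        integrals with respect to \<open>M\<close>.\<close>
      have "exp c * (1 + (Z x - c)) \<le> exp c * exp (Z x - c)"
        by (intro mult_left_mono exp_ge_add_one_self) auto
      then show "exp c * (indicator A x * (1 - c) + indicator A x * Z x) \<le> exp (Z x)"
        by (auto simp: indicator_def exp_diff algebra_simps)
    qed (use IZ IA eint in auto)
    also have "\<dots> \<le> exp \<beta>"
      using nn eint by (subst (asm) nn_integral_eq_integral) auto
    finally have "prob A * exp c \<le> exp \<beta>" .
    then have "ln (prob A * exp c) \<le> ln (exp \<beta>)" using p by (subst ln_le_cancel_iff) auto
    then have "c \<le> \<beta> - ln (prob A)" using p by (simp add: ln_mult)
    then show ?thesis by (simp add: c_def field_simps)
  qed
  then have "V\<^sup>2 \<le> (sqrt 2 * (\<beta> - ln (prob A)))\<^sup>2" using V0 by (intro power_mono) auto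
  then have "prob A * V\<^sup>2 \<le> prob A * (2 * (\<beta> - ln (prob A))\<^sup>2)"
    by (intro mult_left_mono) (auto simp: power_mult_distrib)
  also have "\<dots> \<le> 2 * (4 * prob A * \<beta>\<^sup>2 + 8 * \<beta>\<^sup>2 * exp (- \<beta>))"
    using log_square_bound[of "prob A" \<beta>] p \<beta> by simp
  finally show ?thesis by (simp add: V2 v_def[abs_def])
qed

section \<open>Algorithms with measurable updates\<close>

text \<open>Two values of a single sample are interchangeable if they lead to the same output for every
  choice of the other samples. There are finitely many classes of interchangeable values, and they
  are measurable because sections of the success events are; replacing each sample by a representative
  of its class makes the updates measurable.\<close>

lemma measurable_updates:
  fixes M :: "'x measure" and K :: "'i set" and h :: "bool list \<Rightarrow> 'i"
    and f :: "nat \<Rightarrow> 'x \<Rightarrow> bool list \<Rightarrow> bool list" and t s l :: nat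
  defines "\<Omega> \<equiv> PiM {..<t} (\<lambda>_. M)"
  assumes t: "t \<ge> 1" and u: "length u = s"
    and len: "\<And>x j v. x \<in> space M \<Longrightarrow> j < t * l \<Longrightarrow> length v = s \<Longrightarrow> length (f j x v) = s"
    and meas: "\<And>i. i \<in> K \<Longrightarrow> {x \<in> space \<Omega>. h (memory_state t f u x (t * l)) = i} \<in> sets \<Omega>"
  obtains f' where
    "\<And>x j v. x \<in> space M \<Longrightarrow> j < t * l \<Longrightarrow> length v = s \<Longrightarrow> length (f' j x v) = s"
    "\<And>j v. (\<lambda>x. f' j x v) \<in> M \<rightarrow>\<^sub>M count_space UNIV"
    "\<And>x i. x \<in> space \<Omega> \<Longrightarrow> i \<in> K \<Longrightarrow>
       h (memory_state t f' u x (t * l)) = i \<longleftrightarrow> h (memory_state t f u x (t * l)) = i"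
proof -
  define Out where "Out x = h (memory_state t f u x (t * l))" for x
  define X where "X = space M"
  have sp: "space \<Omega> = PiE {..<t} (\<lambda>_. X)" by (simp add: \<Omega>_def X_def space_PiM)
  have upd: "x(a := y) \<in> space \<Omega>" if "x \<in> space \<Omega>" "a < t" "y \<in> X" for x a y
    using that by (auto simp: sp PiE_iff extensional_def)
  define E where "E a y y' \<longleftrightarrow> (\<forall>x\<in>space \<Omega>. \<forall>i\<in>K. Out (x(a := y)) = i \<longleftrightarrow> Out (x(a := y')) = i)" for a y y'
  have E_refl: "E a y y" for a y by (simp add: E_def)
  have E_sym: "E a y y' \<Longrightarrow> E a y' y" for a y y' by (simp add: E_def)
  have E_trans: "E a y y' \<Longrightarrow> E a y' y'' \<Longrightarrow> E a y y''" for a y y' y'' by (simp add: E_def)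
  define rep where "rep a y = (SOME z. z \<in> X \<and> E a z y)" for a y
  have rep: "rep a y \<in> X" "E a (rep a y) y" if "y \<in> X" for a y
    using someI[of "\<lambda>z. z \<in> X \<and> E a z y" y] that E_refl by (auto simp: rep_def)
  have rep_eq: "rep a y = rep a y'" if "E a y y'" for a y y'
  proof -
    have "(\<lambda>z. z \<in> X \<and> E a z y) = (\<lambda>z. z \<in> X \<and> E a z y')"
      using that E_sym E_trans by blast
    then show ?thesis by (simp add: rep_def)
  qed
  define Q where "Q = {..<l} \<times> {v :: bool list. length v = s}"
  have finite_strings: "finite {v :: bool list. length v = s}"
    using finite_lists_length_eq[of "UNIV :: bool set" s] by simp
  have finQ: "finite Q" unfolding Q_def using finite_strings by auto
  \<comment> \<open>The complete table of reactions to the value y at position a: the next state for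
    every pass and every state of length s. There are finitely many tables, and values with equal
    tables are interchangeable, which bounds the number of classes.\<close>
  define type where "type a y = (\<lambda>p\<in>Q. f (fst p * t + a) y (snd p))" for a y
  have type_E: "E a y y'" if a: "a < t" and y: "y \<in> X" "y' \<in> X" and eq: "type a y = type a y'" for a y y'
  proof -
    have "memory_state t f u (x(a := y)) n = memory_state t f u (x(a := y')) n
        \<and> length (memory_state t f u (x(a := y)) n) = s" if x: "x \<in> space \<Omega>" and "n \<le> t * l" for x n
      using that(2)
    proof (induction n)
      case 0 then show ?case using u by simp
    next
      case (Suc n)
      define v where "v = memory_state t f u (x(a := y)) n"
      have IH: "memory_state t f u (x(a := y')) n = v" "length v = s"
        using Suc.IH Suc.prems unfolding v_def by (metis Suc_leD)+
      have n: "n < t * l" using Suc.prems by simp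
      have xa: "x (n mod t) \<in> X" using x t by (auto simp: sp PiE_iff)
      have "f n y v = f n y' v" if "n mod t = a"
      proof -
        have "n div t < l" using n by (simp add: less_mult_imp_div_less mult.commute)
        then have "(n div t, v) \<in> Q" using IH by (auto simp: Q_def)
        then have "f (n div t * t + a) y v = f (n div t * t + a) y' v"
          using fun_cong[OF eq, of "(n div t, v)"] by (simp add: type_def)
        moreover have "n div t * t + a = n" using that by (metis div_mult_mod_eq)
        ultimately show ?thesis by simp
      qed
      then have "f n ((x(a := y)) (n mod t)) v = f n ((x(a := y')) (n mod t)) v" by simp
      moreover have "length (f n ((x(a := y)) (n mod t)) v) = s"
        using xa y by (intro len n IH) (auto simp: X_def)
      ultimately show ?case unfolding memory_state.simps IH(1) v_def[symmetric] by blast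
    qed
    then show ?thesis by (auto simp: E_def Out_def)
  qed
  have fin_rep: "finite (rep a ` X)" if a: "a < t" for a
  proof -
    have "type a ` X \<subseteq> PiE Q (\<lambda>_. {v. length v = s})"
    proof
      fix \<tau> assume "\<tau> \<in> type a ` X"
      then obtain y where y: "y \<in> X" "\<tau> = type a y" by auto
      have "length (f (c * t + a) y v) = s" if "c < l" "length v = s" for c v
      proof -
        have "c * t + a < Suc c * t" using a by simp
        also have "\<dots> \<le> l * t" using that by (intro mult_le_mono1) auto
        finally show ?thesis using len[of y "c * t + a" v] y that by (auto simp: X_def mult.commute)
      qed
      then show "\<tau> \<in> PiE Q (\<lambda>_. {v. length v = s})" using y by (auto simp: type_def Q_def)
    qed
    moreover have "finite (PiE Q (\<lambda>_. {v :: bool list. length v = s}))"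
      using finQ finite_strings by (intro finite_PiE) auto
    ultimately have "finite (type a ` X)" using finite_subset by blast
    moreover have "rep a ` X \<subseteq> (\<lambda>\<tau>. rep a (SOME y. y \<in> X \<and> type a y = \<tau>)) ` (type a ` X)"
    proof
      fix z assume "z \<in> rep a ` X"
      then obtain y where y: "y \<in> X" "z = rep a y" by auto
      define y' where "y' = (SOME y'. y' \<in> X \<and> type a y' = type a y)"
      have "y' \<in> X \<and> type a y' = type a y" unfolding y'_def
        using y by (intro someI[of "\<lambda>y'. y' \<in> X \<and> type a y' = type a y" y]) simp
      then have "z = rep a y'" using rep_eq[OF type_E[OF a, of y' y]] y by simp
      then show "z \<in> (\<lambda>\<tau>. rep a (SOME y. y \<in> X \<and> type a y = \<tau>)) ` (type a ` X)"
        using y(1) unfolding y'_def by blast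
    qed
    ultimately show ?thesis by (meson finite_imageI finite_subset)
  qed
  have section_sets: "{y \<in> X. Out (x(a := y)) = i} \<in> sets M" if "x \<in> space \<Omega>" "a < t" "i \<in> K" for x a i
  proof -
    have "(\<lambda>y. x(a := y)) \<in> M \<rightarrow>\<^sub>M \<Omega>"
      unfolding \<Omega>_def
    proof (rule measurable_PiM_single')
      show "(\<lambda>y. x(a := y)) \<in> space M \<rightarrow> ({..<t} \<rightarrow>\<^sub>E space M)"
        using upd[OF that(1,2)] by (auto simp: sp X_def)
      fix b assume "b \<in> {..<t}"
      then have "x b \<in> space M" using that(1) by (auto simp: sp X_def PiE_iff)
      then show "(\<lambda>y. (x(a := y)) b) \<in> M \<rightarrow>\<^sub>M M" by (cases "b = a") auto
    qed
    from measurable_sets[OF this meas[OF that(3)]] upd[OF that(1,2)] show ?thesis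
      by (auto simp: vimage_def Int_def Out_def X_def conj_commute elim!: back_subst[of "\<lambda>S. S \<in> sets M"])
  qed
  have class_sets: "{y \<in> X. E a y z} \<in> sets M" if a: "a < t" and z: "z \<in> X" for a z
  proof -
    \<comment> \<open>The class of z is cut out by finitely many tests: for every representative z'
      outside it, one data set and one output in K for which z' and z differ. A value that passes
      all these tests has its representative in the class of z.\<close>
    define Z where "Z = {z' \<in> rep a ` X. \<not> E a z' z}"
    have finZ: "finite Z" using fin_rep[OF a] by (simp add: Z_def)
    have "\<forall>z'\<in>Z. \<exists>x i. x \<in> space \<Omega> \<and> i \<in> K \<and> (Out (x(a := z')) = i) \<noteq> (Out (x(a := z)) = i)"
      unfolding Z_def E_def by blast
    then obtain x i where xi: "\<And>z'. z' \<in> Z \<Longrightarrow> x z' \<in> space \<Omega> \<and> i z' \<in> K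
        \<and> (Out ((x z')(a := z')) = i z') \<noteq> (Out ((x z')(a := z)) = i z')"
      by metis
    have "{y \<in> X. E a y z} = {y \<in> X. \<forall>z'\<in>Z. (Out ((x z')(a := y)) = i z') = (Out ((x z')(a := z)) = i z')}"
    proof (safe)
      fix y z' assume "y \<in> X" "E a y z" "z' \<in> Z" then show
        "Out ((x z')(a := y)) = i z' \<Longrightarrow> Out ((x z')(a := z)) = i z'"
        "Out ((x z')(a := z)) = i z' \<Longrightarrow> Out ((x z')(a := y)) = i z'"
        using xi[of z'] by (auto simp: E_def)
    next
      fix y assume y: "y \<in> X"
        and all: "\<forall>z'\<in>Z. (Out ((x z')(a := y)) = i z') = (Out ((x z')(a := z)) = i z')"
      define r where "r = rep a y"
      have r: "r \<in> X" "E a r y" "r \<in> rep a ` X" using rep[OF y] y by (auto simp: r_def)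
      have "r \<notin> Z"
      proof
        assume rZ: "r \<in> Z"
        then have "(Out ((x r)(a := r)) = i r) = (Out ((x r)(a := y)) = i r)"
          using r xi[OF rZ] by (auto simp: E_def)
        with all rZ xi[OF rZ] show False by blast
      qed
      then have "E a r z" using r by (simp add: Z_def)
      then show "E a y z" using r E_sym E_trans by blast
    qed
    also have "\<dots> \<in> sets M"
      unfolding X_def
    proof (intro sets.sets_Collect_finite_All finZ)
      fix z' assume z': "z' \<in> Z"
      have S: "{y \<in> space M. Out ((x z')(a := y)) = i z'} \<in> sets M"
        using section_sets[of "x z'" a "i z'"] xi[OF z'] a by (simp add: X_def)
      show "{y \<in> space M. (Out ((x z')(a := y)) = i z') = (Out ((x z')(a := z)) = i z')} \<in> sets M"
        using S sets.sets_Collect_neg[OF S] by (cases "Out ((x z')(a := z)) = i z'") auto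
    qed
    finally show ?thesis .
  qed
  define f' where "f' j y v = f j (rep (j mod t) y) v" for j y v
  show ?thesis
  proof (rule that[of f'])
    show "length (f' j x v) = s" if "x \<in> space M" "j < t * l" "length v = s" for x j v
      unfolding f'_def using that rep[of x] by (intro len) (auto simp: X_def)
    show "(\<lambda>x. f' j x v) \<in> M \<rightarrow>\<^sub>M count_space UNIV" for j v
    proof (subst measurable_count_space_eq2_countable, intro conjI ballI)
      fix w :: "bool list"
      define a where "a = j mod t"
      have a: "a < t" using t by (simp add: a_def)
      have "(\<lambda>x. f' j x v) -` {w} \<inter> space M = (\<Union>z\<in>{z \<in> rep a ` X. f j z v = w}. {y \<in> X. E a y z})"
      proof (intro equalityI subsetI)
        fix y assume "y \<in> (\<lambda>x. f' j x v) -` {w} \<inter> space M"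
        then have y: "y \<in> X" "f j (rep a y) v = w" by (auto simp: X_def f'_def a_def)
        then show "y \<in> (\<Union>z\<in>{z \<in> rep a ` X. f j z v = w}. {y \<in> X. E a y z})"
          using rep[of y a] E_sym by blast
      next
        fix y assume "y \<in> (\<Union>z\<in>{z \<in> rep a ` X. f j z v = w}. {y \<in> X. E a y z})"
        then obtain y0 where y0: "y0 \<in> X" "f j (rep a y0) v = w" "y \<in> X" "E a y (rep a y0)" by auto
        then have "E a y y0" using rep[of y0 a] E_trans by blast
        then have "rep a y = rep a y0" by (rule rep_eq)
        then show "y \<in> (\<lambda>x. f' j x v) -` {w} \<inter> space M"
          using y0 by (auto simp: f'_def a_def[symmetric] X_def)
      qed
      also have "\<dots> \<in> sets M"
        using fin_rep[OF a] class_sets[OF a] rep by (intro sets.finite_UN) auto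
      finally show "(\<lambda>x. f' j x v) -` {w} \<inter> space M \<in> sets M" .
    qed auto
    fix x i assume x: "x \<in> space \<Omega>" and i: "i \<in> K"
    \<comment> \<open>Hybrid argument: in \<open>y n\<close> the first n samples are replaced by
      representatives, and passing from n to n + 1 changes a single sample within its class.\<close>
    define y where "y n = (\<lambda>a. if a < n then rep a (x a) else x a)" for n :: nat
    have xX: "x a \<in> X" if "a < t" for a using x that by (auto simp: sp PiE_iff)
    have y_space: "y n \<in> space \<Omega>" if "n \<le> t" for n
      using x that rep(1) by (auto simp: sp PiE_iff y_def extensional_def)
    have "Out (y n) = i \<longleftrightarrow> Out x = i" if "n \<le> t" for n
      using that
    proof (induction n)
      case 0 then show ?case by (simp add: y_def)
    next
      case (Suc n)
      have "y (Suc n) = (y n)(n := rep n (x n))" "y n = (y n)(n := x n)"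
        by (auto simp: y_def fun_eq_iff)
      moreover have "E n (rep n (x n)) (x n)" using rep xX Suc by auto
      ultimately have "Out (y (Suc n)) = i \<longleftrightarrow> Out (y n) = i"
        using y_space[of n] Suc i unfolding E_def by (metis Suc_leD)
      then show ?case using Suc by simp
    qed
    from this[of t] have "Out (y t) = i \<longleftrightarrow> Out x = i" by simp
    moreover have "memory_state t f' u x n = memory_state t f u (y t) n" for n
      using t by (induction n) (auto simp: f'_def y_def)
    ultimately show "h (memory_state t f' u x (t * l)) = i \<longleftrightarrow> h (memory_state t f u x (t * l)) = i"
      by (simp add: Out_def)
  qed
qed

section \<open>Transcripts\<close>

text \<open>Starts at an arbitrary time a and in an arbitrary state v, because consistency of a
  block with a transcript has to be tested also from recorded states that the actual computation
  does not reach.\<close>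

primrec run :: "nat \<Rightarrow> (nat \<Rightarrow> 'x \<Rightarrow> bool list \<Rightarrow> bool list) \<Rightarrow> nat \<Rightarrow> (nat \<Rightarrow> 'x) \<Rightarrow> nat \<Rightarrow> bool list \<Rightarrow> bool list"
where
  "run t f a x 0 v = v"
| "run t f a x (Suc n) v = f (a + n) (x ((a + n) mod t)) (run t f a x n v)"

lemma memory_state_add: "memory_state t f u x (a + n) = run t f a x n (memory_state t f u x a)"
  by (induction n) auto

lemma run_cong:
  assumes "\<And>i. i < n \<Longrightarrow> x ((a + i) mod t) = y ((a + i) mod t)"
  shows "run t f a x n v = run t f a y n v"
  using assms by (induction n) auto

lemma measurable_run:
  fixes M :: "'x measure"
  assumes "\<And>j v. (\<lambda>x. f j x v) \<in> M \<rightarrow>\<^sub>M count_space UNIV"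
    and "\<And>i. i < n \<Longrightarrow> (a + i) mod t \<in> G"
  shows "(\<lambda>x. run t f a x n v) \<in> PiM G (\<lambda>_. M) \<rightarrow>\<^sub>M count_space UNIV"
  using assms(2)
proof (induction n)
  case 0 then show ?case by simp
next
  case (Suc n)
  have [measurable]: "(\<lambda>x. x ((a + n) mod t)) \<in> PiM G (\<lambda>_. M) \<rightarrow>\<^sub>M M"
    using Suc.prems by (intro measurable_component_singleton) auto
  have "(\<lambda>x. f (a + n) (x ((a + n) mod t)) w) \<in> PiM G (\<lambda>_. M) \<rightarrow>\<^sub>M count_space UNIV" for w
    using assms(1)[of "a + n" w] by measurable
  from measurable_compose_countable[of "\<lambda>w x. f (a + n) (x ((a + n) mod t)) w", OF this] Suc
  show ?case by auto
qed

text \<open>The predicates \<open>A j\<close> have the rectangle property of communication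
  protocols: consistency of block j with \<pi> depends on block j alone, and the \<pi> consistent
  with all blocks is the actual sequence of recorded states. With all blocks but j fixed, \<pi> is
  determined by the l strings recorded after the readings of block j, hence the bound 2 ^ (s *
  l).\<close>

lemma transcripts:
  fixes M :: "'x measure" and f :: "nat \<Rightarrow> 'x \<Rightarrow> bool list \<Rightarrow> bool list" and t s l k :: nat
  defines "\<Omega> \<equiv> PiM {..<t} (\<lambda>_. M)" and "m \<equiv> (t + k - 1) div k"
  assumes pos: "t \<ge> 1" "k \<ge> 1" "l \<ge> 1" and u: "length u = s"
    and len: "\<And>x j v. x \<in> space M \<Longrightarrow> j < t * l \<Longrightarrow> length v = s \<Longrightarrow> length (f j x v) = s"
    and meas: "\<And>j v. (\<lambda>x. f j x v) \<in> M \<rightarrow>\<^sub>M count_space UNIV"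
  obtains G :: "nat \<Rightarrow> nat set" and T :: "(nat \<Rightarrow> bool list) set"
    and A :: "nat \<Rightarrow> (nat \<Rightarrow> bool list) \<Rightarrow> (nat \<Rightarrow> 'x) \<Rightarrow> bool"
    and out :: "(nat \<Rightarrow> bool list) \<Rightarrow> bool list"
  where "\<And>j. card (G j) \<le> k" "(\<Union>j<m. G j) = {..<t}" "disjoint_family_on G {..<m}" "finite T"
    "\<And>j \<pi>. j < m \<Longrightarrow> {x \<in> space (PiM (G j) (\<lambda>_. M)). A j \<pi> x} \<in> sets (PiM (G j) (\<lambda>_. M))"
    "\<And>j \<pi> x. j < m \<Longrightarrow> A j \<pi> (restrict x (G j)) \<longleftrightarrow> A j \<pi> x"
    "\<And>x. x \<in> space \<Omega> \<Longrightarrow> \<exists>!\<pi>. \<pi> \<in> T \<and> (\<forall>j<m. A j \<pi> x)"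
    "\<And>x \<pi>. x \<in> space \<Omega> \<Longrightarrow> \<pi> \<in> T \<Longrightarrow> \<forall>j<m. A j \<pi> x \<Longrightarrow> memory_state t f u x (t * l) = out \<pi>"
    "\<And>x j. x \<in> space \<Omega> \<Longrightarrow> j < m \<Longrightarrow> card {\<pi> \<in> T. \<forall>i<m. i \<noteq> j \<longrightarrow> A i \<pi> x} \<le> 2 ^ (s * l)"
proof -
  have m1: "m \<ge> 1" using pos by (simp add: m_def div_greater_zero_iff Suc_le_eq)
  have mk: "t \<le> m * k"
  proof -
    have "t + k - 1 < Suc m * k" unfolding m_def using pos
      by (metis dividend_less_div_times mult_Suc add.commute Suc_le_eq One_nat_def mult.commute)
    then show ?thesis using pos by simp
  qed
  have mk': "(m - 1) * k < t"
  proof -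
    have "m * k \<le> t + k - 1" unfolding m_def by (simp add: div_times_less_eq_dividend)
    then show ?thesis using pos by (simp add: diff_mult_distrib)
  qed
  \<comment> \<open>The last block may be shorter than k, hence the \<open>min\<close>. Segment n of
    the stream is block \<open>n mod m\<close> in pass \<open>n div m\<close>; it occupies
    \<open>size n\<close> consecutive times from \<open>bd n\<close> on.\<close>
  define G where "G j = {j * k ..< min ((j + 1) * k) t}" for j
  define bd where "bd n = (n div m) * t + min ((n mod m) * k) t" for n
  define start :: "nat \<Rightarrow> nat" where "start n = n mod m * k" for n
  define size where "size n = min ((n mod m + 1) * k) t - n mod m * k" for n
  have mod_less: "n mod m < m" for n using m1 by simp
  have start_less: "start n < t" for n
  proof -
    have "n mod m \<le> m - 1" using m1 by (simp add: Suc_le_eq le_diff_conv2 mod_less_divisor Suc_leI)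
    then have "start n \<le> (m - 1) * k" unfolding start_def by (rule mult_le_mono1)
    then show ?thesis using mk' by simp
  qed
  have bd_eq: "bd n = (n div m) * t + start n" for n
    using start_less[of n] by (simp add: bd_def start_def)
  have bd_Suc: "bd (Suc n) = bd n + size n" for n
  proof -
    \<comment> \<open>At the end of a pass, t \<le> m k makes the truncated block end exactly at t,
      where the next pass begins.\<close>
    have "bd (Suc n) = (n div m) * t + min ((n mod m + 1) * k) t"
    proof (cases "Suc (n mod m) = m")
      case True
      then have "Suc n div m = Suc (n div m)" "Suc n mod m = 0" by (simp_all add: div_Suc mod_Suc)
      moreover have "min ((n mod m + 1) * k) t = t" using True mk by simp
      ultimately show ?thesis by (simp add: bd_def)
    next
      case False
      then have "Suc n div m = n div m" "Suc n mod m = Suc (n mod m)" by (simp_all add: div_Suc mod_Suc)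
      then show ?thesis by (simp add: bd_def)
    qed
    then show ?thesis using start_less[of n] unfolding bd_eq size_def start_def by auto
  qed
  have bd_last: "bd (m * l) = t * l" using m1 by (simp add: bd_def)
  have bd_0: "bd 0 = 0" by (simp add: bd_def)
  have in_block: "(bd n + i) mod t \<in> G (n mod m)" if "i < size n" for n i
  proof -
    have "(bd n + i) mod t = (start n + i) mod t" by (simp add: bd_eq add.assoc)
    also have "\<dots> = start n + i" using that by (auto simp: size_def start_def)
    finally show ?thesis using that by (auto simp: G_def size_def start_def)
  qed
  have less: "bd n + i < t * l" if "i < size n" "n < m * l" for n i
  proof -
    have "n div m < l" using that(2) by (simp add: less_mult_imp_div_less mult.commute)
    have "bd n + i < (n div m) * t + t" using that(1) by (auto simp: bd_eq size_def start_def)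
    also have "\<dots> = Suc (n div m) * t" by simp
    also have "\<dots> \<le> l * t" using \<open>n div m < l\<close> by (intro mult_le_mono1) simp
    finally show ?thesis by (simp add: mult.commute)
  qed
  define step where "step n x v = run t f (bd n) x (size n) v" for n x v
  \<comment> \<open>The state from which segment n starts according to \<pi>. Segment 0 starts in
    the initial state u, which \<pi> does not record.\<close>
  define prev where "prev \<pi> n = (if n = 0 then u else \<pi> (n - 1))" for \<pi> :: "nat \<Rightarrow> bool list" and n
  define A where "A j \<pi> x \<longleftrightarrow> (\<forall>c<l. step (c * m + j) x (prev \<pi> (c * m + j)) = \<pi> (c * m + j))" for j \<pi> x
  define T where "T = PiE {..<m * l} (\<lambda>_. {v :: bool list. length v = s})"
  define out where "out \<pi> = \<pi> (m * l - 1)" for \<pi> :: "nat \<Rightarrow> bool list"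
  have A_iff: "A j \<pi> x \<longleftrightarrow> (\<forall>n<m * l. n mod m = j \<longrightarrow> step n x (prev \<pi> n) = \<pi> n)" if "j < m" for j \<pi> x
  proof
    assume A: "A j \<pi> x"
    show "\<forall>n<m * l. n mod m = j \<longrightarrow> step n x (prev \<pi> n) = \<pi> n"
    proof (intro allI impI)
      fix n assume n: "n < m * l" "n mod m = j"
      have "n div m < l" using n by (simp add: less_mult_imp_div_less mult.commute)
      moreover have "n div m * m + j = n" using n(2) by (metis div_mult_mod_eq)
      ultimately show "step n x (prev \<pi> n) = \<pi> n" using A unfolding A_def by metis
    qed
  next
    assume B: "\<forall>n<m * l. n mod m = j \<longrightarrow> step n x (prev \<pi> n) = \<pi> n"
    have "c * m + j < m * l \<and> (c * m + j) mod m = j" if "c < l" for c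
    proof -
      have "c * m + j < Suc c * m" using \<open>j < m\<close> by simp
      also have "\<dots> \<le> l * m" using that by (intro mult_le_mono1) simp
      finally show ?thesis using \<open>j < m\<close> by (simp add: mult.commute)
    qed
    then show "A j \<pi> x" using B by (simp add: A_def)
  qed
  have step_eq: "step n x (prev \<pi> n) = \<pi> n" if "A (n mod m) \<pi> x" "n < m * l" for n \<pi> x
    using that unfolding A_iff[OF mod_less] by blast
  have state_Suc: "memory_state t f u x (bd (Suc n)) = step n x (memory_state t f u x (bd n))" for x n
    by (simp add: bd_Suc step_def memory_state_add)
  have len_state: "length (memory_state t f u x n) = s" if x: "x \<in> space \<Omega>" and "n \<le> t * l" for x n
    using that(2)
  proof (induction n)
    case 0 then show ?case using u by simp
  next
    case (Suc n)
    have "x (n mod t) \<in> space M" using x pos by (auto simp: \<Omega>_def space_PiM PiE_iff)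
    then show ?case using Suc len[of "x (n mod t)" n] by simp
  qed
  have bd_le: "bd n \<le> t * l" if "n \<le> m * l" for n
    using that
  proof (induction rule: inc_induct)
    case base then show ?case by (simp add: bd_last)
  next
    case (step n) then show ?case by (simp add: bd_Suc)
  qed
  define trace where "trace x = (\<lambda>n\<in>{..<m * l}. memory_state t f u x (bd (Suc n)))" for x
  have trace_T: "trace x \<in> T" if "x \<in> space \<Omega>" for x
    using len_state[OF that bd_le] by (auto simp: T_def trace_def)
  have consistent: "\<pi> n = memory_state t f u x (bd (Suc n))"
    if "\<forall>j<m. A j \<pi> x" "n < m * l" for \<pi> x n
    using that(2)
  proof (induction n)
    case 0
    then have "step 0 x (prev \<pi> 0) = \<pi> 0" using that(1) mod_less[of 0] by (intro step_eq) auto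
    then show ?case using state_Suc[of x 0] by (simp add: prev_def bd_0)
  next
    case (Suc n)
    have "n < m * l" using Suc by simp
    moreover have "step (Suc n) x (prev \<pi> (Suc n)) = \<pi> (Suc n)"
      using that(1) mod_less[of "Suc n"] Suc.prems by (intro step_eq) blast+
    ultimately show ?case using Suc.IH state_Suc[of x "Suc n"] by (simp add: prev_def)
  qed
  have trace_A: "A j (trace x) x" if "j < m" for j x
    unfolding A_iff[OF that]
  proof (intro allI impI)
    fix n assume n: "n < m * l"
    have "prev (trace x) n = memory_state t f u x (bd n)"
      using n by (cases n) (auto simp: prev_def trace_def bd_0)
    then show "step n x (prev (trace x) n) = trace x n" using n by (simp add: state_Suc trace_def)
  qed
  show ?thesis
  proof (rule that[of G T A out])
    show "card (G j) \<le> k" for j by (simp add: G_def)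
    show "(\<Union>j<m. G j) = {..<t}"
    proof (intro equalityI subsetI)
      fix a assume "a \<in> {..<t}"
      then have a: "a < t" by simp
      have "a div k < m" using a mk by (metis less_le_trans less_mult_imp_div_less)
      moreover have "a \<in> G (a div k)"
        using a pos dividend_less_div_times[of k a] by (auto simp: G_def mult.commute)
      ultimately show "a \<in> (\<Union>j<m. G j)" by blast
    qed (auto simp: G_def)
    show "disjoint_family_on G {..<m}"
    proof -
      have "i = a div k" if "a \<in> G i" for i a
        using that pos by (auto simp: G_def intro!: div_nat_eqI[symmetric] simp: mult.commute)
      then show ?thesis unfolding disjoint_family_on_def by blast
    qed
    show "finite T"
      unfolding T_def using finite_lists_length_eq[of "UNIV :: bool set" s] by (intro finite_PiE) auto
    show "{x \<in> space (PiM (G j) (\<lambda>_. M)). A j \<pi> x} \<in> sets (PiM (G j) (\<lambda>_. M))" if "j < m" for j \<pi>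
      unfolding A_iff[OF that]
    proof (intro sets.sets_Collect_finite_All' sets.sets_Collect_countable_All)
      fix n
      have "{x \<in> space (PiM (G j) (\<lambda>_. M)). step n x (prev \<pi> n) = \<pi> n} \<in> sets (PiM (G j) (\<lambda>_. M))"
        if "n mod m = j"
      proof -
        have "(\<lambda>x. step n x (prev \<pi> n)) \<in> PiM (G j) (\<lambda>_. M) \<rightarrow>\<^sub>M count_space UNIV"
          unfolding step_def using in_block that by (intro measurable_run meas) auto
        from measurable_sets[OF this, of "{\<pi> n}"] show ?thesis
          by (simp add: vimage_def Int_def conj_commute)
      qed
      then show "{x \<in> space (PiM (G j) (\<lambda>_. M)). n < m * l \<longrightarrow> n mod m = j \<longrightarrow> step n x (prev \<pi> n) = \<pi> n}
          \<in> sets (PiM (G j) (\<lambda>_. M))"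
        by (cases "n < m * l \<and> n mod m = j") auto
    qed
    show "A j \<pi> (restrict x (G j)) \<longleftrightarrow> A j \<pi> x" if "j < m" for j \<pi> x
    proof -
      have "step n (restrict x (G j)) v = step n x v" if "n mod m = j" for n v
        unfolding step_def using in_block[of _ n] that by (intro run_cong) auto
      then show ?thesis unfolding A_iff[OF that] by auto
    qed
    show "\<exists>!\<pi>. \<pi> \<in> T \<and> (\<forall>j<m. A j \<pi> x)" if x: "x \<in> space \<Omega>" for x
    proof (rule ex1I[of _ "trace x"])
      show "trace x \<in> T \<and> (\<forall>j<m. A j (trace x) x)" using trace_T[OF x] trace_A by blast
      fix \<pi> assume \<pi>: "\<pi> \<in> T \<and> (\<forall>j<m. A j \<pi> x)"
      then have "\<And>n. n < m * l \<Longrightarrow> \<pi> n = trace x n" using consistent by (auto simp: trace_def)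
      then show "\<pi> = trace x" using \<pi> trace_T[OF x] unfolding T_def by (intro PiE_ext) auto
    qed
    show "memory_state t f u x (t * l) = out \<pi>" if "\<forall>j<m. A j \<pi> x" for x \<pi>
      using consistent[OF that, of "m * l - 1"] m1 pos by (simp add: out_def bd_last)
    show "card {\<pi> \<in> T. \<forall>i<m. i \<noteq> j \<longrightarrow> A i \<pi> x} \<le> 2 ^ (s * l)" if x: "x \<in> space \<Omega>" and j: "j < m" for x j
    proof -
      define S where "S = {\<pi> \<in> T. \<forall>i<m. i \<noteq> j \<longrightarrow> A i \<pi> x}"
      define own where "own \<pi> = (\<lambda>c\<in>{..<l}. \<pi> (c * m + j))" for \<pi> :: "nat \<Rightarrow> bool list"
      have "inj_on own S"
      proof (rule inj_onI)
        fix \<pi> \<pi>' assume S: "\<pi> \<in> S" "\<pi>' \<in> S" and own: "own \<pi> = own \<pi>'"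
        \<comment> \<open>Induction along the stream: at segments of block j the entries agree by
          assumption, at all others the entry is computed from the previous one and the fixed
          data.\<close>
        have eq: "\<pi> n = \<pi>' n" if "n < m * l" for n
          using that
        proof (induction n rule: less_induct)
          case (less n)
          show ?case
          proof (cases "n mod m = j")
            case True
            have "n div m < l" using less by (simp add: less_mult_imp_div_less mult.commute)
            moreover have "n div m * m + j = n" using True by (metis div_mult_mod_eq)
            ultimately show ?thesis using fun_cong[OF own, of "n div m"] by (simp add: own_def)
          next
            case False
            have "prev \<pi> n = prev \<pi>' n" using less by (auto simp: prev_def)
            moreover have "step n x (prev \<pi> n) = \<pi> n" "step n x (prev \<pi>' n) = \<pi>' n"
              using S False mod_less[of n] less.prems unfolding S_def by (intro step_eq; blast)+
            ultimately show ?thesis by simp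
          qed
        qed
        show "\<pi> = \<pi>'"
          by (rule PiE_ext[of \<pi> "{..<m * l}" "\<lambda>_. {v. length v = s}"])
             (use S eq in \<open>auto simp: S_def T_def\<close>)
      qed
      moreover have "own ` S \<subseteq> PiE {..<l} (\<lambda>_. {v :: bool list. length v = s})"
      proof -
        have "c * m + j < m * l" if "c < l" for c
        proof -
          have "c * m + j < Suc c * m" using \<open>j < m\<close> by simp
          also have "\<dots> \<le> l * m" using that by (intro mult_le_mono1) simp
          finally show ?thesis by (simp add: mult.commute)
        qed
        then show ?thesis by (auto simp: own_def S_def T_def restrict_PiE_iff)
      qed
      moreover have "finite (PiE {..<l} (\<lambda>_. {v :: bool list. length v = s}))"
        using finite_lists_length_eq[of "UNIV :: bool set" s] by (intro finite_PiE) auto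
      ultimately have "card S \<le> card (PiE {..<l} (\<lambda>_. {v :: bool list. length v = s}))"
        by (rule card_inj_on_le)
      also have "\<dots> = 2 ^ (s * l)"
        using card_lists_length_eq[of "UNIV :: bool set" s] by (simp add: card_PiE power_mult)
      finally show ?thesis by (simp add: S_def)
    qed
  qed
qed

section \<open>Families of weakly correlated densities\<close>

lemma integrable_mult_of_squares:
  fixes f g :: "'a \<Rightarrow> real"
  assumes [measurable]: "f \<in> borel_measurable M" "g \<in> borel_measurable M"
    and "integrable M (\<lambda>x. (f x)\<^sup>2)" "integrable M (\<lambda>x. (g x)\<^sup>2)"
  shows "integrable M (\<lambda>x. f x * g x)"
proof (rule Bochner_Integration.integrable_bound)
  show "integrable M (\<lambda>x. (f x)\<^sup>2 + (g x)\<^sup>2)" using assms by simp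
  have "\<bar>f x * g x\<bar> \<le> (f x)\<^sup>2 + (g x)\<^sup>2" for x
  proof -
    have "2 * \<bar>f x\<bar> * \<bar>g x\<bar> \<le> (f x)\<^sup>2 + (g x)\<^sup>2"
      using sum_squares_bound[of "\<bar>f x\<bar>" "\<bar>g x\<bar>"] by simp
    moreover have "0 \<le> \<bar>f x\<bar> * \<bar>g x\<bar>" by simp
    ultimately show ?thesis unfolding abs_mult by linarith
  qed
  then show "AE x in M. norm (f x * g x) \<le> norm ((f x)\<^sup>2 + (g x)\<^sup>2)" by simp
qed simp

lemma (in prob_space) integrable_of_square:
  fixes f :: "'a \<Rightarrow> real"
  assumes "f \<in> borel_measurable M" "integrable M (\<lambda>x. (f x)\<^sup>2)"
  shows "integrable M f"
  using integrable_mult_of_squares[of f M "\<lambda>_. 1"] assms by simp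

text \<open>As a polynomial in c, the expectation of indicator A times (R - c)^2 is nonnegative; it
  is evaluated at the conditional mean of R given A.\<close>

lemma (in prob_space) indicator_cauchy_schwarz:
  fixes R :: "'a \<Rightarrow> real"
  assumes A[measurable]: "A \<in> events" and [measurable]: "R \<in> borel_measurable M"
    and R2: "integrable M (\<lambda>x. (R x)\<^sup>2)"
  shows "(\<integral>x. indicator A x * R x \<partial>M)\<^sup>2 \<le> prob A * (\<integral>x. indicator A x * (R x)\<^sup>2 \<partial>M)"
proof -
  have R1: "integrable M R" by (rule integrable_of_square) (use R2 in auto)
  define e where "e = (\<integral>x. indicator A x * R x \<partial>M)"
  define e2 where "e2 = (\<integral>x. indicator A x * (R x)\<^sup>2 \<partial>M)"
  have I0: "integrable M (indicat_real A)"
    by (intro integrable_real_indicator) (auto simp: less_top[symmetric])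
  have I1: "integrable M (\<lambda>x. indicator A x * R x)"
    using integrable_real_mult_indicator[OF A R1] by (simp add: mult.commute)
  have I2: "integrable M (\<lambda>x. indicator A x * (R x)\<^sup>2)"
    using integrable_real_mult_indicator[OF A R2] by (simp add: mult.commute)
  have quad: "0 \<le> e2 - 2 * c * e + c\<^sup>2 * prob A" for c
  proof -
    have "0 \<le> (\<integral>x. indicator A x * (R x - c)\<^sup>2 \<partial>M)" by simp
    also have "\<dots> = (\<integral>x. indicator A x * (R x)\<^sup>2 - 2 * c * (indicator A x * R x) + c\<^sup>2 * indicator A x \<partial>M)"
      by (intro Bochner_Integration.integral_cong) (auto simp: power2_eq_square algebra_simps)
    also have "\<dots> = e2 - 2 * c * e + c\<^sup>2 * prob A"
      using I0 I1 I2 by (simp add: e_def e2_def)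
    finally show ?thesis .
  qed
  have "e\<^sup>2 \<le> prob A * e2"
  proof (cases "prob A = 0")
    case True
    have "e = 0"
    proof (rule ccontr)
      assume "e \<noteq> 0"
      \<comment> \<open>For prob A = 0 the polynomial degenerates to e2 - 2 c e, and this c gives it
        the value -1.\<close>
      then show False using quad[of "(e2 + 1) / (2 * e)"] True by simp
    qed
    then show ?thesis using True by simp
  next
    case False
    then have p: "prob A > 0" by (simp add: zero_less_measure_iff)
    have "0 \<le> e2 - 2 * (e / prob A) * e + (e / prob A)\<^sup>2 * prob A" by (rule quad)
    also have "\<dots> = e2 - e\<^sup>2 / prob A" using p by (simp add: power2_eq_square field_simps)
    finally show ?thesis using p by (simp add: field_simps)
  qed
  then show ?thesis by (simp add: e_def e2_def)
qed

text \<open>The \<open>\<l> i\<close> are densities with respect to \<open>N\<close>, and \<open>g i\<close> is the first-order term of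
  \<open>\<l> i - 1\<close> in \<open>\<sigma>\<close>.\<close>

locale weakly_correlated = prob_space N for N :: "'x measure" +
  fixes K :: "'i set" and \<l> g :: "'i \<Rightarrow> 'x \<Rightarrow> real" and \<sigma> :: real
  assumes finite_K: "finite K" and \<sigma>_pos: "0 < \<sigma>" and \<sigma>_less: "\<sigma> < 1"
    and density_measurable: "i \<in> K \<Longrightarrow> \<l> i \<in> borel_measurable N"
    and feature_measurable: "i \<in> K \<Longrightarrow> g i \<in> borel_measurable N"
    and density_nonneg: "i \<in> K \<Longrightarrow> \<l> i x \<ge> 0"
    and density_square_integrable: "i \<in> K \<Longrightarrow> integrable N (\<lambda>x. (\<l> i x)\<^sup>2)"
    and feature_square_integrable: "i \<in> K \<Longrightarrow> integrable N (\<lambda>x. (g i x)\<^sup>2)"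
    and density_mean: "i \<in> K \<Longrightarrow> (\<integral>x. \<l> i x \<partial>N) = 1"
    and density_second_moment: "i \<in> K \<Longrightarrow> (\<integral>x. (\<l> i x)\<^sup>2 \<partial>N) = 1 / (1 - \<sigma>\<^sup>2)"
    and feature_mean: "i \<in> K \<Longrightarrow> (\<integral>x. g i x \<partial>N) = 0"
    and feature_second_moment: "i \<in> K \<Longrightarrow> (\<integral>x. (g i x)\<^sup>2 \<partial>N) = 1"
    and density_feature: "i \<in> K \<Longrightarrow> (\<integral>x. \<l> i x * g i x \<partial>N) = \<sigma>"
    and features_mgf: "(\<Sum>i\<in>K. (b i)\<^sup>2) \<le> 1 / 2 \<Longrightarrow>
      (\<integral>\<^sup>+x. ennreal (exp (\<Sum>i\<in>K. b i * g i x)) \<partial>N) \<le> ennreal (exp (\<Sum>i\<in>K. (b i)\<^sup>2))"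
begin

abbreviation samples :: "nat \<Rightarrow> (nat \<Rightarrow> 'x) measure" where
  "samples t \<equiv> PiM {..<t} (\<lambda>_. N)"

definition lr :: "nat set \<Rightarrow> 'i \<Rightarrow> (nat \<Rightarrow> 'x) \<Rightarrow> real" where
  "lr G i x = (\<Prod>a\<in>G. \<l> i (x a))"

definition feature :: "nat set \<Rightarrow> 'i \<Rightarrow> (nat \<Rightarrow> 'x) \<Rightarrow> real" where
  "feature G i x = (\<Sum>a\<in>G. g i (x a))"

text \<open>The term \<open>\<sigma> * feature G i\<close> is the orthogonal projection of
  \<open>lr G i - 1\<close> to the line spanned by \<open>feature G i\<close>, since the feature has
  second moment card G and correlation card G * \<sigma> with \<open>lr G i\<close>. So the second
  moment of the remainder is that of \<open>lr G i - 1\<close> less card G * \<sigma>^2, which is of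
  order (card G * \<sigma>^2)^2 when card G * \<sigma>^2 is small.\<close>

definition remainder :: "nat set \<Rightarrow> 'i \<Rightarrow> (nat \<Rightarrow> 'x) \<Rightarrow> real" where
  "remainder G i x = lr G i x - 1 - \<sigma> * feature G i x"

declare density_measurable[measurable] feature_measurable[measurable]

lemma integrable_density: "i \<in> K \<Longrightarrow> integrable N (\<l> i)"
  by (rule integrable_of_square) (auto intro: density_square_integrable)

lemma integrable_feature: "i \<in> K \<Longrightarrow> integrable N (g i)"
  by (rule integrable_of_square) (auto intro: feature_square_integrable)

lemma integrable_density_feature: "i \<in> K \<Longrightarrow> integrable N (\<lambda>x. \<l> i x * g i x)"
  by (rule integrable_mult_of_squares) (auto intro: feature_square_integrable density_square_integrable)

lemma sample_product:
  fixes F :: "nat \<Rightarrow> 'x \<Rightarrow> real"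
  assumes "\<And>a. a < t \<Longrightarrow> integrable N (F a)"
  shows "integrable (samples t) (\<lambda>x. \<Prod>a<t. F a (x a))"
    and "(\<integral>x. (\<Prod>a<t. F a (x a)) \<partial>samples t) = (\<Prod>a<t. \<integral>x. F a x \<partial>N)"
proof -
  interpret product_sigma_finite "\<lambda>_::nat. N" by (rule product_sigma_finite.intro) unfold_locales
  show "integrable (samples t) (\<lambda>x. \<Prod>a<t. F a (x a))"
    using assms by (intro product_integrable_prod) auto
  show "(\<integral>x. (\<Prod>a<t. F a (x a)) \<partial>samples t) = (\<Prod>a<t. \<integral>x. F a x \<partial>N)"
    using assms by (intro product_integral_prod) auto
qed

lemma measurable_lr: "i \<in> K \<Longrightarrow> G \<subseteq> I \<Longrightarrow> lr G i \<in> borel_measurable (PiM I (\<lambda>_. N))"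
  unfolding lr_def by (intro borel_measurable_prod) (auto intro!: measurable_compose[OF measurable_component_singleton])

lemma measurable_feature: "i \<in> K \<Longrightarrow> G \<subseteq> I \<Longrightarrow> feature G i \<in> borel_measurable (PiM I (\<lambda>_. N))"
  unfolding feature_def by (intro borel_measurable_sum) (auto intro!: measurable_compose[OF measurable_component_singleton])

lemma measurable_remainder: "i \<in> K \<Longrightarrow> G \<subseteq> I \<Longrightarrow> remainder G i \<in> borel_measurable (PiM I (\<lambda>_. N))"
  unfolding remainder_def
  by (intro borel_measurable_diff borel_measurable_times measurable_lr measurable_feature) auto

lemma lr_nonneg: "i \<in> K \<Longrightarrow> lr G i x \<ge> 0"
  unfolding lr_def by (intro prod_nonneg) (auto intro: density_nonneg)

text \<open>Factors 1 outside the block turn a block product into a product over all coordinates,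
  which \<open>sample_product\<close> integrates factor by factor.\<close>

lemma prod_block: "G \<subseteq> {..<t} \<Longrightarrow> (\<Prod>a\<in>G. c a) = (\<Prod>a<t. if a \<in> G then c a else (1::real))" for t :: nat
  by (intro prod.mono_neutral_cong_left) auto

section \<open>Moments of block likelihood ratios and block features\<close>

context
  fixes t :: nat and G :: "nat set" and i :: 'i
  assumes G: "G \<subseteq> {..<t}" and i: "i \<in> K"
begin

lemma finite_block: "finite G"
  using G finite_subset by blast

lemma lr_moments:
  "integrable (samples t) (lr G i)" "(\<integral>x. lr G i x \<partial>samples t) = 1"
  "integrable (samples t) (\<lambda>x. (lr G i x)\<^sup>2)"
  "(\<integral>x. (lr G i x)\<^sup>2 \<partial>samples t) = (1 / (1 - \<sigma>\<^sup>2)) ^ card G"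
proof -
  let ?F = "\<lambda>a x. if a \<in> G then \<l> i x else 1"
  have F: "lr G i = (\<lambda>x. \<Prod>a<t. ?F a (x a))"
    unfolding lr_def prod_block[OF G] by simp
  have int: "integrable N (?F a)" for a
    by (cases "a \<in> G") (auto intro: integrable_density i)
  show "integrable (samples t) (lr G i)" unfolding F by (rule sample_product) (rule int)
  have "(\<integral>x. lr G i x \<partial>samples t) = (\<Prod>a<t. \<integral>x. ?F a x \<partial>N)"
    unfolding F by (rule sample_product) (rule int)
  also have "\<dots> = (\<Prod>a<t. 1)"
  proof (intro prod.cong refl)
    show "(\<integral>x. ?F a x \<partial>N) = 1" for a
      by (cases "a \<in> G") (auto simp: density_mean i prob_space)
  qed
  finally show "(\<integral>x. lr G i x \<partial>samples t) = 1" by simp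
  let ?F2 = "\<lambda>a x. if a \<in> G then (\<l> i x)\<^sup>2 else 1"
  have F2: "(\<lambda>x. (lr G i x)\<^sup>2) = (\<lambda>x. \<Prod>a<t. ?F2 a (x a))"
    unfolding lr_def prod_block[OF G] prod_power_distrib by (intro ext prod.cong) auto
  have int2: "integrable N (?F2 a)" for a
    by (cases "a \<in> G") (auto intro: density_square_integrable i)
  show "integrable (samples t) (\<lambda>x. (lr G i x)\<^sup>2)" unfolding F2 by (rule sample_product) (rule int2)
  have "(\<integral>x. (lr G i x)\<^sup>2 \<partial>samples t) = (\<Prod>a<t. \<integral>x. ?F2 a x \<partial>N)"
    unfolding F2 by (rule sample_product) (rule int2)
  also have "\<dots> = (\<Prod>a<t. if a \<in> G then 1 / (1 - \<sigma>\<^sup>2) else 1)"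
  proof (intro prod.cong refl)
    show "(\<integral>x. ?F2 a x \<partial>N) = (if a \<in> G then 1 / (1 - \<sigma>\<^sup>2) else 1)" for a
      by (cases "a \<in> G") (auto simp: density_second_moment i prob_space)
  qed
  also have "\<dots> = (\<Prod>a\<in>G. 1 / (1 - \<sigma>\<^sup>2))"
    by (rule prod_block[OF G, symmetric])
  also have "\<dots> = (1 / (1 - \<sigma>\<^sup>2)) ^ card G" by simp
  finally show "(\<integral>x. (lr G i x)\<^sup>2 \<partial>samples t) = (1 / (1 - \<sigma>\<^sup>2)) ^ card G" .
qed

text \<open>All integrands are products of functions of single samples. Weighting with
  \<open>lr G i\<close> amounts to drawing the block from the correlated law, under which the
  feature of each sample has mean \<sigma>.\<close>

lemma sample_feature:
  assumes b: "b \<in> G"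
  shows "integrable (samples t) (\<lambda>x. g i (x b))" "(\<integral>x. g i (x b) \<partial>samples t) = 0"
    and "integrable (samples t) (\<lambda>x. lr G i x * g i (x b))"
      "(\<integral>x. lr G i x * g i (x b) \<partial>samples t) = \<sigma>"
    and "\<And>c. c \<in> G \<Longrightarrow> integrable (samples t) (\<lambda>x. g i (x b) * g i (x c))"
      "\<And>c. c \<in> G \<Longrightarrow> (\<integral>x. g i (x b) * g i (x c) \<partial>samples t) = (if b = c then 1 else 0)"
proof -
  have bt: "b < t" using b G by auto
  let ?F = "\<lambda>a x. if a = b then g i x else 1"
  have F: "(\<lambda>x. g i (x b)) = (\<lambda>x. \<Prod>a<t. ?F a (x a))" for x
    using bt by (simp add: prod.delta)
  have int: "integrable N (?F a)" for a
    by (cases "a = b") (auto intro: integrable_feature i)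
  show "integrable (samples t) (\<lambda>x. g i (x b))" unfolding F by (rule sample_product) (rule int)
  have "(\<integral>x. g i (x b) \<partial>samples t) = (\<Prod>a<t. \<integral>x. ?F a x \<partial>N)"
    unfolding F by (rule sample_product) (rule int)
  also have "\<dots> = 0" using bt by (intro prod_zero) (auto intro!: bexI[of _ b] simp: feature_mean i)
  finally show "(\<integral>x. g i (x b) \<partial>samples t) = 0" .
  let ?H = "\<lambda>a x. if a = b then \<l> i x * g i x else if a \<in> G then \<l> i x else 1"
  have H: "(\<lambda>x. lr G i x * g i (x b)) = (\<lambda>x. \<Prod>a<t. ?H a (x a))"
  proof
    fix x
    have "lr G i x * g i (x b) = (\<Prod>a<t. (if a \<in> G then \<l> i (x a) else 1)) * (\<Prod>a<t. ?F a (x a))"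
      unfolding lr_def prod_block[OF G] using bt by (simp add: prod.delta)
    also have "\<dots> = (\<Prod>a<t. ?H a (x a))"
      unfolding prod.distrib[symmetric] using b by (intro prod.cong) auto
    finally show "lr G i x * g i (x b) = (\<Prod>a<t. ?H a (x a))" .
  qed
  have intH: "integrable N (?H a)" for a
    using integrable_density_feature integrable_density i by (cases "a = b"; cases "a \<in> G") auto
  show "integrable (samples t) (\<lambda>x. lr G i x * g i (x b))" unfolding H by (rule sample_product) (rule intH)
  have "(\<integral>x. lr G i x * g i (x b) \<partial>samples t) = (\<Prod>a<t. \<integral>x. ?H a x \<partial>N)"
    unfolding H by (rule sample_product) (rule intH)
  also have "\<dots> = (\<Prod>a<t. if a = b then \<sigma> else 1)"
  proof (intro prod.cong refl)
    show "(\<integral>x. ?H a x \<partial>N) = (if a = b then \<sigma> else 1)" for a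
      by (cases "a = b"; cases "a \<in> G") (auto simp: density_mean density_feature i prob_space)
  qed
  also have "\<dots> = \<sigma>" using bt by (simp add: prod.delta)
  finally show "(\<integral>x. lr G i x * g i (x b) \<partial>samples t) = \<sigma>" .
  fix c assume c: "c \<in> G"
  have ct: "c < t" using c G by auto
  let ?J = "\<lambda>a x. if a = b then if b = c then (g i x)\<^sup>2 else g i x else if a = c then g i x else 1"
  have J: "(\<lambda>x. g i (x b) * g i (x c)) = (\<lambda>x. \<Prod>a<t. ?J a (x a))"
  proof
    fix x
    have "g i (x b) * g i (x c) = (\<Prod>a<t. if a = b then g i (x a) else 1) * (\<Prod>a<t. if a = c then g i (x a) else 1)"
      using bt ct by (simp add: prod.delta)
    also have "\<dots> = (\<Prod>a<t. ?J a (x a))"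
      unfolding prod.distrib[symmetric] by (intro prod.cong) (auto simp: power2_eq_square)
    finally show "g i (x b) * g i (x c) = (\<Prod>a<t. ?J a (x a))" .
  qed
  have intJ: "integrable N (?J a)" for a
    using integrable_feature feature_square_integrable i by (cases "a = b"; cases "a = c"; cases "b = c") auto
  show "integrable (samples t) (\<lambda>x. g i (x b) * g i (x c))" unfolding J by (rule sample_product) (rule intJ)
  have EJ: "(\<integral>x. g i (x b) * g i (x c) \<partial>samples t) = (\<Prod>a<t. \<integral>x. ?J a x \<partial>N)"
    unfolding J by (rule sample_product) (rule intJ)
  show "(\<integral>x. g i (x b) * g i (x c) \<partial>samples t) = (if b = c then 1 else 0)"
  proof (cases "b = c")
    case True
    have "(\<integral>x. ?J a x \<partial>N) = 1" for a
      using True by (cases "a = b") (auto simp: feature_second_moment i prob_space)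
    then have "(\<Prod>a<t. \<integral>x. ?J a x \<partial>N) = (\<Prod>a<t. 1)" by simp
    then show ?thesis using EJ True by simp
  next
    case False
    then have "(\<Prod>a<t. \<integral>x. ?J a x \<partial>N) = 0"
      using bt by (intro prod_zero) (auto intro!: bexI[of _ b] simp: feature_mean i)
    then show ?thesis using EJ False by simp
  qed
qed

lemma feature_moments:
  "integrable (samples t) (feature G i)" "(\<integral>x. feature G i x \<partial>samples t) = 0"
  "integrable (samples t) (\<lambda>x. lr G i x * feature G i x)"
  "(\<integral>x. lr G i x * feature G i x \<partial>samples t) = card G * \<sigma>"
  "integrable (samples t) (\<lambda>x. (feature G i x)\<^sup>2)"
  "(\<integral>x. (feature G i x)\<^sup>2 \<partial>samples t) = card G"
proof -
  show "integrable (samples t) (feature G i)" "(\<integral>x. feature G i x \<partial>samples t) = 0"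
    unfolding feature_def using sample_feature by (auto simp: Bochner_Integration.integral_sum)
  show "integrable (samples t) (\<lambda>x. lr G i x * feature G i x)"
    "(\<integral>x. lr G i x * feature G i x \<partial>samples t) = card G * \<sigma>"
    unfolding feature_def sum_distrib_left using sample_feature
    by (auto simp: Bochner_Integration.integral_sum)
  have sq: "(\<lambda>x. (feature G i x)\<^sup>2) = (\<lambda>x. \<Sum>b\<in>G. \<Sum>c\<in>G. g i (x b) * g i (x c))"
    unfolding feature_def power2_eq_square sum_product ..
  show "integrable (samples t) (\<lambda>x. (feature G i x)\<^sup>2)"
    unfolding sq using sample_feature by (intro Bochner_Integration.integrable_sum) auto
  have "(\<integral>x. (feature G i x)\<^sup>2 \<partial>samples t) = (\<Sum>b\<in>G. \<Sum>c\<in>G. if b = c then 1 else 0)"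
    unfolding sq using sample_feature
    by (subst Bochner_Integration.integral_sum, force intro!: Bochner_Integration.integrable_sum)
       (intro sum.cong refl, subst Bochner_Integration.integral_sum, auto)
  also have "\<dots> = card G" using finite_block by (simp add: sum.delta)
  finally show "(\<integral>x. (feature G i x)\<^sup>2 \<partial>samples t) = card G" .
qed

lemma remainder_second_moment:
  "integrable (samples t) (\<lambda>x. (remainder G i x)\<^sup>2)"
  "(\<integral>x. (remainder G i x)\<^sup>2 \<partial>samples t) = (1 / (1 - \<sigma>\<^sup>2)) ^ card G - 1 - card G * \<sigma>\<^sup>2"
proof -
  interpret S: prob_space "samples t" by (intro prob_space_PiM) unfold_locales
  have sq: "(\<lambda>x. (remainder G i x)\<^sup>2) = (\<lambda>x. (lr G i x)\<^sup>2 + 1 + \<sigma>\<^sup>2 * (feature G i x)\<^sup>2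
      - 2 * lr G i x - (2 * \<sigma>) * (lr G i x * feature G i x) + (2 * \<sigma>) * feature G i x)"
    unfolding remainder_def by (auto simp: power2_eq_square algebra_simps)
  show "integrable (samples t) (\<lambda>x. (remainder G i x)\<^sup>2)"
    unfolding sq using lr_moments feature_moments by simp
  show "(\<integral>x. (remainder G i x)\<^sup>2 \<partial>samples t) = (1 / (1 - \<sigma>\<^sup>2)) ^ card G - 1 - card G * \<sigma>\<^sup>2"
    unfolding sq using lr_moments feature_moments by (simp add: S.prob_space power2_eq_square algebra_simps)
qed

end

text \<open>Independence multiplies the generating functions of the samples: the exponent grows with
  the block, while the ball of admissible b keeps its radius.\<close>

lemma sample_features_mgf:
  assumes G: "G \<subseteq> {..<t}" and b: "(\<Sum>i\<in>K. (b i)\<^sup>2) \<le> 1 / 2" and k: "card G \<le> (k::real)"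
  shows "(\<integral>\<^sup>+x. ennreal (exp (\<Sum>i\<in>K. b i * feature G i x)) \<partial>samples t) \<le> ennreal (exp (k * (\<Sum>i\<in>K. (b i)\<^sup>2)))"
proof -
  interpret product_sigma_finite "\<lambda>_::nat. N" by (rule product_sigma_finite.intro) unfold_locales
  let ?F = "\<lambda>a x. if a \<in> G then ennreal (exp (\<Sum>i\<in>K. b i * g i x)) else 1"
  have fin: "finite G" using G finite_subset by blast
  have [measurable]: "(\<lambda>x. \<Sum>i\<in>K. b i * g i x) \<in> borel_measurable N"
    by (intro borel_measurable_sum) auto
  have "ennreal (exp (\<Sum>i\<in>K. b i * feature G i x)) = (\<Prod>a<t. ?F a (x a))" for x
  proof -
    have "(\<Sum>i\<in>K. b i * feature G i x) = (\<Sum>a\<in>G. \<Sum>i\<in>K. b i * g i (x a))"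
      unfolding feature_def sum_distrib_left by (rule sum.swap)
    then have "ennreal (exp (\<Sum>i\<in>K. b i * feature G i x)) = (\<Prod>a\<in>G. ennreal (exp (\<Sum>i\<in>K. b i * g i (x a))))"
      using fin by (simp add: exp_sum prod_ennreal)
    also have "\<dots> = (\<Prod>a<t. ?F a (x a))"
      using G by (intro prod.mono_neutral_cong_left) auto
    finally show ?thesis .
  qed
  then have "(\<integral>\<^sup>+x. ennreal (exp (\<Sum>i\<in>K. b i * feature G i x)) \<partial>samples t)
      = (\<integral>\<^sup>+x. (\<Prod>a<t. ?F a (x a)) \<partial>samples t)" by simp
  also have "\<dots> = (\<Prod>a<t. \<integral>\<^sup>+x. ?F a x \<partial>N)"
    by (intro product_nn_integral_prod) auto
  also have "\<dots> \<le> (\<Prod>a<t. if a \<in> G then ennreal (exp (\<Sum>i\<in>K. (b i)\<^sup>2)) else 1)"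
  proof (rule prod_mono_ennreal)
    show "(\<integral>\<^sup>+x. ?F a x \<partial>N) \<le> (if a \<in> G then ennreal (exp (\<Sum>i\<in>K. (b i)\<^sup>2)) else 1)" for a
      using features_mgf[OF b] by (cases "a \<in> G") (auto simp: emeasure_space_1)
  qed
  also have "\<dots> = (\<Prod>a\<in>G. ennreal (exp (\<Sum>i\<in>K. (b i)\<^sup>2)))"
    using G by (intro prod.mono_neutral_cong_right) auto
  also have "\<dots> = ennreal (exp (card G * (\<Sum>i\<in>K. (b i)\<^sup>2)))"
    by (simp add: ennreal_power exp_of_nat_mult)
  also have "\<dots> \<le> ennreal (exp (k * (\<Sum>i\<in>K. (b i)\<^sup>2)))"
    using k by (intro ennreal_leI) (auto intro!: mult_right_mono sum_nonneg)
  finally show ?thesis .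
qed

text \<open>Change of measure: success probabilities under the law i become expectations under the
  reference law \<open>N\<close>, to which all later computations refer.\<close>

lemma integral_product_density:
  assumes i: "i \<in> K" and B: "B \<in> sets (samples t)"
  shows "measure (PiM {..<t} (\<lambda>_. density N (\<l> i))) B = (\<integral>x. indicator B x * lr {..<t} i x \<partial>samples t)"
proof -
  have "(\<integral>\<^sup>+x. ennreal (\<l> i x) \<partial>N) = 1"
    using integrable_density[OF i] density_mean[OF i] density_nonneg[OF i]
    by (subst nn_integral_eq_integral) auto
  then interpret D: prob_space "density N (\<l> i)"
    using i by (intro prob_spaceI) (simp add: emeasure_density cong: nn_integral_cong)
  have "PiM {..<t} (\<lambda>_. density N (\<l> i)) = density (samples t) (\<lambda>x. \<Prod>a<t. ennreal (\<l> i (x a)))"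
    using i by (intro PiM_density) (auto intro: D.sigma_finite_measure_axioms sigma_finite_measure_axioms)
  also have "\<dots> = density (samples t) (\<lambda>x. ennreal (lr {..<t} i x))"
    unfolding lr_def using density_nonneg[OF i] by (simp add: prod_ennreal)
  finally have "emeasure (PiM {..<t} (\<lambda>_. density N (\<l> i))) B
      = (\<integral>\<^sup>+x. ennreal (lr {..<t} i x) * indicator B x \<partial>samples t)"
    using B measurable_lr[OF i, of "{..<t}" "{..<t}"] by (simp add: emeasure_density)
  also have "\<dots> = (\<integral>\<^sup>+x. ennreal (indicator B x * lr {..<t} i x) \<partial>samples t)"
    by (intro nn_integral_cong) (auto simp: indicator_def)
  also have "\<dots> = ennreal (\<integral>x. indicator B x * lr {..<t} i x \<partial>samples t)"
    using integrable_real_mult_indicator[OF B lr_moments(1)[of "{..<t}" t, OF _ i]] lr_nonneg[OF i]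
    by (intro nn_integral_eq_integral) (auto simp: mult.commute)
  finally show ?thesis
    using lr_nonneg[OF i] by (simp add: measure_def)
qed

end

section \<open>Information carried by transcripts\<close>

text \<open>Block \<open>j\<close> consists of the samples with index in \<open>G j\<close>; \<open>A j \<pi> x\<close> says that block \<open>j\<close> of the
  data set \<open>x\<close> is consistent with the transcript \<open>\<pi>\<close>. The last assumption bounds the
  number of transcripts that remain possible when all blocks but one are known.\<close>

locale block_protocol = weakly_correlated N K \<l> g \<sigma>
  for N :: "'x measure" and K :: "'i set" and \<l> g :: "'i \<Rightarrow> 'x \<Rightarrow> real" and \<sigma> :: real +
  fixes t m :: nat and \<beta> :: real and G :: "nat \<Rightarrow> nat set" and T :: "'p set"
    and A :: "nat \<Rightarrow> 'p \<Rightarrow> (nat \<Rightarrow> 'x) \<Rightarrow> bool"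
  assumes \<beta>: "\<beta> \<ge> 1"
    and card_block: "real (card (G j)) \<le> 2 * \<beta>"
    and blocks: "(\<Union>j<m. G j) = {..<t}" "disjoint_family_on G {..<m}"
    and finite_T: "finite T"
    and consistent_sets: "j < m \<Longrightarrow> {x \<in> space (PiM (G j) (\<lambda>_. N)). A j \<pi> x} \<in> sets (PiM (G j) (\<lambda>_. N))"
    and consistent_restrict: "j < m \<Longrightarrow> A j \<pi> (restrict x (G j)) \<longleftrightarrow> A j \<pi> x"
    and unique_transcript: "x \<in> space (samples t) \<Longrightarrow> \<exists>!\<pi>. \<pi> \<in> T \<and> (\<forall>j<m. A j \<pi> x)"
    and few_transcripts: "x \<in> space (samples t) \<Longrightarrow> j < m \<Longrightarrow>
      real (card {\<pi> \<in> T. \<forall>i<m. i \<noteq> j \<longrightarrow> A i \<pi> x}) \<le> exp \<beta>"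
begin

sublocale S: prob_space "samples t"
  by (intro prob_space_PiM) unfold_locales

text \<open>A function on all data sets instead of the indicator of a measurable set, so that it is
  literally unchanged by restriction to the block.\<close>

definition chi :: "nat \<Rightarrow> 'p \<Rightarrow> (nat \<Rightarrow> 'x) \<Rightarrow> real" where
  "chi j \<pi> x = (if A j \<pi> x then 1 else 0)"

text \<open>Random variables of block j in the form that \<open>block_independence\<close> combines:
  measurability on the block gives independence, integrability on the whole sample space lets
  expectations factorise.\<close>

definition block_fun :: "nat \<Rightarrow> ((nat \<Rightarrow> 'x) \<Rightarrow> real) \<Rightarrow> bool" where
  "block_fun j F \<longleftrightarrow> F \<in> borel_measurable (PiM (G j) (\<lambda>_. N)) \<and> (\<forall>x. F (restrict x (G j)) = F x)
     \<and> integrable (samples t) F"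

lemma block_subset: "j < m \<Longrightarrow> G j \<subseteq> {..<t}"
  using blocks(1) by blast

lemma chi_block_measurable: "j < m \<Longrightarrow> chi j \<pi> \<in> borel_measurable (PiM (G j) (\<lambda>_. N))"
  unfolding chi_def[abs_def] using consistent_sets by (intro measurable_If) auto

lemma chi_restrict: "j < m \<Longrightarrow> chi j \<pi> (restrict x (G j)) = chi j \<pi> x"
  by (simp add: chi_def consistent_restrict)

lemma chi_measurable:
  assumes j: "j < m"
  shows "chi j \<pi> \<in> borel_measurable (samples t)"
proof -
  have "(\<lambda>x. chi j \<pi> (restrict x (G j))) \<in> borel_measurable (samples t)"
    by (rule measurable_compose[OF measurable_restrict_subset[OF block_subset[OF j]] chi_block_measurable[OF j]])
  then show ?thesis by (simp add: chi_restrict[OF j])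
qed

lemma block_funD:
  assumes "block_fun j F"
  shows "F \<in> borel_measurable (PiM (G j) (\<lambda>_. N))" "F (restrict x (G j)) = F x" "integrable (samples t) F"
  using assms by (auto simp: block_fun_def)

lemma block_fun_chi_mult:
  assumes j: "j < m" and F: "block_fun j F"
  shows "block_fun j (\<lambda>x. chi j \<pi> x * F x)"
proof -
  have "integrable (samples t) (\<lambda>x. chi j \<pi> x * F x)"
  proof (rule Bochner_Integration.integrable_bound[OF block_funD(3)[OF F]])
    show "(\<lambda>x. chi j \<pi> x * F x) \<in> borel_measurable (samples t)"
      using block_funD(3)[OF F] by (intro borel_measurable_times chi_measurable j) auto
  qed (auto simp: chi_def)
  then show ?thesis
    using F chi_restrict[OF j] chi_block_measurable[OF j] unfolding block_fun_def by auto
qed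

lemma block_fun_const: "block_fun j (\<lambda>_. c)"
  by (simp add: block_fun_def)

lemma block_fun_chi: "j < m \<Longrightarrow> block_fun j (chi j \<pi>)"
  using block_fun_chi_mult[OF _ block_fun_const[of j 1]] by simp

lemma block_fun_intros:
  assumes "j < m" "i \<in> K"
  shows "block_fun j (lr (G j) i)" "block_fun j (\<lambda>x. lr (G j) i x - 1)" "block_fun j (feature (G j) i)"
    "block_fun j (remainder (G j) i)" "block_fun j (\<lambda>x. (remainder (G j) i x)\<^sup>2)"
proof -
  have sub: "G j \<subseteq> {..<t}" using block_subset assms by auto
  have r: "lr (G j) i (restrict x (G j)) = lr (G j) i x"
    "feature (G j) i (restrict x (G j)) = feature (G j) i x" for x
    by (simp_all add: lr_def feature_def)
  have m: "lr (G j) i \<in> borel_measurable (PiM (G j) (\<lambda>_. N))"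
    "feature (G j) i \<in> borel_measurable (PiM (G j) (\<lambda>_. N))"
    "remainder (G j) i \<in> borel_measurable (PiM (G j) (\<lambda>_. N))"
    using measurable_lr measurable_feature measurable_remainder assms by auto
  show "block_fun j (lr (G j) i)" "block_fun j (\<lambda>x. lr (G j) i x - 1)" "block_fun j (feature (G j) i)"
    using m r lr_moments(1)[OF sub assms(2)] feature_moments(1)[OF sub assms(2)] by (auto simp: block_fun_def)
  then show "block_fun j (remainder (G j) i)"
    using m r by (auto simp: block_fun_def remainder_def[abs_def])
  show "block_fun j (\<lambda>x. (remainder (G j) i x)\<^sup>2)"
    using m r remainder_second_moment(1)[OF sub assms(2)] by (auto simp: block_fun_def remainder_def)
qed

section \<open>Factorisation of expectations over blocks\<close>

lemma block_independence:
  assumes J: "J \<subseteq> {..<m}" and F: "\<And>j. j \<in> J \<Longrightarrow> block_fun j (F j)"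
  shows "integrable (samples t) (\<lambda>x. \<Prod>j\<in>J. F j x)"
    and "(\<integral>x. (\<Prod>j\<in>J. F j x) \<partial>samples t) = (\<Prod>j\<in>J. \<integral>x. F j x \<partial>samples t)"
proof -
  have "S.indep_vars (\<lambda>_. borel) (\<lambda>j x. F j (restrict x (G j))) J"
  proof (rule indep_vars_blocks)
    show "prob_space N" by unfold_locales
    show "G j \<subseteq> {..<t}" if "j \<in> J" for j using J that block_subset by blast
    show "disjoint_family_on G J" using blocks(2) J by (rule disjoint_family_on_mono[rotated])
    show "F j \<in> borel_measurable (PiM (G j) (\<lambda>_. N))" if "j \<in> J" for j using block_funD(1)[OF F[OF that]] .
  qed
  then have ind: "S.indep_vars (\<lambda>_. borel) F J"
    by (rule S.indep_vars_cong[THEN iffD1, rotated -1]) (auto simp: block_funD(2)[OF F])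
  have fin: "finite J" using J finite_subset by blast
  show "integrable (samples t) (\<lambda>x. \<Prod>j\<in>J. F j x)"
    by (rule S.indep_vars_integrable[OF fin ind]) (rule block_funD(3)[OF F])
  show "(\<integral>x. (\<Prod>j\<in>J. F j x) \<partial>samples t) = (\<Prod>j\<in>J. \<integral>x. F j x \<partial>samples t)"
    by (rule S.indep_vars_lebesgue_integral[OF fin ind]) (rule block_funD(3)[OF F])
qed

text \<open>Consistency of all blocks with \<pi> is an intersection of independent block events, so
  each summand is an expectation over this event. By uniqueness of the transcript these events are
  disjoint, and their indicators add up.\<close>

lemma sum_cells:
  assumes T': "T' \<subseteq> T" and H: "\<And>j. j < m \<Longrightarrow> block_fun j (H j)"
  shows "(\<Sum>\<pi>\<in>T'. \<Prod>j<m. \<integral>x. chi j \<pi> x * H j x \<partial>samples t)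
    = (\<integral>x. indicator {x. \<exists>\<pi>\<in>T'. \<forall>j<m. A j \<pi> x} x * (\<Prod>j<m. H j x) \<partial>samples t)"
proof -
  have B: "block_fun j (\<lambda>x. chi j \<pi> x * H j x)" if "j < m" for j \<pi>
    using block_fun_chi_mult[OF that H[OF that]] .
  have "(\<Sum>\<pi>\<in>T'. \<Prod>j<m. \<integral>x. chi j \<pi> x * H j x \<partial>samples t)
      = (\<Sum>\<pi>\<in>T'. \<integral>x. (\<Prod>j<m. chi j \<pi> x * H j x) \<partial>samples t)"
    using B by (intro sum.cong refl block_independence(2)[symmetric]) auto
  also have "\<dots> = (\<integral>x. (\<Sum>\<pi>\<in>T'. \<Prod>j<m. chi j \<pi> x * H j x) \<partial>samples t)"
    using B by (intro Bochner_Integration.integral_sum[symmetric] block_independence(1)) auto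
  also have "\<dots> = (\<integral>x. indicator {x. \<exists>\<pi>\<in>T'. \<forall>j<m. A j \<pi> x} x * (\<Prod>j<m. H j x) \<partial>samples t)"
  proof (intro Bochner_Integration.integral_cong refl)
    fix x assume x: "x \<in> space (samples t)"
    have chi: "(\<Prod>j<m. chi j \<pi> x) = (if \<forall>j<m. A j \<pi> x then 1 else 0)" for \<pi>
      unfolding chi_def by (auto intro!: prod.neutral)
    obtain \<pi>0 where \<pi>0: "\<pi>0 \<in> T" "\<forall>j<m. A j \<pi>0 x" "\<And>\<pi>. \<pi> \<in> T \<Longrightarrow> \<forall>j<m. A j \<pi> x \<Longrightarrow> \<pi> = \<pi>0"
      using unique_transcript[OF x] by blast
    have "(\<Sum>\<pi>\<in>T'. \<Prod>j<m. chi j \<pi> x) = (\<Sum>\<pi>\<in>T'. if \<pi> = \<pi>0 then 1 else 0)"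
      unfolding chi using T' \<pi>0 by (intro sum.cong refl) (metis subsetD)
    also have "\<dots> = (if \<pi>0 \<in> T' then 1 else 0)"
      using finite_subset[OF T' finite_T] by (simp add: sum.delta)
    also have "\<dots> = indicator {x. \<exists>\<pi>\<in>T'. \<forall>j<m. A j \<pi> x} x"
    proof -
      have "\<pi>0 \<in> T' \<longleftrightarrow> (\<exists>\<pi>\<in>T'. \<forall>j<m. A j \<pi> x)" using \<pi>0 T' by blast
      then show ?thesis by (simp add: indicator_def)
    qed
    finally show "(\<Sum>\<pi>\<in>T'. \<Prod>j<m. chi j \<pi> x * H j x) = indicator {x. \<exists>\<pi>\<in>T'. \<forall>j<m. A j \<pi> x} x * (\<Prod>j<m. H j x)"
      by (simp add: prod.distrib sum_distrib_right[symmetric])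
  qed
  finally show ?thesis .
qed

text \<open>The events of all transcripts partition the sample space, so that summation removes the
  algorithm altogether.\<close>

lemma sum_all_cells:
  assumes H: "\<And>j. j < m \<Longrightarrow> block_fun j (H j)"
  shows "(\<Sum>\<pi>\<in>T. \<Prod>j<m. \<integral>x. chi j \<pi> x * H j x \<partial>samples t) = (\<Prod>j<m. \<integral>x. H j x \<partial>samples t)"
proof -
  have "(\<Sum>\<pi>\<in>T. \<Prod>j<m. \<integral>x. chi j \<pi> x * H j x \<partial>samples t)
      = (\<integral>x. indicator {x. \<exists>\<pi>\<in>T. \<forall>j<m. A j \<pi> x} x * (\<Prod>j<m. H j x) \<partial>samples t)"
    by (rule sum_cells[OF subset_refl H])
  also have "\<dots> = (\<integral>x. (\<Prod>j<m. H j x) \<partial>samples t)"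
  proof (intro Bochner_Integration.integral_cong refl)
    fix x assume x: "x \<in> space (samples t)"
    have "\<exists>\<pi>\<in>T. \<forall>j<m. A j \<pi> x" using unique_transcript[OF x] by blast
    then show "indicator {x. \<exists>\<pi>\<in>T. \<forall>j<m. A j \<pi> x} x * (\<Prod>j<m. H j x) = (\<Prod>j<m. H j x)" by simp
  qed
  also have "\<dots> = (\<Prod>j<m. \<integral>x. H j x \<partial>samples t)" using H by (intro block_independence) auto
  finally show ?thesis .
qed

section \<open>Conditional likelihood ratios of blocks given the transcript\<close>

definition cell_prob :: "nat \<Rightarrow> 'p \<Rightarrow> real" where
  "cell_prob j \<pi> = (\<integral>x. chi j \<pi> x \<partial>samples t)"

text \<open>By independence of the blocks this is the probability of the transcript \<pi> under the
  reference law.\<close>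

definition weight :: "'p \<Rightarrow> real" where
  "weight \<pi> = (\<Prod>j<m. cell_prob j \<pi>)"

text \<open>Not a probability distribution on transcripts: its total mass is the mean number of
  transcripts that the blocks other than j leave open, and is bounded only by exp \<beta>.\<close>

definition weight_except :: "nat \<Rightarrow> 'p \<Rightarrow> real" where
  "weight_except j \<pi> = (\<Prod>i\<in>{..<m} - {j}. cell_prob i \<pi>)"

text \<open>The conditional mean of \<open>lr (G j) i - 1\<close> given that block j is consistent
  with \<pi>. On cells of probability 0, division by zero makes it -1; this value respects the lower
  bound -1 and is always multiplied by \<open>cell_prob j \<pi>\<close> or
  \<open>weight \<pi>\<close>.\<close>

definition deviation :: "'i \<Rightarrow> nat \<Rightarrow> 'p \<Rightarrow> real" where
  "deviation i j \<pi> = (\<integral>x. chi j \<pi> x * lr (G j) i x \<partial>samples t) / cell_prob j \<pi> - 1"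

lemma cell_prob_nonneg: "cell_prob j \<pi> \<ge> 0"
  unfolding cell_prob_def chi_def by (intro Bochner_Integration.integral_nonneg) auto

lemma weight_except_nonneg: "weight_except j \<pi> \<ge> 0"
  unfolding weight_except_def by (intro prod_nonneg) (auto intro: cell_prob_nonneg)

lemma weight_nonneg: "weight \<pi> \<ge> 0"
  unfolding weight_def by (intro prod_nonneg) (auto intro: cell_prob_nonneg)

lemma weight_split: "j < m \<Longrightarrow> weight \<pi> = cell_prob j \<pi> * weight_except j \<pi>"
  unfolding weight_def weight_except_def by (intro prod.remove) auto

lemma chi_cell:
  fixes F :: "(nat \<Rightarrow> 'x) \<Rightarrow> real"
  assumes "j < m"
  defines "C \<equiv> \<lambda>\<pi>. {x \<in> space (samples t). A j \<pi> x}"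
  shows "C \<pi> \<in> sets (samples t)" "S.prob (C \<pi>) = cell_prob j \<pi>"
    "(\<integral>x. indicator (C \<pi>) x * F x \<partial>samples t) = (\<integral>x. chi j \<pi> x * F x \<partial>samples t)"
proof -
  have "C \<pi> = chi j \<pi> -` {1} \<inter> space (samples t)" by (auto simp: C_def chi_def split: if_splits)
  then show C: "C \<pi> \<in> sets (samples t)" using measurable_sets[OF chi_measurable[OF assms(1)], of "{1}" \<pi>] by simp
  have F: "(\<integral>x. indicator (C \<pi>) x * F x \<partial>samples t) = (\<integral>x. chi j \<pi> x * F x \<partial>samples t)"
    for F :: "(nat \<Rightarrow> 'x) \<Rightarrow> real"
    by (intro Bochner_Integration.integral_cong refl) (auto simp: C_def chi_def indicator_def)
  have "cell_prob j \<pi> = (\<integral>x. indicator (C \<pi>) x * 1 \<partial>samples t)" unfolding F by (simp add: cell_prob_def)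
  also have "\<dots> = S.prob (C \<pi>)" using C by simp
  finally show "S.prob (C \<pi>) = cell_prob j \<pi>" by simp
  show "(\<integral>x. indicator (C \<pi>) x * F x \<partial>samples t) = (\<integral>x. chi j \<pi> x * F x \<partial>samples t)" by (rule F)
qed

lemma chi_cauchy_schwarz:
  assumes j: "j < m" and F: "F \<in> borel_measurable (samples t)" "integrable (samples t) (\<lambda>x. (F x)\<^sup>2)"
  shows "(\<integral>x. chi j \<pi> x * F x \<partial>samples t)\<^sup>2 \<le> cell_prob j \<pi> * (\<integral>x. chi j \<pi> x * (F x)\<^sup>2 \<partial>samples t)"
  using S.indicator_cauchy_schwarz[OF chi_cell(1)[OF j] F, of \<pi>] unfolding chi_cell[OF j] .

text \<open>In product form the identity covers cells of probability 0, where the left side vanishes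
  by the Cauchy-Schwarz inequality.\<close>

lemma cell_lr:
  assumes j: "j < m" and i: "i \<in> K"
  shows "(\<integral>x. chi j \<pi> x * lr (G j) i x \<partial>samples t) = cell_prob j \<pi> * (1 + deviation i j \<pi>)"
proof (cases "cell_prob j \<pi> = 0")
  case True
  have "(\<integral>x. chi j \<pi> x * lr (G j) i x \<partial>samples t)\<^sup>2 \<le> 0"
    using chi_cauchy_schwarz[OF j measurable_lr[OF i block_subset[OF j]] lr_moments(3)[OF block_subset[OF j] i], of \<pi>] True
    by simp
  then show ?thesis using True by simp
next
  case False
  then show ?thesis by (simp add: deviation_def)
qed

lemma cell_deviation:
  assumes j: "j < m" and i: "i \<in> K"
  shows "(\<integral>x. chi j \<pi> x * (lr (G j) i x - 1) \<partial>samples t) = cell_prob j \<pi> * deviation i j \<pi>"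
proof -
  have "(\<integral>x. chi j \<pi> x * (lr (G j) i x - 1) \<partial>samples t)
      = (\<integral>x. chi j \<pi> x * lr (G j) i x - chi j \<pi> x \<partial>samples t)"
    by (simp add: algebra_simps)
  also have "\<dots> = (\<integral>x. chi j \<pi> x * lr (G j) i x \<partial>samples t) - cell_prob j \<pi>"
    using block_funD(3)[OF block_fun_chi_mult[OF j block_fun_intros(1)[OF j i]]] block_funD(3)[OF block_fun_chi[OF j]]
    by (simp add: cell_prob_def)
  finally show ?thesis by (simp add: cell_lr[OF j i] algebra_simps)
qed

text \<open>To be applied to the set T' of transcripts whose answer is not i: likely under the
  reference law, unlikely under the law i. The product of the factors
  \<open>1 + deviation i j \<pi>\<close> over j is the likelihood ratio of \<pi>, so
  \<open>testing_lower_bound\<close> applies.\<close>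

lemma deviation_lower_bound:
  assumes i: "i \<in> K" and T': "T' \<subseteq> T"
    and null: "(\<integral>x. indicator {x. \<exists>\<pi>\<in>T'. \<forall>j<m. A j \<pi> x} x \<partial>samples t) \<ge> (5 / 6 :: real)"
    and alt: "(\<integral>x. indicator {x. \<exists>\<pi>\<in>T'. \<forall>j<m. A j \<pi> x} x * lr {..<t} i x \<partial>samples t) \<le> 1 / 6"
  shows "(\<Sum>j<m. \<Sum>\<pi>\<in>T. weight \<pi> * (deviation i j \<pi>)\<^sup>2) \<ge> 1 / 48"
proof (rule testing_lower_bound[OF finite_T _ _ _ _ T'])
  show "weight \<pi> \<ge> 0" for \<pi> by (rule weight_nonneg)
  show "deviation i j \<pi> \<ge> -1" for j \<pi>
  proof -
    have "(\<integral>x. chi j \<pi> x * lr (G j) i x \<partial>samples t) \<ge> 0"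
      using lr_nonneg[OF i] by (intro Bochner_Integration.integral_nonneg) (auto simp: chi_def)
    then show ?thesis using cell_prob_nonneg[of j \<pi>] by (simp add: deviation_def)
  qed
  show "(\<Sum>\<pi>\<in>T. weight \<pi> * (deviation i a \<pi> * deviation i b \<pi>)) = 0"
    if a: "a \<in> {..<m}" and b: "b \<in> {..<m}" and "a \<noteq> b" for a b
  proof -
    \<comment> \<open>Summed over all transcripts, the product of the two deviations becomes the
      mean of \<open>lr - 1\<close> on block a times that on block b, and both are 0.\<close>
    define H where "H j = (if j = a \<or> j = b then (\<lambda>x. lr (G j) i x - 1) else (\<lambda>_. 1))" for j
    have H: "block_fun j (H j)" if "j < m" for j
      using block_fun_intros(2)[OF that i] block_fun_const by (simp add: H_def)
    have "weight \<pi> * (deviation i a \<pi> * deviation i b \<pi>) = (\<Prod>j<m. \<integral>x. chi j \<pi> x * H j x \<partial>samples t)" for \<pi>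
    proof -
      have "weight \<pi> * (deviation i a \<pi> * deviation i b \<pi>) = (\<Prod>j<m. cell_prob j \<pi>)
          * ((\<Prod>j<m. if j = a then deviation i a \<pi> else 1) * (\<Prod>j<m. if j = b then deviation i b \<pi> else 1))"
        using a b by (simp add: weight_def prod.delta)
      also have "\<dots> = (\<Prod>j<m. \<integral>x. chi j \<pi> x * H j x \<partial>samples t)"
        unfolding prod.distrib[symmetric] using \<open>a \<noteq> b\<close> cell_deviation[OF _ i]
        by (intro prod.cong refl) (auto simp: H_def cell_prob_def)
      finally show ?thesis .
    qed
    then have "(\<Sum>\<pi>\<in>T. weight \<pi> * (deviation i a \<pi> * deviation i b \<pi>)) = (\<Prod>j<m. \<integral>x. H j x \<partial>samples t)"
      using sum_all_cells[of H, OF H] by simp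
    also have "\<dots> = 0"
    proof (rule prod_zero)
      have "(\<integral>x. H a x \<partial>samples t) = 0"
        using lr_moments(1,2)[OF block_subset i, of a] a by (simp add: H_def S.prob_space)
      then show "\<exists>j\<in>{..<m}. (\<integral>x. H j x \<partial>samples t) = 0" using a by blast
    qed simp
    finally show ?thesis .
  qed
  have "(\<Sum>\<pi>\<in>T'. weight \<pi>) = (\<integral>x. indicator {x. \<exists>\<pi>\<in>T'. \<forall>j<m. A j \<pi> x} x \<partial>samples t)"
    using sum_cells[OF T', of "\<lambda>_ _. 1"] by (simp add: block_fun_const weight_def cell_prob_def)
  then show "(\<Sum>\<pi>\<in>T'. weight \<pi>) \<ge> 5 / 6" using null by simp
  have "weight \<pi> * (\<Prod>j<m. 1 + deviation i j \<pi>) = (\<Prod>j<m. \<integral>x. chi j \<pi> x * lr (G j) i x \<partial>samples t)" for \<pi>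
    unfolding weight_def prod.distrib[symmetric] by (intro prod.cong refl) (simp add: cell_lr i)
  then have "(\<Sum>\<pi>\<in>T'. weight \<pi> * (\<Prod>j<m. 1 + deviation i j \<pi>))
      = (\<integral>x. indicator {x. \<exists>\<pi>\<in>T'. \<forall>j<m. A j \<pi> x} x * (\<Prod>j<m. lr (G j) i x) \<partial>samples t)"
    using sum_cells[OF T', of "\<lambda>j. lr (G j) i"] block_fun_intros(1)[OF _ i] by simp
  also have "(\<lambda>x. \<Prod>j<m. lr (G j) i x) = lr {..<t} i"
  proof
    fix x
    have "finite (G j)" if "j < m" for j using block_subset[OF that] finite_subset by blast
    then show "(\<Prod>j<m. lr (G j) i x) = lr {..<t} i x"
      unfolding lr_def blocks(1)[symmetric] using blocks(2)
      by (intro prod.UNION_disjoint[symmetric]) (auto simp: disjoint_family_on_def)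
  qed
  finally show "(\<Sum>\<pi>\<in>T'. weight \<pi> * (\<Prod>j<m. 1 + deviation i j \<pi>)) \<le> 1 / 6"
    using alt by (simp only:)
qed auto

section \<open>Upper bound on the deviations through the features\<close>

lemma sum_weight_except:
  assumes j: "j < m"
  shows "(\<Sum>\<pi>\<in>T. weight_except j \<pi>) \<le> exp \<beta>"
proof -
  have "(\<Sum>\<pi>\<in>T. weight_except j \<pi>) = (\<Sum>\<pi>\<in>T. \<integral>x. (\<Prod>i\<in>{..<m} - {j}. chi i \<pi> x) \<partial>samples t)"
    unfolding weight_except_def cell_prob_def using block_fun_chi
    by (intro sum.cong refl block_independence(2)[symmetric]) auto
  \<comment> \<open>The integrand counts the transcripts consistent with all blocks except
    j.\<close>
  also have "\<dots> = (\<integral>x. (\<Sum>\<pi>\<in>T. \<Prod>i\<in>{..<m} - {j}. chi i \<pi> x) \<partial>samples t)"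
    using block_fun_chi by (intro Bochner_Integration.integral_sum[symmetric] block_independence(1)) auto
  also have "\<dots> \<le> (\<integral>x. exp \<beta> \<partial>samples t)"
  proof (intro integral_mono)
    show "integrable (samples t) (\<lambda>x. \<Sum>\<pi>\<in>T. \<Prod>i\<in>{..<m} - {j}. chi i \<pi> x)"
      using block_fun_chi by (intro Bochner_Integration.integrable_sum block_independence(1)) auto
    fix x assume x: "x \<in> space (samples t)"
    have "(\<Prod>i\<in>{..<m} - {j}. chi i \<pi> x) = (if \<forall>i<m. i \<noteq> j \<longrightarrow> A i \<pi> x then 1 else 0)" for \<pi>
      unfolding chi_def by (auto intro!: prod.neutral)
    then have "(\<Sum>\<pi>\<in>T. \<Prod>i\<in>{..<m} - {j}. chi i \<pi> x) = real (card {\<pi> \<in> T. \<forall>i<m. i \<noteq> j \<longrightarrow> A i \<pi> x})"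
      using finite_T by (simp add: sum.If_cases Int_def)
    then show "(\<Sum>\<pi>\<in>T. \<Prod>i\<in>{..<m} - {j}. chi i \<pi> x) \<le> exp \<beta>" using few_transcripts[OF x j] by simp
  qed simp
  finally show ?thesis by (simp add: S.prob_space)
qed

text \<open>The block length of at most 2 \<beta> makes \<open>sample_features_mgf\<close> meet the
  exponent demanded by \<open>conditional_features_bound\<close>.\<close>

lemma cell_features_bound:
  assumes j: "j < m"
  shows "cell_prob j \<pi> * (\<Sum>i\<in>K. ((\<integral>x. chi j \<pi> x * feature (G j) i x \<partial>samples t) / cell_prob j \<pi>)\<^sup>2)
    \<le> 8 * cell_prob j \<pi> * \<beta>\<^sup>2 + 16 * \<beta>\<^sup>2 * exp (- \<beta>)"
proof (cases "cell_prob j \<pi> > 0")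
  case True
  show ?thesis
    using S.conditional_features_bound[OF finite_K feature_moments(1)[OF block_subset[OF j]] chi_cell(1)[OF j, of \<pi>] _ \<beta>
        sample_features_mgf[OF block_subset[OF j] _ card_block]] True
    unfolding chi_cell[OF j] by simp
next
  case False
  then have "cell_prob j \<pi> = 0" using cell_prob_nonneg[of j \<pi>] by simp
  then show ?thesis by simp
qed

text \<open>The linear part is kept as a conditional mean, since its sum over i is controlled by the
  joint exponential moments of the features. For the small remainder the squared conditional mean is
  replaced by the conditional second moment, which averages exactly over the transcripts.\<close>

lemma deviation_decomposition:
  assumes j: "j < m" and i: "i \<in> K"
  shows "cell_prob j \<pi> * (deviation i j \<pi>)\<^sup>2 \<le>
    2 * \<sigma>\<^sup>2 * (cell_prob j \<pi> * ((\<integral>x. chi j \<pi> x * feature (G j) i x \<partial>samples t) / cell_prob j \<pi>)\<^sup>2)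
      + 2 * (\<integral>x. chi j \<pi> x * (remainder (G j) i x)\<^sup>2 \<partial>samples t)"
proof (cases "cell_prob j \<pi> > 0")
  case False
  then have "cell_prob j \<pi> = 0" using cell_prob_nonneg[of j \<pi>] by simp
  moreover have "(\<integral>x. chi j \<pi> x * (remainder (G j) i x)\<^sup>2 \<partial>samples t) \<ge> 0"
    by (intro Bochner_Integration.integral_nonneg) (auto simp: chi_def)
  ultimately show ?thesis by simp
next
  case True
  define p where "p = cell_prob j \<pi>"
  define v where "v = (\<integral>x. chi j \<pi> x * feature (G j) i x \<partial>samples t)"
  define e where "e = (\<integral>x. chi j \<pi> x * remainder (G j) i x \<partial>samples t)"
  have p: "p > 0" using True by (simp add: p_def)
  have "p * deviation i j \<pi> = (\<integral>x. chi j \<pi> x * (lr (G j) i x - 1) \<partial>samples t)"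
    unfolding p_def cell_deviation[OF j i] ..
  also have "\<dots> = (\<integral>x. \<sigma> * (chi j \<pi> x * feature (G j) i x) + chi j \<pi> x * remainder (G j) i x \<partial>samples t)"
    by (simp add: remainder_def algebra_simps)
  also have "\<dots> = \<sigma> * v + e"
    using block_funD(3)[OF block_fun_chi_mult[OF j block_fun_intros(3)[OF j i]]]
      block_funD(3)[OF block_fun_chi_mult[OF j block_fun_intros(4)[OF j i]]]
    by (simp add: v_def e_def)
  finally have dev: "deviation i j \<pi> = \<sigma> * (v / p) + e / p" using p by (simp add: field_simps)
  have "(deviation i j \<pi>)\<^sup>2 \<le> 2 * (\<sigma> * (v / p))\<^sup>2 + 2 * (e / p)\<^sup>2"
    unfolding dev using sum_squares_bound[of "\<sigma> * (v / p)" "e / p"] by (simp add: power2_sum)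
  then have "p * (deviation i j \<pi>)\<^sup>2 \<le> p * (2 * (\<sigma> * (v / p))\<^sup>2 + 2 * (e / p)\<^sup>2)"
    using p by (intro mult_left_mono) auto
  also have "\<dots> = 2 * \<sigma>\<^sup>2 * (p * (v / p)\<^sup>2) + 2 * (e\<^sup>2 / p)"
    using p by (simp add: power2_eq_square field_simps)
  also have "e\<^sup>2 / p \<le> (\<integral>x. chi j \<pi> x * (remainder (G j) i x)\<^sup>2 \<partial>samples t)"
    using chi_cauchy_schwarz[OF j measurable_remainder[OF i block_subset[OF j]]
        remainder_second_moment(1)[OF block_subset[OF j] i], of \<pi>] p
    by (simp add: e_def p_def field_simps)
  finally show ?thesis by (simp add: p_def v_def)
qed

text \<open>The cell bounds are averaged with \<open>weight_except\<close>. For the linear part, 8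
  \<beta>^2 meets a total probability 1, and 16 \<beta>^2 exp (-\<beta>) meets a total mass of at
  most exp \<beta>; this gives 24 \<beta>^2, and 48 after the factor 2 from the
  decomposition.\<close>

lemma deviation_upper_bound:
  fixes \<rho> :: real
  assumes j: "j < m" and rho: "\<And>i. i \<in> K \<Longrightarrow> (\<integral>x. (remainder (G j) i x)\<^sup>2 \<partial>samples t) \<le> \<rho>"
  shows "(\<Sum>i\<in>K. \<Sum>\<pi>\<in>T. weight \<pi> * (deviation i j \<pi>)\<^sup>2) \<le> 48 * \<sigma>\<^sup>2 * \<beta>\<^sup>2 + 2 * card K * \<rho>"
proof -
  define V where "V i \<pi> = cell_prob j \<pi> * ((\<integral>x. chi j \<pi> x * feature (G j) i x \<partial>samples t) / cell_prob j \<pi>)\<^sup>2" for i \<pi>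
  define E where "E i \<pi> = (\<integral>x. chi j \<pi> x * (remainder (G j) i x)\<^sup>2 \<partial>samples t)" for i \<pi>
  have "(\<Sum>i\<in>K. \<Sum>\<pi>\<in>T. weight \<pi> * (deviation i j \<pi>)\<^sup>2)
      \<le> (\<Sum>i\<in>K. \<Sum>\<pi>\<in>T. weight_except j \<pi> * (2 * \<sigma>\<^sup>2 * V i \<pi> + 2 * E i \<pi>))"
  proof (intro sum_mono)
    fix i \<pi> assume i: "i \<in> K"
    have "weight \<pi> * (deviation i j \<pi>)\<^sup>2 = weight_except j \<pi> * (cell_prob j \<pi> * (deviation i j \<pi>)\<^sup>2)"
      by (simp add: weight_split[OF j])
    also have "\<dots> \<le> weight_except j \<pi> * (2 * \<sigma>\<^sup>2 * V i \<pi> + 2 * E i \<pi>)"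
      unfolding V_def E_def by (intro mult_left_mono deviation_decomposition j i weight_except_nonneg)
    finally show "weight \<pi> * (deviation i j \<pi>)\<^sup>2 \<le> weight_except j \<pi> * (2 * \<sigma>\<^sup>2 * V i \<pi> + 2 * E i \<pi>)" .
  qed
  also have "\<dots> = 2 * \<sigma>\<^sup>2 * (\<Sum>\<pi>\<in>T. weight_except j \<pi> * (\<Sum>i\<in>K. V i \<pi>))
      + 2 * (\<Sum>i\<in>K. \<Sum>\<pi>\<in>T. weight_except j \<pi> * E i \<pi>)"
  proof -
    have "(\<Sum>\<pi>\<in>T. weight_except j \<pi> * (\<Sum>i\<in>K. V i \<pi>)) = (\<Sum>i\<in>K. \<Sum>\<pi>\<in>T. weight_except j \<pi> * V i \<pi>)"
      unfolding sum_distrib_left by (rule sum.swap)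
    then show ?thesis by (simp add: sum_distrib_left sum.distrib algebra_simps)
  qed
  also have "\<dots> \<le> 2 * \<sigma>\<^sup>2 * (24 * \<beta>\<^sup>2) + 2 * (card K * \<rho>)"
  proof (intro add_mono mult_left_mono)
    have "(\<Sum>\<pi>\<in>T. weight_except j \<pi> * (\<Sum>i\<in>K. V i \<pi>))
        \<le> (\<Sum>\<pi>\<in>T. weight_except j \<pi> * (8 * cell_prob j \<pi> * \<beta>\<^sup>2 + 16 * \<beta>\<^sup>2 * exp (- \<beta>)))"
      unfolding V_def sum_distrib_left[symmetric]
      by (intro sum_mono mult_left_mono cell_features_bound j weight_except_nonneg)
    also have "\<dots> = 8 * \<beta>\<^sup>2 * (\<Sum>\<pi>\<in>T. weight \<pi>) + 16 * \<beta>\<^sup>2 * exp (- \<beta>) * (\<Sum>\<pi>\<in>T. weight_except j \<pi>)"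
      by (simp add: weight_split[OF j] sum_distrib_left sum.distrib algebra_simps)
    also have "(\<Sum>\<pi>\<in>T. weight \<pi>) = 1"
      using sum_all_cells[of "\<lambda>_ _. 1"] by (simp add: block_fun_const weight_def cell_prob_def S.prob_space)
    also have "16 * \<beta>\<^sup>2 * exp (- \<beta>) * (\<Sum>\<pi>\<in>T. weight_except j \<pi>) \<le> 16 * \<beta>\<^sup>2 * exp (- \<beta>) * exp \<beta>"
      by (intro mult_left_mono sum_weight_except j) auto
    finally show "(\<Sum>\<pi>\<in>T. weight_except j \<pi> * (\<Sum>i\<in>K. V i \<pi>)) \<le> 24 * \<beta>\<^sup>2"
      by (simp add: exp_minus field_simps)
    have "(\<Sum>\<pi>\<in>T. weight_except j \<pi> * E i \<pi>) \<le> \<rho>" if i: "i \<in> K" for i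
    proof -
      \<comment> \<open>Averaging over the transcripts removes the conditioning: the sum is the
        unconditional second moment of the remainder.\<close>
      define H where "H a = (if a = j then (\<lambda>x. (remainder (G j) i x)\<^sup>2) else (\<lambda>_. 1))" for a
      have H: "block_fun a (H a)" if "a < m" for a
        using block_fun_intros(5)[OF j i] block_fun_const by (simp add: H_def)
      have "weight_except j \<pi> * E i \<pi> = (\<Prod>a<m. \<integral>x. chi a \<pi> x * H a x \<partial>samples t)" for \<pi>
      proof -
        have "(\<Prod>a<m. \<integral>x. chi a \<pi> x * H a x \<partial>samples t)
            = (\<integral>x. chi j \<pi> x * H j x \<partial>samples t) * (\<Prod>a\<in>{..<m} - {j}. \<integral>x. chi a \<pi> x * H a x \<partial>samples t)"
          using j by (intro prod.remove) auto
        also have "\<dots> = E i \<pi> * weight_except j \<pi>"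
          unfolding weight_except_def cell_prob_def E_def
          by (intro arg_cong2[of _ _ _ _ "(*)"] prod.cong) (auto simp: H_def)
        finally show ?thesis by simp
      qed
      then have "(\<Sum>\<pi>\<in>T. weight_except j \<pi> * E i \<pi>) = (\<Prod>a<m. \<integral>x. H a x \<partial>samples t)"
        using sum_all_cells[of H, OF H] by simp
      also have "\<dots> = (\<Prod>a<m. if a = j then \<integral>x. (remainder (G j) i x)\<^sup>2 \<partial>samples t else 1)"
        by (intro prod.cong refl) (auto simp: H_def S.prob_space)
      also have "\<dots> = (\<integral>x. (remainder (G j) i x)\<^sup>2 \<partial>samples t)" using j by (simp add: prod.delta)
      finally show ?thesis using rho[OF i] by simp
    qed
    then have "(\<Sum>i\<in>K. \<Sum>\<pi>\<in>T. weight_except j \<pi> * E i \<pi>) \<le> (\<Sum>i\<in>K. \<rho>)" by (intro sum_mono)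
    then show "(\<Sum>i\<in>K. \<Sum>\<pi>\<in>T. weight_except j \<pi> * E i \<pi>) \<le> card K * \<rho>" by simp
  qed auto
  finally show ?thesis by simp
qed

end

section \<open>The lower bound for weakly correlated families\<close>

text \<open>Bernoulli's inequality reduces the power to 1 / (1 - y) with y = n x, and 1 / (1 - y)
  \<le> 1 + y + 2 y^2 on [0, 1/2]. What is left after subtraction of 1 + n x is the quadratic error
  that bounds the remainders.\<close>

lemma inverse_power_le:
  fixes x :: real
  assumes "0 \<le> x" "real n * x \<le> 1 / 2"
  shows "(1 / (1 - x)) ^ n \<le> 1 + real n * x + 2 * (real n * x)\<^sup>2"
proof (cases "n = 0")
  case False
  then have "1 * x \<le> real n * x" using assms(1) by (intro mult_right_mono) auto
  then have x: "x \<le> 1 / 2" using assms(2) by simp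
  define y where "y = real n * x"
  have y: "0 \<le> y" "y \<le> 1 / 2" using assms by (auto simp: y_def)
  have "1 - y \<le> (1 - x) ^ n" using Bernoulli_inequality[of "- x" n] x by (simp add: y_def)
  then have "1 / (1 - x) ^ n \<le> 1 / (1 - y)" using y x by (intro divide_left_mono) auto
  also have "\<dots> \<le> 1 + y + 2 * y\<^sup>2"
  proof -
    have "0 \<le> y\<^sup>2 * (1 - 2 * y)" using y by simp
    then have "1 \<le> (1 + y + 2 * y\<^sup>2) * (1 - y)" by (simp add: power2_eq_square algebra_simps)
    then show ?thesis using y by (simp add: field_simps)
  qed
  finally show ?thesis by (simp add: y_def power_one_over)
qed simp

context weakly_correlated
begin

text \<open>Even with unlimited memory, telling the law i from the reference law takes about 1 /
  \<sigma>^2 samples; this settles the range in which blocks of length 2 s l are too long. The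
  change in the probability of B is bounded by the chi-square divergence between the two laws of the
  sample.\<close>

lemma few_samples:
  assumes i: "i \<in> K" and B: "B \<in> sets (samples t)"
    and null: "measure (samples t) B \<le> 1 / 6"
    and alt: "(\<integral>x. indicator B x * lr {..<t} i x \<partial>samples t) \<ge> 5 / 6"
  shows "real t * \<sigma>\<^sup>2 \<ge> 1 / 4"
proof (rule ccontr)
  assume "\<not> real t * \<sigma>\<^sup>2 \<ge> 1 / 4"
  then have small: "real t * \<sigma>\<^sup>2 < 1 / 4" by simp
  interpret S: prob_space "samples t" by (intro prob_space_PiM) unfold_locales
  note lr = lr_moments[OF subset_refl i, of t]
  have m: "lr {..<t} i \<in> borel_measurable (samples t)" using measurable_lr[OF i] by simp
  have IB: "integrable (samples t) (indicat_real B)"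
    using B by (intro integrable_real_indicator) (auto simp: less_top[symmetric])
  have Il: "integrable (samples t) (\<lambda>x. indicator B x * lr {..<t} i x)"
    using integrable_real_mult_indicator[OF B lr(1)] by (simp add: mult.commute)
  have sq: "(\<lambda>x. (lr {..<t} i x - 1)\<^sup>2) = (\<lambda>x. (lr {..<t} i x)\<^sup>2 - 2 * lr {..<t} i x + 1)"
    by (simp add: power2_eq_square algebra_simps)
  have I2: "integrable (samples t) (\<lambda>x. (lr {..<t} i x - 1)\<^sup>2)" unfolding sq using lr by simp
  have E2: "(\<integral>x. (lr {..<t} i x - 1)\<^sup>2 \<partial>samples t) = (1 / (1 - \<sigma>\<^sup>2)) ^ t - 1"
    unfolding sq using lr by (simp add: S.prob_space)
  have "2 / 3 \<le> (\<integral>x. indicator B x * lr {..<t} i x \<partial>samples t) - S.prob B" using null alt by simp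
  also have "\<dots> = (\<integral>x. indicator B x * lr {..<t} i x - indicator B x \<partial>samples t)"
    using IB Il B by simp
  also have "\<dots> = (\<integral>x. indicator B x * (lr {..<t} i x - 1) \<partial>samples t)" by (simp add: algebra_simps)
  finally have "(2 / 3)\<^sup>2 \<le> (\<integral>x. indicator B x * (lr {..<t} i x - 1) \<partial>samples t)\<^sup>2"
    by (intro power_mono) auto
  also have "\<dots> \<le> S.prob B * (\<integral>x. indicator B x * (lr {..<t} i x - 1)\<^sup>2 \<partial>samples t)"
    using m I2 B by (intro S.indicator_cauchy_schwarz) auto
  also have "\<dots> \<le> 1 * (\<integral>x. (lr {..<t} i x - 1)\<^sup>2 \<partial>samples t)"
  proof (intro mult_mono)
    show "(\<integral>x. indicator B x * (lr {..<t} i x - 1)\<^sup>2 \<partial>samples t) \<le> (\<integral>x. (lr {..<t} i x - 1)\<^sup>2 \<partial>samples t)"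
      using I2 integrable_real_mult_indicator[OF B I2]
      by (intro integral_mono) (auto simp: mult.commute indicator_def)
  qed auto
  also have "\<dots> = (1 / (1 - \<sigma>\<^sup>2)) ^ t - 1" using E2 by simp
  also have "\<dots> \<le> real t * \<sigma>\<^sup>2 + 2 * (real t * \<sigma>\<^sup>2)\<^sup>2"
    using inverse_power_le[of "\<sigma>\<^sup>2" t] small by simp
  \<comment> \<open>The value is 3/8, which is below (2/3)^2 = 4/9.\<close>
  also have "\<dots> \<le> 1 / 4 + 2 * (1 / 4)\<^sup>2"
    using small by (intro add_mono mult_left_mono power_mono) auto
  finally show False by (simp add: power2_eq_square)
qed

text \<open>The lower bound 1/48, summed over at least half of K, is compared with the upper bounds
  summed over all blocks: card K / 96 \<le> 64 t s l \<sigma>^2, and 96 * 64 = 6144.\<close>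

theorem identification_lower_bound:
  assumes K: "card K \<ge> 12" "real (card K) * \<sigma>\<^sup>2 \<le> 1"
    and tsl: "t \<ge> 1" "s \<ge> 1" "l \<ge> 1"
    and alg: "identifying_algorithm t s l K (\<lambda>i. density N (\<l> i)) (1 / 6) f u h"
  shows "real (card K) \<le> 6144 * (real t * real s * real l * \<sigma>\<^sup>2)"
proof -
  interpret S: prob_space "samples t" by (intro prob_space_PiM) unfold_locales
  define B where "B i = {x \<in> space (samples t). h (memory_state t f u x (t * l)) = i}" for i
  have u: "length u = s"
    and len: "\<And>x j v. x \<in> space N \<Longrightarrow> j < t * l \<Longrightarrow> length v = s \<Longrightarrow> length (f j x v) = s"
    using alg K(1) unfolding identifying_algorithm_def by fastforce+
  have success: "measure (PiM {..<t} (\<lambda>_. density N (\<l> i))) (B i) \<ge> 5 / 6" if "i \<in> K" for i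
    using alg that unfolding identifying_algorithm_def B_def by (auto simp: space_PiM)
  have B_sets: "B i \<in> sets (samples t)" if i: "i \<in> K" for i
  proof (rule ccontr)
    assume "B i \<notin> sets (samples t)"
    moreover have "sets (PiM {..<t} (\<lambda>_. density N (\<l> i))) = sets (samples t)" by (intro sets_PiM_cong) auto
    ultimately have "measure (PiM {..<t} (\<lambda>_. density N (\<l> i))) (B i) = 0" by (simp add: measure_notin_sets)
    then show False using success[OF i] by simp
  qed
  have alt: "(\<integral>x. indicator (B i) x * lr {..<t} i x \<partial>samples t) \<ge> 5 / 6" if "i \<in> K" for i
    using success[OF that] integral_product_density[OF that B_sets[OF that]] by simp
  \<comment> \<open>Under the reference law at most 6 answers can have probability above 1/6, so
    that with card K \<ge> 12 at least half of K remains.\<close>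
  define K' where "K' = {i \<in> K. S.prob (B i) \<le> 1 / 6}"
  have card_K': "2 * card K' \<ge> card K"
  proof -
    have fin: "finite (K - K')" using finite_K by simp
    have "real (card (K - K')) * (1 / 6) = (\<Sum>i\<in>K - K'. 1 / 6)" by simp
    also have "\<dots> \<le> (\<Sum>i\<in>K - K'. S.prob (B i))" by (intro sum_mono) (auto simp: K'_def)
    also have "\<dots> = S.prob (\<Union>i\<in>K - K'. B i)"
      using fin B_sets by (intro S.finite_measure_finite_Union[symmetric]) (auto simp: disjoint_family_on_def B_def)
    also have "\<dots> \<le> 1" by simp
    finally have "card (K - K') \<le> 6" by simp
    moreover have "card K = card K' + card (K - K')"
      using finite_K card_mono[OF finite_K, of K'] by (subst card_Diff_subset) (auto simp: K'_def)
    ultimately show ?thesis using K(1) by linarith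
  qed
  then have "K' \<noteq> {}" using K(1) by auto
  then obtain i0 where "i0 \<in> K'" by blast
  then have t: "real t * \<sigma>\<^sup>2 \<ge> 1 / 4"
    using few_samples[OF _ B_sets _ alt, of i0] by (auto simp: K'_def)
  define \<beta> where "\<beta> = real s * real l"
  define k where "k = 2 * s * l"
  have \<beta>: "\<beta> \<ge> 1" using tsl mult_mono[of 1 "real s" 1 "real l"] by (simp add: \<beta>_def)
  have k: "real k = 2 * \<beta>" by (simp add: k_def \<beta>_def)
  have k1: "k \<ge> 1" using tsl by (simp add: k_def)
  have \<sigma>2: "0 < \<sigma>\<^sup>2" using \<sigma>_pos by simp
  have K_le: "real (card K) \<le> 1 / \<sigma>\<^sup>2" using K(2) \<sigma>2 by (simp add: field_simps)
  have t_le: "1 / \<sigma>\<^sup>2 \<le> 4 * real t" using t \<sigma>2 by (simp add: field_simps)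
  have "real (card K) \<le> 6144 * (real t * \<beta> * \<sigma>\<^sup>2)"
  \<comment> \<open>If a block would be longer than the sample, or too long for the expansion of the
    likelihood ratio, then \<beta> \<sigma>^2 \<ge> 1/8, and the claim follows from t \<ge> 1 / (4
    \<sigma>^2) and card K \<le> 1 / \<sigma>^2.\<close>
  proof (cases "real k * \<sigma>\<^sup>2 \<le> 1 / 2 \<and> k \<le> t")
    case False
    have "1 / \<sigma>\<^sup>2 \<le> 6144 * (real t * \<beta> * \<sigma>\<^sup>2)"
    proof (cases "real k * \<sigma>\<^sup>2 \<le> 1 / 2")
      case True
      then have "real t \<le> 2 * \<beta>" using False k by linarith
      then have "real t * \<sigma>\<^sup>2 \<le> 2 * \<beta> * \<sigma>\<^sup>2" using \<sigma>2 by (intro mult_right_mono) auto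
      then have "1 / 8 \<le> \<beta> * \<sigma>\<^sup>2" using t by linarith
      then have "real t * (1 / 8) \<le> real t * (\<beta> * \<sigma>\<^sup>2)" by (intro mult_left_mono) auto
      then show ?thesis using t_le by (simp add: mult.assoc)
    next
      case False
      then have "1 / 8 \<le> \<beta> * \<sigma>\<^sup>2" using k by simp
      then have "real t * (1 / 8) \<le> real t * (\<beta> * \<sigma>\<^sup>2)" by (intro mult_left_mono) auto
      then show ?thesis using t_le by (simp add: mult.assoc)
    qed
    then show ?thesis using K_le by linarith
  next
    case True
    obtain f' where f':
      "\<And>x j v. x \<in> space N \<Longrightarrow> j < t * l \<Longrightarrow> length v = s \<Longrightarrow> length (f' j x v) = s"
      "\<And>j v. (\<lambda>x. f' j x v) \<in> N \<rightarrow>\<^sub>M count_space UNIV"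
      "\<And>x i. x \<in> space (samples t) \<Longrightarrow> i \<in> K \<Longrightarrow>
         h (memory_state t f' u x (t * l)) = i \<longleftrightarrow> h (memory_state t f u x (t * l)) = i"
    proof (rule measurable_updates[OF tsl(1) u, where M = N and f = f and l = l and K = K and h = h])
      show "{x \<in> space (samples t). h (memory_state t f u x (t * l)) = i} \<in> sets (samples t)" if "i \<in> K" for i
        using B_sets[OF that] by (simp add: B_def)
    qed (rule len, assumption+, blast)
    define m where "m = (t + k - 1) div k"
    obtain G :: "nat \<Rightarrow> nat set" and T :: "(nat \<Rightarrow> bool list) set"
      and A :: "nat \<Rightarrow> (nat \<Rightarrow> bool list) \<Rightarrow> (nat \<Rightarrow> 'x) \<Rightarrow> bool"
      and out :: "(nat \<Rightarrow> bool list) \<Rightarrow> bool list"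
      where tr: "\<And>j. card (G j) \<le> k" "(\<Union>j<m. G j) = {..<t}" "disjoint_family_on G {..<m}" "finite T"
      "\<And>j \<pi>. j < m \<Longrightarrow> {x \<in> space (PiM (G j) (\<lambda>_. N)). A j \<pi> x} \<in> sets (PiM (G j) (\<lambda>_. N))"
      "\<And>j \<pi> x. j < m \<Longrightarrow> A j \<pi> (restrict x (G j)) \<longleftrightarrow> A j \<pi> x"
      "\<And>x. x \<in> space (samples t) \<Longrightarrow> \<exists>!\<pi>. \<pi> \<in> T \<and> (\<forall>j<m. A j \<pi> x)"
      "\<And>x \<pi>. x \<in> space (samples t) \<Longrightarrow> \<pi> \<in> T \<Longrightarrow> \<forall>j<m. A j \<pi> x \<Longrightarrow> memory_state t f' u x (t * l) = out \<pi>"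
      "\<And>x j. x \<in> space (samples t) \<Longrightarrow> j < m \<Longrightarrow> card {\<pi> \<in> T. \<forall>i<m. i \<noteq> j \<longrightarrow> A i \<pi> x} \<le> 2 ^ (s * l)"
      unfolding m_def by (rule transcripts[OF tsl(1) k1 tsl(3) u f'(1,2)]) blast+
    interpret block_protocol N K \<l> g \<sigma> t m \<beta> G T A
    proof
      show "\<beta> \<ge> 1" by fact
      show "real (card (G j)) \<le> 2 * \<beta>" for j using tr(1)[of j] k by linarith
      show "real (card {\<pi> \<in> T. \<forall>i<m. i \<noteq> j \<longrightarrow> A i \<pi> x}) \<le> exp \<beta>"
        if "x \<in> space (samples t)" "j < m" for x j
      proof -
        have "real (card {\<pi> \<in> T. \<forall>i<m. i \<noteq> j \<longrightarrow> A i \<pi> x}) \<le> real (2 ^ (s * l))"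
          using tr(9)[OF that] by (simp only: of_nat_le_iff)
        also have "\<dots> = 2 ^ (s * l)" by simp
        also have "\<dots> \<le> exp 1 ^ (s * l)"
          using exp_ge_add_one_self[of 1] by (intro power_mono) auto
        also have "\<dots> = exp \<beta>" by (simp add: exp_of_nat_mult[symmetric] \<beta>_def)
        finally show ?thesis .
      qed
      show "(\<Union>j<m. G j) = {..<t}" "disjoint_family_on G {..<m}" "finite T" by (rule tr)+
      show "{x \<in> space (PiM (G j) (\<lambda>_. N)). A j \<pi> x} \<in> sets (PiM (G j) (\<lambda>_. N))" if "j < m" for j \<pi>
        by (rule tr(5)[OF that])
      show "A j \<pi> (restrict x (G j)) \<longleftrightarrow> A j \<pi> x" if "j < m" for j \<pi> x by (rule tr(6)[OF that])
      show "\<exists>!\<pi>. \<pi> \<in> T \<and> (\<forall>j<m. A j \<pi> x)" if "x \<in> space (samples t)" for x by (rule tr(7)[OF that])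
    qed
    define D where "D i = (\<Sum>j<m. \<Sum>\<pi>\<in>T. weight \<pi> * (deviation i j \<pi>)\<^sup>2)" for i
    have "D i \<ge> 1 / 48" if i': "i \<in> K'" for i
    proof -
      have i: "i \<in> K" and null: "S.prob (B i) \<le> 1 / 6" using i' by (auto simp: K'_def)
      define T' where "T' = {\<pi> \<in> T. h (out \<pi>) \<noteq> i}"
      have ind: "indicator {x. \<exists>\<pi>\<in>T'. \<forall>j<m. A j \<pi> x} x = (1 - indicator (B i) x :: real)"
        if x: "x \<in> space (samples t)" for x
      proof -
        obtain \<pi> where \<pi>: "\<pi> \<in> T" "\<forall>j<m. A j \<pi> x" "\<And>\<pi>'. \<pi>' \<in> T \<Longrightarrow> \<forall>j<m. A j \<pi>' x \<Longrightarrow> \<pi>' = \<pi>"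
          using tr(7)[OF x] by blast
        have "x \<in> B i \<longleftrightarrow> h (out \<pi>) = i"
          using f'(3)[OF x i] tr(8)[OF x \<pi>(1,2)] x by (simp add: B_def)
        moreover have "(\<exists>\<pi>\<in>T'. \<forall>j<m. A j \<pi> x) \<longleftrightarrow> h (out \<pi>) \<noteq> i"
          using \<pi> unfolding T'_def by blast
        ultimately show ?thesis by (auto simp: indicator_def)
      qed
      have IB: "integrable (samples t) (indicat_real (B i))"
        using B_sets[OF i] by (intro integrable_real_indicator) (auto simp: less_top[symmetric])
      have Il: "integrable (samples t) (\<lambda>x. indicator (B i) x * lr {..<t} i x)"
        using integrable_real_mult_indicator[OF B_sets[OF i] lr_moments(1)[OF subset_refl i]]
        by (simp add: mult.commute)
      show ?thesis unfolding D_def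
      proof (rule deviation_lower_bound[OF i])
        show "T' \<subseteq> T" by (auto simp: T'_def)
        have "(\<integral>x. indicator {x. \<exists>\<pi>\<in>T'. \<forall>j<m. A j \<pi> x} x \<partial>samples t) = (\<integral>x. 1 - indicat_real (B i) x \<partial>samples t)"
          by (intro Bochner_Integration.integral_cong refl ind)
        also have "\<dots> = 1 - S.prob (B i)" using IB B_sets[OF i] by (simp add: S.prob_space)
        finally show "(\<integral>x. indicator {x. \<exists>\<pi>\<in>T'. \<forall>j<m. A j \<pi> x} x \<partial>samples t) \<ge> (5 / 6 :: real)"
          using null by simp
        have "(\<integral>x. indicator {x. \<exists>\<pi>\<in>T'. \<forall>j<m. A j \<pi> x} x * lr {..<t} i x \<partial>samples t)
            = (\<integral>x. lr {..<t} i x - indicator (B i) x * lr {..<t} i x \<partial>samples t)"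
          by (intro Bochner_Integration.integral_cong refl) (simp add: ind algebra_simps)
        also have "\<dots> = 1 - (\<integral>x. indicator (B i) x * lr {..<t} i x \<partial>samples t)"
          using Il lr_moments(1,2)[OF subset_refl i, of t] by simp
        finally show "(\<integral>x. indicator {x. \<exists>\<pi>\<in>T'. \<forall>j<m. A j \<pi> x} x * lr {..<t} i x \<partial>samples t) \<le> 1 / 6"
          using alt[OF i] by simp
      qed
    qed
    then have "(\<Sum>i\<in>K'. 1 / 48) \<le> (\<Sum>i\<in>K'. D i)" by (rule sum_mono)
    also have "\<dots> \<le> (\<Sum>i\<in>K. D i)"
      unfolding D_def using finite_K weight_nonneg
      by (intro sum_mono2 sum_nonneg mult_nonneg_nonneg) (auto simp: K'_def)
    also have "\<dots> = (\<Sum>j<m. \<Sum>i\<in>K. \<Sum>\<pi>\<in>T. weight \<pi> * (deviation i j \<pi>)\<^sup>2)"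
      unfolding D_def by (rule sum.swap)
    also have "\<dots> \<le> (\<Sum>j<m. 48 * \<sigma>\<^sup>2 * \<beta>\<^sup>2 + 2 * card K * (8 * \<beta>\<^sup>2 * \<sigma>\<^sup>2 * \<sigma>\<^sup>2))"
    proof (intro sum_mono deviation_upper_bound)
      fix j i assume j: "j \<in> {..<m}" and i: "i \<in> K"
      have c: "real (card (G j)) * \<sigma>\<^sup>2 \<le> real k * \<sigma>\<^sup>2" using tr(1)[of j] by (intro mult_right_mono) auto
      have "(\<integral>x. (remainder (G j) i x)\<^sup>2 \<partial>samples t) = (1 / (1 - \<sigma>\<^sup>2)) ^ card (G j) - 1 - card (G j) * \<sigma>\<^sup>2"
        using j by (intro remainder_second_moment(2) block_subset i) auto
      also have "\<dots> \<le> 2 * (real (card (G j)) * \<sigma>\<^sup>2)\<^sup>2"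
        using inverse_power_le[of "\<sigma>\<^sup>2" "card (G j)"] c True by simp
      also have "\<dots> \<le> 2 * (real k * \<sigma>\<^sup>2)\<^sup>2" using c by (intro mult_left_mono power_mono) auto
      also have "\<dots> = 8 * \<beta>\<^sup>2 * \<sigma>\<^sup>2 * \<sigma>\<^sup>2" by (simp add: k power2_eq_square)
      finally show "(\<integral>x. (remainder (G j) i x)\<^sup>2 \<partial>samples t) \<le> 8 * \<beta>\<^sup>2 * \<sigma>\<^sup>2 * \<sigma>\<^sup>2" .
    qed auto
    also have "\<dots> = real m * (48 * \<sigma>\<^sup>2 * \<beta>\<^sup>2 + 16 * \<beta>\<^sup>2 * \<sigma>\<^sup>2 * (card K * \<sigma>\<^sup>2))" by simp
    \<comment> \<open>Here card K * \<sigma>^2 \<le> 1 keeps the remainders, summed over K, within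
      the order of the main term.\<close>
    also have "\<dots> \<le> real m * (48 * \<sigma>\<^sup>2 * \<beta>\<^sup>2 + 16 * \<beta>\<^sup>2 * \<sigma>\<^sup>2 * 1)"
      using K(2) by (intro mult_left_mono add_left_mono) auto
    also have "\<dots> = (real m * \<beta>) * (64 * \<beta> * \<sigma>\<^sup>2)" by (simp add: power2_eq_square algebra_simps)
    also have "\<dots> \<le> real t * (64 * \<beta> * \<sigma>\<^sup>2)"
    proof (intro mult_right_mono)
      \<comment> \<open>Rounding up the number of blocks costs at most a factor 2 because k \<le> t;
        it cancels against the 2 in k = 2 \<beta>.\<close>
      have "m * k \<le> t + k - 1" unfolding m_def by (simp add: div_times_less_eq_dividend)
      also have "\<dots> \<le> 2 * t" using conjunct2[OF True] by arith
      finally have "real (m * k) \<le> real (2 * t)" by (simp only: of_nat_le_iff)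
      then have "real m * real k \<le> 2 * real t" by simp
      then show "real m * \<beta> \<le> real t" by (simp add: k)
    qed (use \<beta> in auto)
    finally show ?thesis using card_K' by (simp add: algebra_simps)
  qed
  then show ?thesis by (simp add: \<beta>_def mult_ac)
qed

end

section \<open>Pairwise correlated Gaussians\<close>

abbreviation std_gaussian :: "real measure" where
  "std_gaussian \<equiv> density lborel (\<lambda>x. ennreal (std_normal_density x))"

abbreviation std_gaussians :: "nat set \<Rightarrow> (nat \<Rightarrow> real) measure" where
  "std_gaussians I \<equiv> PiM I (\<lambda>_. std_gaussian)"

text \<open>The density of a standard Gaussian pair with correlation \<open>\<sigma>\<close> with respect to an independent one.\<close>

definition pair_lr :: "real \<Rightarrow> real \<Rightarrow> real \<Rightarrow> real" where
  "pair_lr \<sigma> x y = exp (- (\<sigma>\<^sup>2 * (x\<^sup>2 + y\<^sup>2) - 2 * \<sigma> * x * y) / (2 * (1 - \<sigma>\<^sup>2))) / sqrt (1 - \<sigma>\<^sup>2)"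

lemma pair_lr_nonneg: "0 < \<sigma> \<Longrightarrow> \<sigma> < 1 \<Longrightarrow> pair_lr \<sigma> x y \<ge> 0"
  by (simp add: pair_lr_def power_le_one)

text \<open>Subtracting \<sigma> times row i from row j leaves an upper triangular matrix with
  diagonal entry 1 - \<sigma>^2 in row j and 1 elsewhere.\<close>

lemma det_pair_cov:
  assumes "i < j" "j < d"
  shows "Determinant.det (pair_cov d \<sigma> {i, j}) = 1 - \<sigma>\<^sup>2"
proof -
  define S where "S = pair_cov d \<sigma> {i, j}"
  define U where "U = addrow (- \<sigma>) j i S"
  have S: "S \<in> carrier_mat d d" by (simp add: S_def pair_cov_def)
  have S_entry: "S $$ (a, b) = (if a = b then 1 else if a = i \<and> b = j \<or> a = j \<and> b = i then \<sigma> else 0)"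
    if "a < d" "b < d" for a b
    using that by (auto simp: S_def pair_cov_def doubleton_eq_iff)
  have U_entry: "U $$ (a, b) = (if a = j then - \<sigma> * S $$ (i, b) + S $$ (j, b) else S $$ (a, b))"
    if "a < d" "b < d" for a b
    using that S by (auto simp: U_def)
  have U: "U \<in> carrier_mat d d" using S by (simp add: U_def)
  have "Determinant.det S = Determinant.det U"
    unfolding U_def by (rule det_addrow[OF _ _ S, symmetric]) (use assms in auto)
  also have "\<dots> = prod_list (diag_mat U)"
  proof (rule det_upper_triangular[OF _ U])
    show "upper_triangular U"
    proof
      fix a b assume "b < a" "a < dim_row U"
      then show "U $$ (a, b) = 0" using assms U by (auto simp: U_entry S_entry)
    qed
  qed
  also have "\<dots> = (\<Prod>a = 0..<d. U $$ (a, a))" using U by (simp add: prod_list_diag_prod)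
  also have "\<dots> = (\<Prod>a = 0..<d. if a = j then 1 - \<sigma>\<^sup>2 else 1)"
    using assms by (intro prod.cong) (auto simp: U_entry S_entry power2_eq_square)
  also have "\<dots> = 1 - \<sigma>\<^sup>2" using assms by (simp add: prod.delta)
  finally show ?thesis by (simp add: S_def)
qed

text \<open>On the pair the inverse has diagonal entries 1 / (1 - \<sigma>^2) and off-diagonal
  entries -\<sigma> / (1 - \<sigma>^2). Writing the former as 1 + \<sigma>^2 / (1 - \<sigma>^2)
  separates the identity, which belongs to the standard Gaussian density, from the correction, which
  belongs to \<open>pair_lr\<close>.\<close>

lemma mat_inverse_pair_cov:
  assumes ij: "i < j" "j < d" and \<sigma>: "0 < \<sigma>" "\<sigma> < 1" and ab: "a < d" "b < d"
  shows "the (mat_inverse (pair_cov d \<sigma> {i, j})) $$ (a, b) = of_bool (a = b)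
      + \<sigma>\<^sup>2 / (1 - \<sigma>\<^sup>2) * (of_bool (a = i \<and> b = i) + of_bool (a = j \<and> b = j))
      - \<sigma> / (1 - \<sigma>\<^sup>2) * (of_bool (a = i \<and> b = j) + of_bool (a = j \<and> b = i))"
proof -
  define S where "S = pair_cov d \<sigma> {i, j}"
  define p where "p = \<sigma>\<^sup>2 / (1 - \<sigma>\<^sup>2)"
  define q where "q = \<sigma> / (1 - \<sigma>\<^sup>2)"
  define r where "r a b = of_bool (a = b) + p * (of_bool (a = i \<and> b = i) + of_bool (a = j \<and> b = j))
      - q * (of_bool (a = i \<and> b = j) + of_bool (a = j \<and> b = i))" for a b
  define R where "R = mat d d (\<lambda>(a, b). r a b)"
  have \<sigma>2: "1 - \<sigma>\<^sup>2 > 0" using \<sigma> by (simp add: power_less_one_iff abs_square_less_1)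
  have pq: "\<sigma> * q = p" "\<sigma> + \<sigma> * p = q"
    using \<sigma>2 by (auto simp: p_def q_def power2_eq_square divide_simps) (simp add: algebra_simps)
  have S: "S \<in> carrier_mat d d" by (simp add: S_def pair_cov_def)
  have R: "R \<in> carrier_mat d d" by (simp add: R_def)
  have S_entry: "S $$ (a, c) = (if c = a then 1 else 0) + \<sigma> * (if a = i then if c = j then 1 else 0 else 0)
      + \<sigma> * (if a = j then if c = i then 1 else 0 else 0)"
    if "a < d" "c < d" for a c
    using that ij by (auto simp: S_def pair_cov_def doubleton_eq_iff)
  have SR: "S * R = 1\<^sub>m d"
  proof (rule eq_matI)
    fix a b assume "a < dim_row (1\<^sub>m d)" "b < dim_col (1\<^sub>m d)"
    then have ab: "a < d" "b < d" by auto
    have "(S * R) $$ (a, b) = (\<Sum>c = 0..<d. S $$ (a, c) * r c b)"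
      using S ab by (simp add: scalar_prod_def R_def)
    also have "\<dots> = (\<Sum>c = 0..<d. (if c = a then r c b else 0)
        + (if c = j then if a = i then \<sigma> * r c b else 0 else 0) + (if c = i then if a = j then \<sigma> * r c b else 0 else 0))"
      using ab by (intro sum.cong refl) (auto simp: S_entry ring_distribs)
    also have "\<dots> = r a b + (if a = i then \<sigma> * r j b else 0) + (if a = j then \<sigma> * r i b else 0)"
      using ab ij by (simp add: sum.distrib sum.delta)
    also have "\<dots> = (if a = b then 1 else 0)"
    proof -
      consider "a = i" | "a = j" | "a \<noteq> i" "a \<noteq> j" by blast
      then show ?thesis
      proof cases
        case 1
        then show ?thesis
          using ij pq by (cases "b = i"; cases "b = j") (simp_all add: r_def ring_distribs)
      next
        case 2
        then show ?thesis
          using ij pq by (cases "b = i"; cases "b = j") (simp_all add: r_def ring_distribs)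
      next
        case 3
        then show ?thesis by (simp add: r_def)
      qed
    qed
    finally show "(S * R) $$ (a, b) = 1\<^sub>m d $$ (a, b)" using ab by simp
  qed (use S R in auto)
  have RS: "R * S = 1\<^sub>m d" by (rule mat_mult_left_right_inverse[OF S R SR])
  \<comment> \<open>The result \<open>None\<close> is excluded because S is a unit, and uniqueness
    of inverses identifies any other result with R.\<close>
  have "the (mat_inverse S) = R"
  proof (cases "mat_inverse S")
    case None
    have "S \<in> Units (ring_mat TYPE(real) d ())"
      using S R SR RS unfolding Units_def by (auto simp: ring_mat_def)
    with mat_inverse(1)[OF S None, where b = "()"] show ?thesis by blast
  next
    case (Some B)
    from mat_inverse(2)[OF S this] have B: "S * B = 1\<^sub>m d" "B \<in> carrier_mat d d" by auto
    have "B = (R * S) * B" using B RS by simp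
    also have "\<dots> = R * (S * B)" using R S B by (intro assoc_mult_mat) auto
    also have "\<dots> = R" unfolding B(1) by (rule right_mult_one_mat[OF R])
    finally show ?thesis using Some by simp
  qed
  then show ?thesis using ab by (simp add: S_def R_def r_def p_def q_def)
qed

lemma pair_gaussian_eq_density:
  assumes ij: "i < j" "j < d" and \<sigma>: "0 < \<sigma>" "\<sigma> < 1"
  shows "pair_gaussian d \<sigma> {i, j} = density (std_gaussians {..<d}) (\<lambda>x. ennreal (pair_lr \<sigma> (x i) (x j)))"
proof -
  have \<sigma>2: "1 - \<sigma>\<^sup>2 > 0" using \<sigma> by (simp add: power_less_one_iff abs_square_less_1)
  have sf: "sigma_finite_measure std_gaussian"
    using prob_space_normal_density[of 1 0] by (intro prob_space_imp_sigma_finite) simp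
  have m1: "(\<lambda>x. \<Prod>a<d. ennreal (std_normal_density (x a))) \<in> borel_measurable (PiM {..<d} (\<lambda>_. lborel))"
    by measurable
  have [measurable]: "(\<lambda>x. x i) \<in> borel_measurable (PiM {..<d} (\<lambda>_. lborel))"
    "(\<lambda>x. x j) \<in> borel_measurable (PiM {..<d} (\<lambda>_. lborel))"
    using ij measurable_component_singleton[of _ "{..<d}" "\<lambda>_. lborel :: real measure"] by auto
  have "(\<lambda>x. pair_lr \<sigma> (x i) (x j)) \<in> borel_measurable (PiM {..<d} (\<lambda>_. lborel))"
    unfolding pair_lr_def by measurable
  then have m2: "(\<lambda>x. ennreal (pair_lr \<sigma> (x i) (x j))) \<in> borel_measurable (PiM {..<d} (\<lambda>_. lborel))"
    by measurable
  have quad: "(\<Sum>a<d. \<Sum>b<d. x a * the (mat_inverse (pair_cov d \<sigma> {i, j})) $$ (a, b) * x b)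
      = (\<Sum>a<d. (x a)\<^sup>2) + \<sigma>\<^sup>2 / (1 - \<sigma>\<^sup>2) * ((x i)\<^sup>2 + (x j)\<^sup>2) - 2 * \<sigma> / (1 - \<sigma>\<^sup>2) * x i * x j" for x :: "nat \<Rightarrow> real"
  proof -
    have delta: "(\<Sum>a<d. \<Sum>b<d. of_bool (a = e \<and> b = e') * F a b) = F e e'" if "e < d" "e' < d" for e e' and F :: "nat \<Rightarrow> nat \<Rightarrow> real"
    proof -
      have "(\<Sum>a<d. \<Sum>b<d. of_bool (a = e \<and> b = e') * F a b) = (\<Sum>a<d. \<Sum>b<d. if b = e' then if a = e then F a b else 0 else 0)"
        by (intro sum.cong refl) auto
      then show ?thesis using that by (simp add: sum.delta)
    qed
    have diag: "(\<Sum>a<d. \<Sum>b<d. of_bool (a = b) * (x a * x b)) = (\<Sum>a<d. (x a)\<^sup>2)"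
    proof (intro sum.cong refl)
      fix a assume "a \<in> {..<d}"
      have "(\<Sum>b<d. of_bool (a = b) * (x a * x b)) = (\<Sum>b<d. if b = a then (x a)\<^sup>2 else 0)"
        by (intro sum.cong refl) (auto simp: power2_eq_square)
      then show "(\<Sum>b<d. of_bool (a = b) * (x a * x b)) = (x a)\<^sup>2" using \<open>a \<in> {..<d}\<close> by (simp add: sum.delta)
    qed
    have "(\<Sum>a<d. \<Sum>b<d. x a * the (mat_inverse (pair_cov d \<sigma> {i, j})) $$ (a, b) * x b)
        = (\<Sum>a<d. \<Sum>b<d. of_bool (a = b) * (x a * x b)
          + \<sigma>\<^sup>2 / (1 - \<sigma>\<^sup>2) * (of_bool (a = i \<and> b = i) * (x a * x b)) + \<sigma>\<^sup>2 / (1 - \<sigma>\<^sup>2) * (of_bool (a = j \<and> b = j) * (x a * x b))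
          - \<sigma> / (1 - \<sigma>\<^sup>2) * (of_bool (a = i \<and> b = j) * (x a * x b)) - \<sigma> / (1 - \<sigma>\<^sup>2) * (of_bool (a = j \<and> b = i) * (x a * x b)))"
      by (intro sum.cong refl) (simp add: mat_inverse_pair_cov[OF ij \<sigma>] algebra_simps)
    also have "\<dots> = (\<Sum>a<d. (x a)\<^sup>2) + \<sigma>\<^sup>2 / (1 - \<sigma>\<^sup>2) * (x i * x i) + \<sigma>\<^sup>2 / (1 - \<sigma>\<^sup>2) * (x j * x j)
        - \<sigma> / (1 - \<sigma>\<^sup>2) * (x i * x j) - \<sigma> / (1 - \<sigma>\<^sup>2) * (x j * x i)"
      using ij by (simp only: sum.distrib sum_subtractf sum_distrib_left[symmetric] delta[of _ _ "\<lambda>a b. x a * x b"] diag less_trans[OF ij])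
    also have "\<dots> = (\<Sum>a<d. (x a)\<^sup>2) + \<sigma>\<^sup>2 / (1 - \<sigma>\<^sup>2) * ((x i)\<^sup>2 + (x j)\<^sup>2) - 2 * \<sigma> / (1 - \<sigma>\<^sup>2) * x i * x j"
      by (simp add: power2_eq_square algebra_simps)
    finally show ?thesis .
  qed
  have expo: "- X / 2 + - (v * w - 2 * \<sigma> * y * z) / (2 * e) = - (X + v / e * w - 2 * \<sigma> / e * y * z) / 2"
    if "e \<noteq> 0" for X v w y z e :: real
    using that by (simp add: field_simps)
  have dens: "(\<Prod>a<d. ennreal (std_normal_density (x a))) * ennreal (pair_lr \<sigma> (x i) (x j))
      = ennreal (exp (- (\<Sum>a<d. \<Sum>b<d. x a * the (mat_inverse (pair_cov d \<sigma> {i, j})) $$ (a, b) * x b) / 2)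
             / sqrt ((2 * pi) ^ d * Determinant.det (pair_cov d \<sigma> {i, j})))" for x :: "nat \<Rightarrow> real"
  proof -
    have "(\<Prod>a<d. std_normal_density (x a)) * pair_lr \<sigma> (x i) (x j)
        = exp (- (\<Sum>a<d. (x a)\<^sup>2) / 2) / sqrt (2 * pi) ^ d * pair_lr \<sigma> (x i) (x j)"
      by (simp add: std_normal_density_def prod_dividef exp_sum[symmetric] sum_divide_distrib[symmetric] sum_negf)
    also have "\<dots> = exp (- (\<Sum>a<d. (x a)\<^sup>2) / 2 + - (\<sigma>\<^sup>2 * ((x i)\<^sup>2 + (x j)\<^sup>2) - 2 * \<sigma> * x i * x j) / (2 * (1 - \<sigma>\<^sup>2)))
        / sqrt ((2 * pi) ^ d * (1 - \<sigma>\<^sup>2))"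
      by (simp only: pair_lr_def exp_add real_sqrt_mult real_sqrt_power times_divide_times_eq)
    also have "- (\<Sum>a<d. (x a)\<^sup>2) / 2 + - (\<sigma>\<^sup>2 * ((x i)\<^sup>2 + (x j)\<^sup>2) - 2 * \<sigma> * x i * x j) / (2 * (1 - \<sigma>\<^sup>2))
        = - ((\<Sum>a<d. (x a)\<^sup>2) + \<sigma>\<^sup>2 / (1 - \<sigma>\<^sup>2) * ((x i)\<^sup>2 + (x j)\<^sup>2) - 2 * \<sigma> / (1 - \<sigma>\<^sup>2) * x i * x j) / 2"
      by (rule expo) (use \<sigma>2 in simp)
    finally have eq: "(\<Prod>a<d. std_normal_density (x a)) * pair_lr \<sigma> (x i) (x j)
        = exp (- ((\<Sum>a<d. (x a)\<^sup>2) + \<sigma>\<^sup>2 / (1 - \<sigma>\<^sup>2) * ((x i)\<^sup>2 + (x j)\<^sup>2) - 2 * \<sigma> / (1 - \<sigma>\<^sup>2) * x i * x j) / 2)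
          / sqrt ((2 * pi) ^ d * (1 - \<sigma>\<^sup>2))" .
    show ?thesis
      unfolding quad det_pair_cov[OF ij] eq[symmetric]
      by (simp add: prod_ennreal ennreal_mult prod_nonneg pair_lr_nonneg[OF \<sigma>])
  qed
  have "density (std_gaussians {..<d}) (\<lambda>x. ennreal (pair_lr \<sigma> (x i) (x j)))
      = density (density (PiM {..<d} (\<lambda>_. lborel)) (\<lambda>x. \<Prod>a<d. ennreal (std_normal_density (x a)))) (\<lambda>x. ennreal (pair_lr \<sigma> (x i) (x j)))"
    using sf by (subst PiM_density) (auto intro: sigma_finite_lborel)
  also have "\<dots> = density (PiM {..<d} (\<lambda>_. lborel))
      (\<lambda>x. (\<Prod>a<d. ennreal (std_normal_density (x a))) * ennreal (pair_lr \<sigma> (x i) (x j)))"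
    by (rule density_density_eq[OF m1 m2])
  finally show ?thesis unfolding pair_gaussian_def centered_gaussian_def dens ..
qed

section \<open>Moments of the likelihood ratio and of the features\<close>

lemma prob_space_std_gaussian: "prob_space std_gaussian"
  using prob_space_normal_density[of 1 0] by simp

lemma prob_space_std_gaussians: "prob_space (std_gaussians I)"
  by (intro prob_space_PiM prob_space_std_gaussian)

lemma nn_integral_normal_density:
  "s > 0 \<Longrightarrow> (\<integral>\<^sup>+x. ennreal (normal_density \<mu> s x) \<partial>lborel) = 1"
  by (subst nn_integral_eq_integral) auto

text \<open>For use after completing the square: the integrand is then a multiple of another normal
  density, and the multiple is the integral.\<close>

lemma nn_integral_std_gaussian:
  assumes f: "f \<in> borel_measurable borel" "\<And>x. f x \<ge> 0" and s: "s > 0" and c: "c \<ge> 0"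
    and eq: "\<And>x. std_normal_density x * f x = c * normal_density \<mu> s x"
  shows "(\<integral>\<^sup>+x. ennreal (f x) \<partial>std_gaussian) = ennreal c"
proof -
  have "(\<integral>\<^sup>+x. ennreal (f x) \<partial>std_gaussian) = (\<integral>\<^sup>+x. ennreal (std_normal_density x) * ennreal (f x) \<partial>lborel)"
    using f by (intro nn_integral_density) auto
  also have "\<dots> = (\<integral>\<^sup>+x. ennreal c * ennreal (normal_density \<mu> s x) \<partial>lborel)"
  proof (intro nn_integral_cong)
    fix x
    show "ennreal (std_normal_density x) * ennreal (f x) = ennreal c * ennreal (normal_density \<mu> s x)"
      using f(2) c eq[of x] by (simp add: ennreal_mult[symmetric])
  qed
  also have "\<dots> = ennreal c" using s by (simp add: nn_integral_cmult nn_integral_normal_density)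
  finally show ?thesis .
qed

lemma std_gaussian_mgf: "(\<integral>\<^sup>+x. ennreal (exp (c * x)) \<partial>std_gaussian) = ennreal (exp (c\<^sup>2 / 2))"
proof (rule nn_integral_std_gaussian[where \<mu> = c and s = 1])
  fix x :: real
  have "- x\<^sup>2 / 2 + c * x = c\<^sup>2 / 2 + - (x - c)\<^sup>2 / 2" by (simp add: power2_eq_square field_simps)
  then have "exp (- x\<^sup>2 / 2) * exp (c * x) = exp (c\<^sup>2 / 2) * exp (- (x - c)\<^sup>2 / 2)"
    unfolding exp_add[symmetric] by (rule arg_cong)
  then show "std_normal_density x * exp (c * x) = exp (c\<^sup>2 / 2) * normal_density c 1 x"
    by (simp add: std_normal_density_def normal_density_def)
qed auto

lemma std_gaussian_square_mgf:
  assumes "\<tau> < 1"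
  shows "(\<integral>\<^sup>+x. ennreal (exp (\<tau> * x\<^sup>2 / 2)) \<partial>std_gaussian) = ennreal (1 / sqrt (1 - \<tau>))"
proof (rule nn_integral_std_gaussian[where \<mu> = 0 and s = "1 / sqrt (1 - \<tau>)"])
  fix x :: real
  have s: "(1 / sqrt (1 - \<tau>))\<^sup>2 = 1 / (1 - \<tau>)" using assms by (simp add: power_divide)
  have "- x\<^sup>2 / 2 + \<tau> * x\<^sup>2 / 2 = - (x - 0)\<^sup>2 / (2 * (1 / (1 - \<tau>)))" by (simp add: algebra_simps diff_divide_distrib)
  then have "exp (- x\<^sup>2 / 2) * exp (\<tau> * x\<^sup>2 / 2) = exp (- (x - 0)\<^sup>2 / (2 * (1 / (1 - \<tau>))))"
    unfolding exp_add[symmetric] by (rule arg_cong)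
  then show "std_normal_density x * exp (\<tau> * x\<^sup>2 / 2) = 1 / sqrt (1 - \<tau>) * normal_density 0 (1 / sqrt (1 - \<tau>)) x"
    using assms unfolding normal_density_def s std_normal_density_def
    by (simp add: real_sqrt_divide real_sqrt_mult field_simps)
qed (use assms in auto)

section \<open>Exponential moments of linear and bilinear forms\<close>

lemma linear_form_mgf:
  assumes I: "finite I"
  shows "(\<integral>\<^sup>+x. ennreal (exp (\<Sum>i\<in>I. c i * x i)) \<partial>std_gaussians I) = ennreal (exp ((\<Sum>i\<in>I. (c i)\<^sup>2) / 2))"
proof -
  interpret prob_space std_gaussian by (rule prob_space_std_gaussian)
  interpret product_sigma_finite "\<lambda>_::nat. std_gaussian" by (rule product_sigma_finite.intro) unfold_locales
  have "(\<integral>\<^sup>+x. ennreal (exp (\<Sum>i\<in>I. c i * x i)) \<partial>std_gaussians I)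
      = (\<integral>\<^sup>+x. (\<Prod>i\<in>I. ennreal (exp (c i * x i))) \<partial>std_gaussians I)"
    using I by (simp add: exp_sum prod_ennreal)
  also have "\<dots> = (\<Prod>i\<in>I. \<integral>\<^sup>+x. ennreal (exp (c i * x)) \<partial>std_gaussian)"
    using I by (intro product_nn_integral_prod) auto
  also have "\<dots> = ennreal (exp ((\<Sum>i\<in>I. (c i)\<^sup>2) / 2))"
    using I by (simp add: std_gaussian_mgf prod_ennreal exp_sum sum_divide_distrib)
  finally show ?thesis .
qed

text \<open>Square root of 1 / (1 - \<tau>) \<le> 1 + 2 \<tau> \<le> exp (2 \<tau>). The range
  \<tau> \<le> 1/2 is the origin of the radius in \<open>features_mgf\<close>.\<close>

lemma inverse_sqrt_le_exp:
  fixes \<tau> :: real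
  assumes "0 \<le> \<tau>" "\<tau> \<le> 1 / 2"
  shows "1 / sqrt (1 - \<tau>) \<le> exp \<tau>"
proof -
  have "0 \<le> \<tau> * (1 - 2 * \<tau>)" using assms by simp
  then have "1 \<le> (1 + 2 * \<tau>) * (1 - \<tau>)" by (simp add: algebra_simps)
  then have "1 / (1 - \<tau>) \<le> 1 + 2 * \<tau>" using assms by (simp add: field_simps)
  also have "\<dots> \<le> exp (2 * \<tau>)" by (rule exp_ge_add_one_self)
  also have "\<dots> = (exp \<tau>)\<^sup>2" by (simp add: exp_double)
  finally have "sqrt (1 / (1 - \<tau>)) \<le> sqrt ((exp \<tau>)\<^sup>2)" by (rule real_sqrt_le_mono)
  then show ?thesis by (simp add: real_sqrt_divide)
qed

text \<open>Linearise the square with an auxiliary standard Gaussian variable.\<close>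

lemma linear_form_square_mgf:
  assumes I: "finite I" and e: "(\<Sum>i\<in>I. (e i)\<^sup>2) = 1" and \<tau>: "0 \<le> \<tau>" "\<tau> \<le> 1 / 2"
  shows "(\<integral>\<^sup>+x. ennreal (exp (\<tau> * (\<Sum>i\<in>I. e i * x i)\<^sup>2 / 2)) \<partial>std_gaussians I) \<le> ennreal (exp \<tau>)"
proof -
  interpret prob_space std_gaussian by (rule prob_space_std_gaussian)
  interpret P: prob_space "std_gaussians I" by (rule prob_space_std_gaussians)
  interpret pair_sigma_finite "std_gaussians I" std_gaussian
    by (intro pair_sigma_finite.intro) unfold_locales
  have [measurable]: "(\<lambda>x. x i) \<in> borel_measurable (std_gaussians I)" if "i \<in> I" for i
    using measurable_component_singleton[OF that, of "\<lambda>_. std_gaussian"] by simp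
  have lin[measurable]: "(\<lambda>x. \<Sum>i\<in>I. e i * x i) \<in> borel_measurable (std_gaussians I)"
    by (intro borel_measurable_sum) auto
  have "(\<integral>\<^sup>+x. ennreal (exp (\<tau> * (\<Sum>i\<in>I. e i * x i)\<^sup>2 / 2)) \<partial>std_gaussians I)
      = (\<integral>\<^sup>+x. (\<integral>\<^sup>+y. ennreal (exp (sqrt \<tau> * (\<Sum>i\<in>I. e i * x i) * y)) \<partial>std_gaussian) \<partial>std_gaussians I)"
    using \<tau> by (simp add: std_gaussian_mgf power_mult_distrib)
  also have "\<dots> = (\<integral>\<^sup>+y. (\<integral>\<^sup>+x. ennreal (exp (sqrt \<tau> * (\<Sum>i\<in>I. e i * x i) * y)) \<partial>std_gaussians I) \<partial>std_gaussian)"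
    by (intro Fubini'[symmetric]) measurable
  also have "\<dots> = (\<integral>\<^sup>+y. ennreal (exp (\<tau> * y\<^sup>2 / 2)) \<partial>std_gaussian)"
  proof (intro nn_integral_cong)
    fix y
    have "(\<integral>\<^sup>+x. ennreal (exp (sqrt \<tau> * (\<Sum>i\<in>I. e i * x i) * y)) \<partial>std_gaussians I)
        = (\<integral>\<^sup>+x. ennreal (exp (\<Sum>i\<in>I. (sqrt \<tau> * y * e i) * x i)) \<partial>std_gaussians I)"
      by (simp add: sum_distrib_left sum_distrib_right mult_ac)
    also have "\<dots> = ennreal (exp ((\<Sum>i\<in>I. (sqrt \<tau> * y * e i)\<^sup>2) / 2))" by (rule linear_form_mgf[OF I])
    also have "(\<Sum>i\<in>I. (sqrt \<tau> * y * e i)\<^sup>2) = \<tau> * y\<^sup>2 * (\<Sum>i\<in>I. (e i)\<^sup>2)"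
      using \<tau> by (simp add: power_mult_distrib sum_distrib_left)
    finally show "(\<integral>\<^sup>+x. ennreal (exp (sqrt \<tau> * (\<Sum>i\<in>I. e i * x i) * y)) \<partial>std_gaussians I) = ennreal (exp (\<tau> * y\<^sup>2 / 2))"
      by (simp add: e)
  qed
  also have "\<dots> = ennreal (1 / sqrt (1 - \<tau>))" using \<tau> by (intro std_gaussian_square_mgf) auto
  also have "\<dots> \<le> ennreal (exp \<tau>)" using \<tau> by (intro ennreal_leI inverse_sqrt_le_exp)
  finally show ?thesis .
qed

text \<open>Integrating out the second group of variables leaves the exponential of a sum of squares of
  linear forms, which convexity of the exponential reduces to a single linear form.\<close>

lemma bilinear_form_mgf:
  fixes b :: "nat \<Rightarrow> nat \<Rightarrow> real"
  assumes IJ: "finite I" "finite J" "I \<inter> J = {}"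
    and small: "(\<Sum>j\<in>J. \<Sum>i\<in>I. (b i j)\<^sup>2) \<le> 1 / 2"
  shows "(\<integral>\<^sup>+x. ennreal (exp (\<Sum>j\<in>J. \<Sum>i\<in>I. b i j * x i * x j)) \<partial>std_gaussians (I \<union> J))
    \<le> ennreal (exp (\<Sum>j\<in>J. \<Sum>i\<in>I. (b i j)\<^sup>2))"
proof -
  interpret prob_space std_gaussian by (rule prob_space_std_gaussian)
  interpret P: prob_space "std_gaussians I" by (rule prob_space_std_gaussians)
  interpret product_sigma_finite "\<lambda>_::nat. std_gaussian" by (rule product_sigma_finite.intro) unfold_locales
  \<comment> \<open>Here \<open>n j\<close> is the squared length of the coefficient vector of the
    linear form \<open>c j\<close>, and \<tau> is the squared Frobenius norm of b.\<close>
  define n where "n j = (\<Sum>i\<in>I. (b i j)\<^sup>2)" for j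
  define \<tau> where "\<tau> = (\<Sum>j\<in>J. n j)"
  define c where "c j x = (\<Sum>i\<in>I. b i j * x i)" for j and x :: "nat \<Rightarrow> real"
  have n0: "n j \<ge> 0" for j by (simp add: n_def sum_nonneg)
  have \<tau>: "0 \<le> \<tau>" "\<tau> \<le> 1 / 2" using small n0 by (auto simp: \<tau>_def n_def sum_nonneg)
  have null: "c j x = 0" if "n j = 0" for j x
    using that IJ(1) by (simp add: n_def c_def sum_nonneg_eq_0_iff)
  have comp: "(\<lambda>x. x i) \<in> borel_measurable (std_gaussians L)" if "i \<in> L" for i L
    using measurable_component_singleton[OF that, of "\<lambda>_. std_gaussian"] by simp
  have c_meas[measurable]: "c j \<in> borel_measurable (std_gaussians I)" for j
    unfolding c_def by (intro borel_measurable_sum borel_measurable_times comp) auto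
  have "(\<integral>\<^sup>+x. ennreal (exp (\<Sum>j\<in>J. \<Sum>i\<in>I. b i j * x i * x j)) \<partial>std_gaussians (I \<union> J))
      = (\<integral>\<^sup>+x. (\<integral>\<^sup>+y. ennreal (exp (\<Sum>j\<in>J. \<Sum>i\<in>I. b i j * merge I J (x, y) i * merge I J (x, y) j)) \<partial>std_gaussians J) \<partial>std_gaussians I)"
  proof (rule product_nn_integral_fold[OF IJ(3,1,2)])
    have "(\<lambda>x. \<Sum>j\<in>J. \<Sum>i\<in>I. b i j * x i * x j) \<in> borel_measurable (std_gaussians (I \<union> J))"
      by (intro borel_measurable_sum borel_measurable_times comp) auto
    then show "(\<lambda>x. ennreal (exp (\<Sum>j\<in>J. \<Sum>i\<in>I. b i j * x i * x j))) \<in> borel_measurable (std_gaussians (I \<union> J))"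
      by measurable
  qed
  also have "\<dots> = (\<integral>\<^sup>+x. (\<integral>\<^sup>+y. ennreal (exp (\<Sum>j\<in>J. c j x * y j)) \<partial>std_gaussians J) \<partial>std_gaussians I)"
  proof (intro nn_integral_cong arg_cong[of _ _ ennreal] arg_cong[of _ _ exp] sum.cong refl)
    fix x y :: "nat \<Rightarrow> real" and j assume j: "j \<in> J"
    then have "j \<notin> I" using IJ by auto
    with j show "(\<Sum>i\<in>I. b i j * merge I J (x, y) i * merge I J (x, y) j) = c j x * y j"
      by (simp add: c_def merge_def sum_distrib_right)
  qed
  also have "\<dots> = (\<integral>\<^sup>+x. ennreal (exp ((\<Sum>j\<in>J. (c j x)\<^sup>2) / 2)) \<partial>std_gaussians I)"
    by (intro nn_integral_cong linear_form_mgf IJ)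
  also have "\<dots> \<le> ennreal (exp \<tau>)"
  proof (cases "\<tau> = 0")
    case True
    then have "n j = 0" if "j \<in> J" for j
      using that n0 IJ(2) by (simp add: \<tau>_def sum_nonneg_eq_0_iff)
    then show ?thesis using True by (simp add: null P.emeasure_space_1)
  next
    case False
    then have \<tau>_pos: "\<tau> > 0" using \<tau> by simp
    \<comment> \<open>With weights \<open>n j / \<tau>\<close>, which sum to 1, the mean of the
      \<open>z j\<close> is half the sum of the squares of the \<open>c j\<close>. For n j > 0 each
      \<open>z j\<close> is \<tau> / 2 times the square of a linear form of unit length, so all of
      them obey the same bound exp \<tau>.\<close>
    define z where "z j x = \<tau> * ((c j x)\<^sup>2 / n j) / 2" for j x
    have "exp ((\<Sum>j\<in>J. (c j x)\<^sup>2) / 2) \<le> (\<Sum>j\<in>J. n j / \<tau> * exp (z j x))" for x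
    proof -
      have "(\<Sum>j\<in>J. n j / \<tau> * z j x) = (\<Sum>j\<in>J. (c j x)\<^sup>2 / 2)"
        using \<tau>_pos null by (intro sum.cong refl) (auto simp: z_def)
      then have "exp ((\<Sum>j\<in>J. (c j x)\<^sup>2) / 2) = exp (\<Sum>j\<in>J. (n j / \<tau>) *\<^sub>R z j x)"
        by (simp add: sum_divide_distrib)
      also have "\<dots> \<le> (\<Sum>j\<in>J. n j / \<tau> * exp (z j x))"
      proof (rule convex_on_sum[OF IJ(2)])
        show "J \<noteq> {}" using \<tau>_pos by (auto simp: \<tau>_def)
        show "convex_on UNIV (exp :: real \<Rightarrow> real)" by (rule exp_convex)
        show "(\<Sum>j\<in>J. n j / \<tau>) = 1" using \<tau>_pos by (simp add: \<tau>_def sum_divide_distrib[symmetric])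
      qed (use n0 \<tau>_pos in auto)
      finally show ?thesis .
    qed
    then have "ennreal (exp ((\<Sum>j\<in>J. (c j x)\<^sup>2) / 2)) \<le> (\<Sum>j\<in>J. ennreal (n j / \<tau>) * ennreal (exp (z j x)))" for x
      using ennreal_leI n0 \<tau>_pos by (simp add: ennreal_mult[symmetric] sum_ennreal)
    then have "(\<integral>\<^sup>+x. ennreal (exp ((\<Sum>j\<in>J. (c j x)\<^sup>2) / 2)) \<partial>std_gaussians I)
        \<le> (\<integral>\<^sup>+x. (\<Sum>j\<in>J. ennreal (n j / \<tau>) * ennreal (exp (z j x))) \<partial>std_gaussians I)"
      by (intro nn_integral_mono)
    also have "\<dots> = (\<Sum>j\<in>J. ennreal (n j / \<tau>) * (\<integral>\<^sup>+x. ennreal (exp (z j x)) \<partial>std_gaussians I))"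
      unfolding z_def by (subst nn_integral_sum, measurable, intro sum.cong refl nn_integral_cmult, measurable)
    also have "\<dots> \<le> (\<Sum>j\<in>J. ennreal (n j / \<tau>) * ennreal (exp \<tau>))"
    proof (intro sum_mono mult_left_mono)
      fix j
      show "(\<integral>\<^sup>+x. ennreal (exp (z j x)) \<partial>std_gaussians I) \<le> ennreal (exp \<tau>)"
      proof (cases "n j = 0")
        case True
        then show ?thesis using \<tau> by (simp add: z_def P.emeasure_space_1)
      next
        case False
        then have nj: "n j > 0" using n0[of j] by simp
        define e where "e i = b i j / sqrt (n j)" for i
        have e: "(\<Sum>i\<in>I. (e i)\<^sup>2) = 1"
          using nj by (simp add: e_def power_divide sum_divide_distrib[symmetric] n_def[symmetric])
        have "(\<Sum>i\<in>I. e i * x i)\<^sup>2 = (c j x)\<^sup>2 / n j" for x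
        proof -
          have "(\<Sum>i\<in>I. e i * x i) = c j x / sqrt (n j)"
            by (simp add: e_def c_def sum_divide_distrib)
          then show ?thesis using nj by (simp add: power_divide)
        qed
        then show ?thesis
          using linear_form_square_mgf[OF IJ(1) e \<tau>] by (simp add: z_def)
      qed
    qed simp
    also have "\<dots> = ennreal (\<Sum>j\<in>J. n j / \<tau> * exp \<tau>)"
      using n0 \<tau>_pos by (simp add: ennreal_mult[symmetric] sum_ennreal)
    also have "(\<Sum>j\<in>J. n j / \<tau> * exp \<tau>) = exp \<tau>"
      using \<tau>_pos by (simp add: sum_distrib_right[symmetric] sum_divide_distrib[symmetric] \<tau>_def[symmetric])
    finally show ?thesis .
  qed
  finally show ?thesis by (simp add: \<tau>_def n_def)
qed

section \<open>Moments of functions of two coordinates\<close>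

lemma distr_coordinate_pair:
  assumes ij: "i \<in> I" "j \<in> I" "i \<noteq> j" and I: "finite I"
  shows "distr (std_gaussians I) (std_gaussian \<Otimes>\<^sub>M std_gaussian) (\<lambda>x. (x i, x j)) = std_gaussian \<Otimes>\<^sub>M std_gaussian"
proof (rule pair_measure_eqI[symmetric])
  interpret S: prob_space std_gaussian by (rule prob_space_std_gaussian)
  interpret product_sigma_finite "\<lambda>_::nat. std_gaussian" by (rule product_sigma_finite.intro) unfold_locales
  show "sigma_finite_measure std_gaussian" "sigma_finite_measure std_gaussian" by unfold_locales
  have pair: "(\<lambda>x. (x i, x j)) \<in> std_gaussians I \<rightarrow>\<^sub>M std_gaussian \<Otimes>\<^sub>M std_gaussian"
    by (intro measurable_Pair measurable_component_singleton ij)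
  fix A B assume AB: "A \<in> sets std_gaussian" "B \<in> sets std_gaussian"
  define C where "C a = (if a = i then A else if a = j then B else UNIV)" for a
  have "emeasure (distr (std_gaussians I) (std_gaussian \<Otimes>\<^sub>M std_gaussian) (\<lambda>x. (x i, x j))) (A \<times> B)
      = emeasure (std_gaussians I) ((\<lambda>x. (x i, x j)) -` (A \<times> B) \<inter> space (std_gaussians I))"
    by (rule emeasure_distr[OF pair pair_measureI[OF AB]])
  also have "(\<lambda>x. (x i, x j)) -` (A \<times> B) \<inter> space (std_gaussians I) = Pi\<^sub>E I C"
    using ij by (auto simp: C_def space_PiM PiE_iff split: if_splits)
  also have "emeasure (std_gaussians I) (Pi\<^sub>E I C) = (\<Prod>a\<in>I. emeasure std_gaussian (C a))"
    using I AB by (intro emeasure_PiM) (auto simp: C_def)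
  also have "\<dots> = (\<Prod>a\<in>I. (if a = i then emeasure std_gaussian A else 1) * (if a = j then emeasure std_gaussian B else 1))"
    using ij S.emeasure_space_1 by (intro prod.cong refl) (auto simp: C_def)
  also have "\<dots> = emeasure std_gaussian A * emeasure std_gaussian B"
    unfolding prod.distrib using I ij by (simp add: prod.delta)
  finally show "emeasure std_gaussian A * emeasure std_gaussian B
      = emeasure (distr (std_gaussians I) (std_gaussian \<Otimes>\<^sub>M std_gaussian) (\<lambda>x. (x i, x j))) (A \<times> B)" ..
qed simp

context
  fixes I :: "nat set" and i j :: nat
  assumes ij: "i \<in> I" "j \<in> I" "i \<noteq> j" and I: "finite I"
begin

interpretation S: prob_space std_gaussian by (rule prob_space_std_gaussian)
interpretation P: prob_space "std_gaussians I" by (rule prob_space_std_gaussians)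
interpretation SS: pair_sigma_finite std_gaussian std_gaussian ..

lemma measurable_coordinate_pair: "(\<lambda>x. (x i, x j)) \<in> std_gaussians I \<rightarrow>\<^sub>M std_gaussian \<Otimes>\<^sub>M std_gaussian"
  using ij by (intro measurable_Pair measurable_component_singleton)

lemma nn_integral_coordinate_pair:
  fixes f :: "real \<Rightarrow> real \<Rightarrow> ennreal"
  assumes f: "case_prod f \<in> borel_measurable (borel \<Otimes>\<^sub>M borel)"
  shows "(\<integral>\<^sup>+x. f (x i) (x j) \<partial>std_gaussians I) = (\<integral>\<^sup>+x. (\<integral>\<^sup>+y. f x y \<partial>std_gaussian) \<partial>std_gaussian)"
proof -
  have f': "case_prod f \<in> borel_measurable (std_gaussian \<Otimes>\<^sub>M std_gaussian)"
    using f by (simp cong: measurable_cong_sets sets_pair_measure_cong)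
  have "(\<integral>\<^sup>+x. f (x i) (x j) \<partial>std_gaussians I) = (\<integral>\<^sup>+p. case_prod f p \<partial>distr (std_gaussians I) (std_gaussian \<Otimes>\<^sub>M std_gaussian) (\<lambda>x. (x i, x j)))"
    using f' by (subst nn_integral_distr[OF measurable_coordinate_pair]) auto
  also have "\<dots> = (\<integral>\<^sup>+x. (\<integral>\<^sup>+y. f x y \<partial>std_gaussian) \<partial>std_gaussian)"
    unfolding distr_coordinate_pair[OF ij I] using S.nn_integral_fst[OF f'] by simp
  finally show ?thesis .
qed

lemma integral_coordinate_pair:
  fixes f :: "real \<Rightarrow> real \<Rightarrow> real"
  assumes f: "case_prod f \<in> borel_measurable (borel \<Otimes>\<^sub>M borel)"
    and int: "integrable (std_gaussians I) (\<lambda>x. f (x i) (x j))"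
  shows "(\<integral>x. f (x i) (x j) \<partial>std_gaussians I) = (\<integral>x. (\<integral>y. f x y \<partial>std_gaussian) \<partial>std_gaussian)"
proof -
  have f': "case_prod f \<in> borel_measurable (std_gaussian \<Otimes>\<^sub>M std_gaussian)"
    using f by (simp cong: measurable_cong_sets sets_pair_measure_cong)
  have "integrable (distr (std_gaussians I) (std_gaussian \<Otimes>\<^sub>M std_gaussian) (\<lambda>x. (x i, x j))) (case_prod f)"
    using int f' by (subst integrable_distr_eq[OF measurable_coordinate_pair]) auto
  then have int': "integrable (std_gaussian \<Otimes>\<^sub>M std_gaussian) (case_prod f)"
    unfolding distr_coordinate_pair[OF ij I] .
  have "(\<integral>x. f (x i) (x j) \<partial>std_gaussians I) = (\<integral>p. case_prod f p \<partial>distr (std_gaussians I) (std_gaussian \<Otimes>\<^sub>M std_gaussian) (\<lambda>x. (x i, x j)))"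
    using f' by (subst integral_distr[OF measurable_coordinate_pair]) auto
  also have "\<dots> = (\<integral>x. (\<integral>y. f x y \<partial>std_gaussian) \<partial>std_gaussian)"
    unfolding distr_coordinate_pair[OF ij I] using SS.integral_fst'[OF int'] by simp
  finally show ?thesis .
qed

lemma coordinate_measurable: "(\<lambda>x. x i) \<in> borel_measurable (std_gaussians I)" "(\<lambda>x. x j) \<in> borel_measurable (std_gaussians I)"
  using ij measurable_component_singleton[of _ I "\<lambda>_. std_gaussian"] by auto

lemma integral_std_gaussian:
  fixes f :: "real \<Rightarrow> real"
  assumes "f \<in> borel_measurable borel"
  shows "(\<integral>x. f x \<partial>std_gaussian) = (\<integral>x. std_normal_density x * f x \<partial>lborel)"
  using assms by (subst integral_density) auto

lemma std_gaussian_moments: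
  "(\<integral>x. x \<partial>std_gaussian) = 0" "integrable std_gaussian (\<lambda>x. x\<^sup>2)" "(\<integral>x. x\<^sup>2 \<partial>std_gaussian) = 1"
proof -
  show "(\<integral>x. x \<partial>std_gaussian) = 0"
    by (subst integral_std_gaussian) (use integral_std_normal_moment_odd[of 0] in auto)
  show "integrable std_gaussian (\<lambda>x. x\<^sup>2)"
    using integrable_std_normal_moment[of 2] by (subst integrable_density) auto
  show "(\<integral>x. x\<^sup>2 \<partial>std_gaussian) = 1"
    by (subst integral_std_gaussian) (use integral_std_normal_moment_even[of 1] in \<open>auto simp: fact_numeral\<close>)
qed

lemma feature_pair_moments:
  "integrable (std_gaussians I) (\<lambda>x. (x i * x j)\<^sup>2)" "(\<integral>x. (x i * x j)\<^sup>2 \<partial>std_gaussians I) = 1"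
  "(\<integral>x. x i * x j \<partial>std_gaussians I) = 0"
proof -
  note coordinate_measurable[measurable]
  have sq: "(\<integral>\<^sup>+y. ennreal (y\<^sup>2) \<partial>std_gaussian) = 1"
    using std_gaussian_moments by (subst nn_integral_eq_integral) auto
  have "(\<integral>\<^sup>+x. ennreal ((x i * x j)\<^sup>2) \<partial>std_gaussians I) = (\<integral>\<^sup>+x. (\<integral>\<^sup>+y. ennreal ((x * y)\<^sup>2) \<partial>std_gaussian) \<partial>std_gaussian)"
    by (rule nn_integral_coordinate_pair) measurable
  also have "\<dots> = (\<integral>\<^sup>+x. ennreal (x\<^sup>2) * (\<integral>\<^sup>+y. ennreal (y\<^sup>2) \<partial>std_gaussian) \<partial>std_gaussian)"
    by (simp add: power_mult_distrib ennreal_mult nn_integral_cmult)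
  also have "\<dots> = 1" by (simp add: sq)
  finally have nn: "(\<integral>\<^sup>+x. ennreal ((x i * x j)\<^sup>2) \<partial>std_gaussians I) = 1" .
  show int: "integrable (std_gaussians I) (\<lambda>x. (x i * x j)\<^sup>2)"
    by (rule integrableI_nonneg) (use nn in auto)
  show "(\<integral>x. (x i * x j)\<^sup>2 \<partial>std_gaussians I) = 1"
    using nn by (subst integral_eq_nn_integral) auto
  have "integrable (std_gaussians I) (\<lambda>x. x i * x j)"
    by (rule P.integrable_of_square[OF _ int]) measurable
  then have "(\<integral>x. x i * x j \<partial>std_gaussians I) = (\<integral>x. (\<integral>y. x * y \<partial>std_gaussian) \<partial>std_gaussian)"
    by (intro integral_coordinate_pair) auto
  then show "(\<integral>x. x i * x j \<partial>std_gaussians I) = 0" by (simp add: std_gaussian_moments)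
qed

context
  fixes \<sigma> :: real
  assumes \<sigma>: "0 < \<sigma>" "\<sigma> < 1"
begin

lemma one_minus_square_pos: "1 - \<sigma>\<^sup>2 > 0"
  using \<sigma> by (simp add: power_less_one_iff abs_square_less_1)

lemma pair_lr_measurable[measurable]: "case_prod (pair_lr \<sigma>) \<in> borel_measurable (borel \<Otimes>\<^sub>M borel)"
  unfolding pair_lr_def by measurable

lemma pair_lr_coordinates_measurable: "(\<lambda>x. pair_lr \<sigma> (x i) (x j)) \<in> borel_measurable (std_gaussians I)"
  unfolding pair_lr_def using coordinate_measurable by measurable

text \<open>The conditional density of the second coordinate of the correlated pair when the first
  one is x.\<close>

lemma std_normal_density_pair_lr:
  "std_normal_density y * pair_lr \<sigma> x y = normal_density (\<sigma> * x) (sqrt (1 - \<sigma>\<^sup>2)) y"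
proof -
  have expo: "- y\<^sup>2 / 2 + - (\<sigma>\<^sup>2 * (x\<^sup>2 + y\<^sup>2) - 2 * \<sigma> * x * y) / (2 * (1 - \<sigma>\<^sup>2)) = - (y - \<sigma> * x)\<^sup>2 / (2 * (1 - \<sigma>\<^sup>2))"
  proof -
    have aux: "- y\<^sup>2 / 2 + - W / (2 * e) = (- y\<^sup>2 * e - W) / (2 * e)" if "e \<noteq> 0" for W e :: real
      using that by (simp add: field_simps)
    have "- y\<^sup>2 / 2 + - (\<sigma>\<^sup>2 * (x\<^sup>2 + y\<^sup>2) - 2 * \<sigma> * x * y) / (2 * (1 - \<sigma>\<^sup>2))
        = (- y\<^sup>2 * (1 - \<sigma>\<^sup>2) - (\<sigma>\<^sup>2 * (x\<^sup>2 + y\<^sup>2) - 2 * \<sigma> * x * y)) / (2 * (1 - \<sigma>\<^sup>2))"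
      by (rule aux) (use one_minus_square_pos in simp)
    also have "- y\<^sup>2 * (1 - \<sigma>\<^sup>2) - (\<sigma>\<^sup>2 * (x\<^sup>2 + y\<^sup>2) - 2 * \<sigma> * x * y) = - (y - \<sigma> * x)\<^sup>2"
      by (simp add: power2_eq_square algebra_simps)
    finally show ?thesis .
  qed
  have "std_normal_density y * pair_lr \<sigma> x y = exp (- y\<^sup>2 / 2 + - (\<sigma>\<^sup>2 * (x\<^sup>2 + y\<^sup>2) - 2 * \<sigma> * x * y) / (2 * (1 - \<sigma>\<^sup>2)))
      / (sqrt (2 * pi) * sqrt (1 - \<sigma>\<^sup>2))"
    by (simp only: pair_lr_def std_normal_density_def exp_add) simp
  then show ?thesis
    unfolding expo normal_density_def using one_minus_square_pos by (simp add: real_sqrt_mult)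
qed

text \<open>Completing the square in y leaves a factor whose dependence on x is the exponential of a
  square, which \<open>std_gaussian_square_mgf\<close> integrates.\<close>

lemma std_normal_density_pair_lr_square:
  "std_normal_density y * (pair_lr \<sigma> x y)\<^sup>2
    = (sqrt ((1 - \<sigma>\<^sup>2) / (1 + \<sigma>\<^sup>2)) / (1 - \<sigma>\<^sup>2) * exp ((2 * \<sigma>\<^sup>2 / (1 + \<sigma>\<^sup>2)) * x\<^sup>2 / 2))
      * normal_density (2 * \<sigma> * x / (1 + \<sigma>\<^sup>2)) (sqrt ((1 - \<sigma>\<^sup>2) / (1 + \<sigma>\<^sup>2))) y"
proof -
  define v where "v = (1 - \<sigma>\<^sup>2) / (1 + \<sigma>\<^sup>2)"
  have pos: "1 + \<sigma>\<^sup>2 > 0" by (simp add: add_pos_nonneg)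
  have v: "v > 0" using one_minus_square_pos pos by (simp add: v_def)
  have expo: "- y\<^sup>2 / 2 + 2 * (- (\<sigma>\<^sup>2 * (x\<^sup>2 + y\<^sup>2) - 2 * \<sigma> * x * y) / (2 * (1 - \<sigma>\<^sup>2)))
      = (2 * \<sigma>\<^sup>2 / (1 + \<sigma>\<^sup>2)) * x\<^sup>2 / 2 + - (y - 2 * \<sigma> * x / (1 + \<sigma>\<^sup>2))\<^sup>2 / (2 * v)"
  proof -
    \<comment> \<open>Expressing both \<sigma>^2 and m through p turns the claim into an identity of
      rational functions.\<close>
    define p where "p = 1 + \<sigma>\<^sup>2"
    define m where "m = 1 - \<sigma>\<^sup>2"
    have pm: "p > 0" "m > 0" "m = 2 - p" "\<sigma>\<^sup>2 = p - 1"
      using pos one_minus_square_pos by (auto simp: p_def m_def)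
    have "- y\<^sup>2 / 2 + 2 * (- (\<sigma>\<^sup>2 * (x\<^sup>2 + y\<^sup>2) - 2 * \<sigma> * x * y) / (2 * m))
        = (- y\<^sup>2 * m - 2 * \<sigma>\<^sup>2 * x\<^sup>2 - 2 * \<sigma>\<^sup>2 * y\<^sup>2 + 4 * \<sigma> * x * y) / (2 * m)"
      using pm(2) by (simp add: field_simps)
    also have "\<dots> = (2 * \<sigma>\<^sup>2 / p) * x\<^sup>2 / 2 + - (y - 2 * \<sigma> * x / p)\<^sup>2 / (2 * (m / p))"
    proof -
      have "(y - 2 * \<sigma> * x / p)\<^sup>2 = (y\<^sup>2 * p\<^sup>2 - 4 * \<sigma> * x * y * p + 4 * \<sigma>\<^sup>2 * x\<^sup>2) / p\<^sup>2"
        using pm(1) by (simp add: field_simps power2_eq_square)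
      moreover have "(- y\<^sup>2 * m - 2 * \<sigma>\<^sup>2 * x\<^sup>2 - 2 * \<sigma>\<^sup>2 * y\<^sup>2 + 4 * \<sigma> * x * y) / (2 * m)
        = (2 * \<sigma>\<^sup>2 / p) * x\<^sup>2 / 2 + - ((y\<^sup>2 * p\<^sup>2 - 4 * \<sigma> * x * y * p + 4 * \<sigma>\<^sup>2 * x\<^sup>2) / p\<^sup>2) / (2 * (m / p))"
        using pm(1,2) unfolding pm(4) by (simp add: divide_simps) (simp add: pm(3) power2_eq_square algebra_simps)
      ultimately show ?thesis by simp
    qed
    finally show ?thesis by (simp add: p_def m_def v_def)
  qed
  have sq: "(pair_lr \<sigma> x y)\<^sup>2 = exp (2 * (- (\<sigma>\<^sup>2 * (x\<^sup>2 + y\<^sup>2) - 2 * \<sigma> * x * y) / (2 * (1 - \<sigma>\<^sup>2)))) / (1 - \<sigma>\<^sup>2)"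
    unfolding pair_lr_def power_divide exp_double[symmetric] using one_minus_square_pos by simp
  have "std_normal_density y * (pair_lr \<sigma> x y)\<^sup>2
      = exp (- y\<^sup>2 / 2 + 2 * (- (\<sigma>\<^sup>2 * (x\<^sup>2 + y\<^sup>2) - 2 * \<sigma> * x * y) / (2 * (1 - \<sigma>\<^sup>2)))) / (sqrt (2 * pi) * (1 - \<sigma>\<^sup>2))"
    unfolding sq std_normal_density_def exp_add by simp
  also have "\<dots> = (sqrt v / (1 - \<sigma>\<^sup>2) * exp ((2 * \<sigma>\<^sup>2 / (1 + \<sigma>\<^sup>2)) * x\<^sup>2 / 2)) * normal_density (2 * \<sigma> * x / (1 + \<sigma>\<^sup>2)) (sqrt v) y"
    unfolding expo exp_add normal_density_def using v by (simp add: real_sqrt_mult)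
  finally show ?thesis by (simp add: v_def)
qed

text \<open>All moments are iterated integrals with y innermost, where \<open>pair_lr\<close> turns
  the standard normal density into another one; in the mixed moment the inner integral is x times
  the conditional mean \<sigma> x.\<close>

lemma pair_lr_moments:
  "integrable (std_gaussians I) (\<lambda>x. (pair_lr \<sigma> (x i) (x j))\<^sup>2)"
  "(\<integral>x. pair_lr \<sigma> (x i) (x j) \<partial>std_gaussians I) = 1"
  "(\<integral>x. (pair_lr \<sigma> (x i) (x j))\<^sup>2 \<partial>std_gaussians I) = 1 / (1 - \<sigma>\<^sup>2)"
  "(\<integral>x. pair_lr \<sigma> (x i) (x j) * (x i * x j) \<partial>std_gaussians I) = \<sigma>"
proof -
  note coordinate_measurable[measurable] pair_lr_coordinates_measurable[measurable]
  have section_measurable[measurable]: "pair_lr \<sigma> x \<in> borel_measurable borel" for x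
    unfolding pair_lr_def by measurable
  have pos: "1 + \<sigma>\<^sup>2 > 0" by (simp add: add_pos_nonneg)
  have "(\<integral>\<^sup>+x. ennreal (pair_lr \<sigma> (x i) (x j)) \<partial>std_gaussians I)
      = (\<integral>\<^sup>+x. (\<integral>\<^sup>+y. ennreal (pair_lr \<sigma> x y) \<partial>std_gaussian) \<partial>std_gaussian)"
    by (rule nn_integral_coordinate_pair) measurable
  also have "\<dots> = (\<integral>\<^sup>+x. ennreal 1 \<partial>std_gaussian)"
    using one_minus_square_pos
    by (intro nn_integral_cong nn_integral_std_gaussian[where s = "sqrt (1 - \<sigma>\<^sup>2)"])
       (auto simp: std_normal_density_pair_lr pair_lr_nonneg \<sigma>)
  also have "\<dots> = 1" using S.emeasure_space_1 by simp
  finally have "(\<integral>\<^sup>+x. ennreal (pair_lr \<sigma> (x i) (x j)) \<partial>std_gaussians I) = 1" .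
  then show "(\<integral>x. pair_lr \<sigma> (x i) (x j) \<partial>std_gaussians I) = 1"
    by (subst integral_eq_nn_integral) (auto simp: pair_lr_nonneg \<sigma>)
  define v where "v = (1 - \<sigma>\<^sup>2) / (1 + \<sigma>\<^sup>2)"
  have v: "v > 0" using one_minus_square_pos pos by (simp add: v_def)
  \<comment> \<open>This is 1 - \<tau> for the \<tau> of the outer integral, whose value 1 / sqrt v
    cancels the sqrt v from the inner one.\<close>
  have v': "1 - 2 * \<sigma>\<^sup>2 / (1 + \<sigma>\<^sup>2) = v" using pos by (simp add: v_def field_simps)
  have "(\<integral>\<^sup>+x. ennreal ((pair_lr \<sigma> (x i) (x j))\<^sup>2) \<partial>std_gaussians I)
      = (\<integral>\<^sup>+x. (\<integral>\<^sup>+y. ennreal ((pair_lr \<sigma> x y)\<^sup>2) \<partial>std_gaussian) \<partial>std_gaussian)"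
    by (rule nn_integral_coordinate_pair) measurable
  also have "\<dots> = (\<integral>\<^sup>+x. ennreal (sqrt v / (1 - \<sigma>\<^sup>2) * exp ((2 * \<sigma>\<^sup>2 / (1 + \<sigma>\<^sup>2)) * x\<^sup>2 / 2)) \<partial>std_gaussian)"
    unfolding v_def using one_minus_square_pos pos
    by (intro nn_integral_cong nn_integral_std_gaussian[OF _ _ _ _ std_normal_density_pair_lr_square]) auto
  also have "\<dots> = ennreal (sqrt v / (1 - \<sigma>\<^sup>2)) * (\<integral>\<^sup>+x. ennreal (exp ((2 * \<sigma>\<^sup>2 / (1 + \<sigma>\<^sup>2)) * x\<^sup>2 / 2)) \<partial>std_gaussian)"
  proof -
    have "ennreal (sqrt v / (1 - \<sigma>\<^sup>2) * z) = ennreal (sqrt v / (1 - \<sigma>\<^sup>2)) * ennreal z" if "z \<ge> 0" for z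
      using one_minus_square_pos v that by (intro ennreal_mult) auto
    then show ?thesis by (subst nn_integral_cmult[symmetric]) auto
  qed
  also have "\<dots> = ennreal (sqrt v / (1 - \<sigma>\<^sup>2)) * ennreal (1 / sqrt v)"
    using v v' by (subst std_gaussian_square_mgf) auto
  also have "\<dots> = ennreal (1 / (1 - \<sigma>\<^sup>2))"
    using one_minus_square_pos v by (subst ennreal_mult[symmetric]) auto
  finally have nn: "(\<integral>\<^sup>+x. ennreal ((pair_lr \<sigma> (x i) (x j))\<^sup>2) \<partial>std_gaussians I) = ennreal (1 / (1 - \<sigma>\<^sup>2))" .
  show int: "integrable (std_gaussians I) (\<lambda>x. (pair_lr \<sigma> (x i) (x j))\<^sup>2)"
    by (rule integrableI_nonneg) (use nn in auto)
  show "(\<integral>x. (pair_lr \<sigma> (x i) (x j))\<^sup>2 \<partial>std_gaussians I) = 1 / (1 - \<sigma>\<^sup>2)"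
    using nn one_minus_square_pos by (subst integral_eq_nn_integral) auto
  have "integrable (std_gaussians I) (\<lambda>x. pair_lr \<sigma> (x i) (x j) * (x i * x j))"
    by (rule integrable_mult_of_squares[OF _ _ int feature_pair_moments(1)]) measurable
  then have "(\<integral>x. pair_lr \<sigma> (x i) (x j) * (x i * x j) \<partial>std_gaussians I)
      = (\<integral>x. (\<integral>y. pair_lr \<sigma> x y * (x * y) \<partial>std_gaussian) \<partial>std_gaussian)"
    by (intro integral_coordinate_pair) measurable
  also have "\<dots> = (\<integral>x. \<sigma> * x\<^sup>2 \<partial>std_gaussian)"
  proof (intro Bochner_Integration.integral_cong refl)
    fix x
    have "(\<integral>y. pair_lr \<sigma> x y * (x * y) \<partial>std_gaussian) = (\<integral>y. std_normal_density y * (pair_lr \<sigma> x y * (x * y)) \<partial>lborel)"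
      by (rule integral_std_gaussian) measurable
    also have "\<dots> = (\<integral>y. x * (normal_density (\<sigma> * x) (sqrt (1 - \<sigma>\<^sup>2)) y * y) \<partial>lborel)"
      unfolding std_normal_density_pair_lr[symmetric] by (simp add: mult_ac)
    also have "\<dots> = x * (\<sigma> * x)"
      using one_minus_square_pos by (simp add: integral_normal_moment_nz_1)
    finally show "(\<integral>y. pair_lr \<sigma> x y * (x * y) \<partial>std_gaussian) = \<sigma> * x\<^sup>2" by (simp add: power2_eq_square)
  qed
  also have "\<dots> = \<sigma>" by (simp add: std_gaussian_moments)
  finally show "(\<integral>x. pair_lr \<sigma> (x i) (x j) * (x i * x j) \<partial>std_gaussians I) = \<sigma>" .
qed

end

end

section \<open>The lower bound for pairwise correlated Gaussians\<close>

text \<open>Only the pairs with one element below and one element above \<open>h\<close> are used, because the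
  generating function of a bilinear form is easier to control than that of a general quadratic form.\<close>

definition bipartite_pairs :: "nat \<Rightarrow> nat \<Rightarrow> nat set set" where
  "bipartite_pairs h d = (\<lambda>(i, j). {i, j}) ` ({..<h} \<times> {h..<d})"

lemma inj_on_bipartite_pairs: "inj_on (\<lambda>(i, j). {i, j}) ({..<h} \<times> {h..<d :: nat})"
  by (auto simp: inj_on_def doubleton_eq_iff)

lemma card_bipartite_pairs: "card (bipartite_pairs h d) = h * (d - h)"
  unfolding bipartite_pairs_def using card_image[OF inj_on_bipartite_pairs] by (simp add: card_cartesian_product)

text \<open>The indices are two-element sets, from which \<open>Min\<close> and \<open>Max\<close>
  recover the coordinates below and above h. Since these come from disjoint groups, a combination of
  features is a bilinear form, to which \<open>bilinear_form_mgf\<close> applies.\<close>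

lemma weakly_correlated_pair_gaussians:
  assumes h: "h \<le> d" and \<sigma>: "0 < \<sigma>" "\<sigma> < 1"
  shows "weakly_correlated (std_gaussians {..<d}) (bipartite_pairs h d)
    (\<lambda>I x. pair_lr \<sigma> (x (Min I)) (x (Max I))) (\<lambda>I x. x (Min I) * x (Max I)) \<sigma>"
proof -
  interpret P: prob_space "std_gaussians {..<d}" by (rule prob_space_std_gaussians)
  have pair: "Min I \<in> {..<d}" "Max I \<in> {..<d}" "Min I \<noteq> Max I" if "I \<in> bipartite_pairs h d" for I
    using that h by (auto simp: bipartite_pairs_def)
  note fin = finite_lessThan[of d]
  show ?thesis
  proof
    show "finite (bipartite_pairs h d)" by (simp add: bipartite_pairs_def)
    show "0 < \<sigma>" "\<sigma> < 1" by fact+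
    fix b :: "nat set \<Rightarrow> real"
    have reindex: "(\<Sum>I\<in>bipartite_pairs h d. F I) = (\<Sum>j\<in>{h..<d}. \<Sum>i\<in>{..<h}. F {i, j})" for F :: "nat set \<Rightarrow> real"
    proof -
      have "(\<Sum>I\<in>bipartite_pairs h d. F I) = (\<Sum>p\<in>{..<h} \<times> {h..<d}. F {fst p, snd p})"
        unfolding bipartite_pairs_def by (subst sum.reindex[OF inj_on_bipartite_pairs]) (auto intro!: sum.cong)
      also have "\<dots> = (\<Sum>i\<in>{..<h}. \<Sum>j\<in>{h..<d}. F {i, j})" by (simp add: sum.cartesian_product case_prod_beta)
      also have "\<dots> = (\<Sum>j\<in>{h..<d}. \<Sum>i\<in>{..<h}. F {i, j})" by (rule sum.swap)
      finally show ?thesis .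
    qed
    assume "(\<Sum>I\<in>bipartite_pairs h d. (b I)\<^sup>2) \<le> 1 / 2"
    then have small: "(\<Sum>j\<in>{h..<d}. \<Sum>i\<in>{..<h}. (b {i, j})\<^sup>2) \<le> 1 / 2" by (simp only: reindex)
    have dis: "{..<h} \<inter> {h..<d} = {}" by auto
    have un: "{..<h} \<union> {h..<d} = {..<d}" using h by auto
    have "(\<Sum>I\<in>bipartite_pairs h d. b I * (x (Min I) * x (Max I))) = (\<Sum>j\<in>{h..<d}. \<Sum>i\<in>{..<h}. b {i, j} * x i * x j)" for x :: "nat \<Rightarrow> real"
      unfolding reindex by (intro sum.cong refl) auto
    then show "(\<integral>\<^sup>+x. ennreal (exp (\<Sum>I\<in>bipartite_pairs h d. b I * (x (Min I) * x (Max I)))) \<partial>std_gaussians {..<d})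
        \<le> ennreal (exp (\<Sum>I\<in>bipartite_pairs h d. (b I)\<^sup>2))"
      using bilinear_form_mgf[of "{..<h}" "{h..<d}" "\<lambda>i j. b {i, j}", OF _ _ dis small] by (simp add: un reindex)
  next
    fix I assume I: "I \<in> bipartite_pairs h d"
    note p = pair[OF I] fin
    note coordinate_measurable[OF p, measurable]
    show "(\<lambda>x. pair_lr \<sigma> (x (Min I)) (x (Max I))) \<in> borel_measurable (std_gaussians {..<d})"
      by (rule pair_lr_coordinates_measurable[OF p \<sigma>])
    show "(\<lambda>x. x (Min I) * x (Max I)) \<in> borel_measurable (std_gaussians {..<d})" by measurable
    show "pair_lr \<sigma> (x (Min I)) (x (Max I)) \<ge> 0" for x by (rule pair_lr_nonneg[OF \<sigma>])
    show "integrable (std_gaussians {..<d}) (\<lambda>x. (pair_lr \<sigma> (x (Min I)) (x (Max I)))\<^sup>2)"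
      "(\<integral>x. pair_lr \<sigma> (x (Min I)) (x (Max I)) \<partial>std_gaussians {..<d}) = 1"
      "(\<integral>x. (pair_lr \<sigma> (x (Min I)) (x (Max I)))\<^sup>2 \<partial>std_gaussians {..<d}) = 1 / (1 - \<sigma>\<^sup>2)"
      "(\<integral>x. pair_lr \<sigma> (x (Min I)) (x (Max I)) * (x (Min I) * x (Max I)) \<partial>std_gaussians {..<d}) = \<sigma>"
      by (rule pair_lr_moments[OF p \<sigma>])+
    show "integrable (std_gaussians {..<d}) (\<lambda>x. (x (Min I) * x (Max I))\<^sup>2)"
      "(\<integral>x. (x (Min I) * x (Max I))\<^sup>2 \<partial>std_gaussians {..<d}) = 1"
      "(\<integral>x. x (Min I) * x (Max I) \<partial>std_gaussians {..<d}) = 0"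
      by (rule feature_pair_moments[OF p])+
  qed
qed

lemma identifying_algorithm_subset:
  assumes alg: "identifying_algorithm t s l K M \<epsilon> f u h" and K': "K' \<subseteq> K"
    and M': "\<And>i. i \<in> K' \<Longrightarrow> M i = M' i"
  shows "identifying_algorithm t s l K' M' \<epsilon> f u h"
  unfolding identifying_algorithm_def
proof (intro conjI ballI)
  show "length u = s" using alg unfolding identifying_algorithm_def by blast
  fix i assume i: "i \<in> K'"
  then have iK: "i \<in> K" using K' by blast
  show "\<forall>j<t * l. \<forall>v. length v = s \<longrightarrow> length (f j x v) = s" if "x \<in> space (M' i)" for x
    using alg that iK unfolding identifying_algorithm_def M'[OF i, symmetric] by blast
  show "measure (PiM {..<t} (\<lambda>_. M' i)) {x \<in> space (PiM {..<t} (\<lambda>_. M' i)). h (memory_state t f u x (t * l)) = i} \<ge> 1 - \<epsilon>"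
    using alg iK unfolding identifying_algorithm_def M'[OF i, symmetric] by blast
qed

text \<open>Splitting the coordinates in the middle gives card K \<ge> d (d - 1) / 4 \<ge> d^2 / 6,
  and 6 * 6144 = 36864. From d \<ge> 9 follows card K \<ge> 12, and from d \<sigma> \<le> 1 follows
  card K * \<sigma>^2 \<le> 1.\<close>

lemma pair_gaussians_lower_bound:
  assumes d: "d \<ge> 9" and \<sigma>: "0 < \<sigma>" "\<sigma> < 1" "real d * \<sigma> \<le> 1"
    and tsl: "t \<ge> 1" "s \<ge> 1" "l \<ge> 1"
    and alg: "identifying_algorithm t s l (pair_sets d) (pair_gaussian d \<sigma>) (1 / 6) f u h"
  shows "(real d)\<^sup>2 \<le> 36864 * (real t * real s * real l * \<sigma>\<^sup>2)"
proof -
  define e where "e = d div 2"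
  define K where "K = bipartite_pairs e d"
  have e: "e \<le> d" by (simp add: e_def)
  interpret weakly_correlated "std_gaussians {..<d}" K
    "\<lambda>I x. pair_lr \<sigma> (x (Min I)) (x (Max I))" "\<lambda>I x. x (Min I) * x (Max I)" \<sigma>
    unfolding K_def by (rule weakly_correlated_pair_gaussians[OF e \<sigma>(1,2)])
  have sub: "K \<subseteq> pair_sets d"
    by (auto simp: K_def bipartite_pairs_def pair_sets_def e_def card_insert_if)
  have dens: "pair_gaussian d \<sigma> I = density (std_gaussians {..<d}) (\<lambda>x. ennreal (pair_lr \<sigma> (x (Min I)) (x (Max I))))"
    if I: "I \<in> K" for I
  proof -
    obtain i j where ij: "I = {i, j}" "i < e" "e \<le> j" "j < d"
      using I by (auto simp: K_def bipartite_pairs_def)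
    then have "Min I = i" "Max I = j" by auto
    then show ?thesis using pair_gaussian_eq_density[of i j d \<sigma>] ij \<sigma> by simp
  qed
  have card: "real (card K) = real e * real (d - e)" by (simp add: K_def card_bipartite_pairs)
  have "2 * e + 1 \<ge> d" "2 * (d - e) \<ge> d" by (auto simp: e_def)
  then have half: "2 * real e \<ge> real d - 1" "2 * real (d - e) \<ge> real d" by linarith+
  have "(real d)\<^sup>2 \<le> 6 * real (card K)"
  proof -
    have "(real d - 1) * real d \<le> (2 * real e) * (2 * real (d - e))"
      using half d by (intro mult_mono) auto
    then have "(real d - 1) * real d \<le> 4 * real (card K)" by (simp add: card)
    moreover have "2 * (real d)\<^sup>2 \<le> 3 * ((real d - 1) * real d)"
    proof -
      have "2 * real d \<le> 3 * (real d - 1)" using d by simp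
      then have "2 * real d * real d \<le> 3 * (real d - 1) * real d" by (intro mult_right_mono) auto
      then show ?thesis by (simp add: power2_eq_square algebra_simps)
    qed
    ultimately show ?thesis by linarith
  qed
  moreover have "real (card K) \<le> 6144 * (real t * real s * real l * \<sigma>\<^sup>2)"
  proof (rule identification_lower_bound)
    have "9\<^sup>2 \<le> (real d)\<^sup>2" using d by (intro power_mono) auto
    then show "card K \<ge> 12" using \<open>(real d)\<^sup>2 \<le> 6 * real (card K)\<close> by simp
    have "e * (d - e) \<le> d * d" by (intro mult_le_mono) (auto simp: e_def)
    then have "card K \<le> d * d" by (simp add: K_def card_bipartite_pairs)
    then have "real (card K) \<le> real (d * d)" by (rule of_nat_mono)
    then have "real (card K) \<le> (real d)\<^sup>2" by (simp add: power2_eq_square)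
    then have "real (card K) * \<sigma>\<^sup>2 \<le> (real d)\<^sup>2 * \<sigma>\<^sup>2" by (intro mult_right_mono) auto
    also have "\<dots> = (real d * \<sigma>)\<^sup>2" by (simp add: power_mult_distrib)
    also have "\<dots> \<le> 1" using \<sigma> by (simp add: power_le_one)
    finally show "real (card K) * \<sigma>\<^sup>2 \<le> 1" .
    show "identifying_algorithm t s l K (\<lambda>I. density (std_gaussians {..<d}) (\<lambda>x. ennreal (pair_lr \<sigma> (x (Min I)) (x (Max I))))) (1 / 6) f u h"
      by (rule identifying_algorithm_subset[OF alg sub dens])
  qed (rule tsl)+
  ultimately show ?thesis by linarith
qed

theorem theorem6:
  shows "\<exists>C C' :: real. C > 0 \<and> C' > 0 \<and>
    (\<forall>d :: nat. d \<ge> 3 \<and> real d \<ge> C' \<longrightarrow>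
      (\<forall>\<sigma> :: real. 0 < \<sigma> \<and> \<sigma> < 1 \<and>
          \<sigma> \<le> inverse (C * real d ^ 3 * sqrt (ln (real d)) * ln (real d / \<sigma>)) \<longrightarrow>
        (\<forall>(t :: nat) (s :: nat) (l :: nat). t \<ge> 1 \<and> s \<ge> 1 \<and> l \<ge> 1 \<longrightarrow>
          (\<forall>(f :: nat \<Rightarrow> (nat \<Rightarrow> real) \<Rightarrow> bool list \<Rightarrow> bool list) (u :: bool list)
              (h :: bool list \<Rightarrow> nat set).
            identifying_algorithm t s l (pair_sets d) (pair_gaussian d \<sigma>) (1 / 6) f u h \<longrightarrow>
            real t * real s * real l
              \<ge> (real d)\<^sup>2 / (C * \<sigma>\<^sup>2 * ln (real d) ^ 3 * (ln (1 / \<sigma>))\<^sup>2)))))"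
\<comment> \<open>36864 is the constant of \<open>pair_gaussians_lower_bound\<close> and 9 its
  threshold for d. That bound is free of logarithms; dividing by the logarithmic factors, all at
  least 1 here, lowers its left side d^2 / (36864 \<sigma>^2) further.\<close>
proof (rule exI[of _ 36864], rule exI[of _ 9], intro conjI allI impI)
  fix d t s l :: nat and \<sigma> :: real and f :: "nat \<Rightarrow> (nat \<Rightarrow> real) \<Rightarrow> bool list \<Rightarrow> bool list"
    and u :: "bool list" and h :: "bool list \<Rightarrow> nat set"
  assume d: "d \<ge> 3 \<and> real d \<ge> 9"
    and \<sigma>: "0 < \<sigma> \<and> \<sigma> < 1 \<and> \<sigma> \<le> inverse (36864 * real d ^ 3 * sqrt (ln (real d)) * ln (real d / \<sigma>))"
    and tsl: "t \<ge> 1 \<and> s \<ge> 1 \<and> l \<ge> 1"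
    and alg: "identifying_algorithm t s l (pair_sets d) (pair_gaussian d \<sigma>) (1 / 6) f u h"
  have \<sigma>_pos: "0 < \<sigma>" and \<sigma>_less: "\<sigma> < 1"
    and \<sigma>_le: "\<sigma> \<le> inverse (36864 * real d ^ 3 * sqrt (ln (real d)) * ln (real d / \<sigma>))"
    using \<sigma> by blast+
  have d9: "real d \<ge> 9" using d by blast
  have ln_ge: "ln x \<ge> 1" if "x \<ge> 3" for x :: real
    using that exp_le by (subst ln_ge_iff) auto
  have ln_d: "ln (real d) \<ge> 1" using d9 by (intro ln_ge) linarith+
  have "real d * \<sigma> \<le> real d * 1" using \<sigma>_less by (intro mult_left_mono) simp_all
  then have "real d \<le> real d / \<sigma>" using \<sigma>_pos by (simp add: le_divide_eq)
  then have "3 \<le> real d / \<sigma>" using d9 by linarith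
  then have ln_d\<sigma>: "ln (real d / \<sigma>) \<ge> 1" by (rule ln_ge)
  have "1 \<le> sqrt (ln (real d))" using ln_d by simp
  then have "1 * 1 \<le> sqrt (ln (real d)) * ln (real d / \<sigma>)" using ln_d\<sigma> by (intro mult_mono) auto
  then have "36864 * real d ^ 3 * 1 \<le> 36864 * real d ^ 3 * (sqrt (ln (real d)) * ln (real d / \<sigma>))"
    by (intro mult_left_mono) auto
  moreover have "real d \<le> 36864 * real d ^ 3"
  proof -
    have "real d ^ 1 \<le> real d ^ 3" using d9 by (intro power_increasing) simp_all
    then have "real d \<le> real d ^ 3" by (simp only: power_one_right)
    moreover have "0 \<le> real d ^ 3" by simp
    ultimately show ?thesis by linarith
  qed
  ultimately have "real d \<le> 36864 * real d ^ 3 * sqrt (ln (real d)) * ln (real d / \<sigma>)"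
    by (simp add: mult.assoc)
  then have "inverse (36864 * real d ^ 3 * sqrt (ln (real d)) * ln (real d / \<sigma>)) \<le> inverse (real d)"
    using d9 by (intro le_imp_inverse_le) simp_all
  then have "\<sigma> \<le> inverse (real d)" using \<sigma>_le by (rule order_trans[rotated])
  then have "real d * \<sigma> \<le> real d * inverse (real d)" by (intro mult_left_mono) auto
  then have d\<sigma>: "real d * \<sigma> \<le> 1" using d9 by simp
  then have "real d \<le> 1 / \<sigma>" using \<sigma>_pos by (simp add: le_divide_eq)
  then have "3 \<le> 1 / \<sigma>" using d9 by linarith
  then have ln_\<sigma>: "ln (1 / \<sigma>) \<ge> 1" by (rule ln_ge)
  have main: "(real d)\<^sup>2 \<le> 36864 * (real t * real s * real l * \<sigma>\<^sup>2)"
  proof (rule pair_gaussians_lower_bound[OF _ _ _ d\<sigma> _ _ _ alg])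
    show "9 \<le> d" using d9 by simp
  qed (use \<sigma>_pos \<sigma>_less tsl in blast)+
  have \<sigma>2: "\<sigma>\<^sup>2 > 0" using \<sigma>_pos by simp
  have "1 * 1 \<le> ln (real d) ^ 3 * (ln (1 / \<sigma>))\<^sup>2"
    using ln_d ln_\<sigma> by (intro mult_mono one_le_power) auto
  then have "36864 * \<sigma>\<^sup>2 * 1 \<le> 36864 * \<sigma>\<^sup>2 * (ln (real d) ^ 3 * (ln (1 / \<sigma>))\<^sup>2)"
    using \<sigma>2 by (intro mult_left_mono) auto
  then have "36864 * \<sigma>\<^sup>2 \<le> 36864 * \<sigma>\<^sup>2 * ln (real d) ^ 3 * (ln (1 / \<sigma>))\<^sup>2"
    by (simp only: mult_1_right mult.assoc)
  then have "(real d)\<^sup>2 / (36864 * \<sigma>\<^sup>2 * ln (real d) ^ 3 * (ln (1 / \<sigma>))\<^sup>2) \<le> (real d)\<^sup>2 / (36864 * \<sigma>\<^sup>2)"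
    by (rule frac_le[rotated 3]) (use \<sigma>2 in simp_all)
  also have "\<dots> \<le> real t * real s * real l"
    using main \<sigma>2 by (simp add: divide_le_eq mult_ac)
  finally show "real t * real s * real l \<ge> (real d)\<^sup>2 / (36864 * \<sigma>\<^sup>2 * ln (real d) ^ 3 * (ln (1 / \<sigma>))\<^sup>2)" .
qed auto

end
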